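(* Let $(E,\mathcal{L},\mathcal{B})$ be a weakly left-resolving labelled space. Then there exists a $C^*$-algebra $B$ generated by a universal representation $\{s_a,p_A\}$ of $(E,\mathcal{L},\mathcal{B})$. Furthermore, the $s_a$'s are nonzero and every $p_A$ with $A\neq\emptyset$ is nonzero.
   Context: A labelled graph $(E,\mathcal{L})$ over an alphabet $\mathcal{A}$ is a directed graph $E=(E^0,E^1,r,s)$ together with a map $\mathcal{L}:E^1\to\mathcal{A}$. Paths are $e_1e_2\cdots e_m$ with $r(e_i)=s(e_{i+1})$; $E^m$ is the set of paths of length $m$; $\mathcal{L}(e_1\cdots e_m)=\mathcal{L}(e_1)\cdots\mathcal{L}(e_m)$; $\mathcal{L}^*(E)=\bigcup_{m\ge1}\mathcal{L}(E^m)$ is the set of labelled paths. For $A\subset E^0$ and a labelled path $\alpha$, the relative range is $r(A,\alpha)=\{r(\lambda):\lambda\text{ a path},\ \mathcal{L}(\lambda)=\alpha,\ s(\lambda)\in A\}$, and $r(\alpha)=r(E^0,\alpha)$, $s(\alpha)=\{s(\lambda):\mathcal{L}(\lambda)=\alpha\}$. A sink is a vertex emitting no edges. A collection $\mathcal{B}\subset2^{E^0}$ is accommodating for $(E,\mathcal{L})$ if $r(A,\alpha)\in\mathcal{B}$ for all $A\in\mathcal{B}$, $\alpha\in\mathcal{L}^*(E)$; $r(\alpha)\in\mathcal{B}$ for all $\alpha\in\mathcal{L}^*(E)$; $\{v\}\in\mathcal{B}$ for every sink $v$; and $\mathcal{B}$ is closed under finite unions and intersections. A labelled space is a triple $(E,\mathcal{L},\mathcal{B})$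 where $(E,\mathcal{L})$ is a labelled graph and $\mathcal{B}$ is accommodating for $(E,\mathcal{L})$. It is weakly left-resolving if $r(A,\alpha)\cap r(B,\alpha)=r(A\cap B,\alpha)$ for all $A,B\in\mathcal{B}$, $\alpha\in\mathcal{L}^*(E)$. A representation of a weakly left-resolving labelled space $(E,\mathcal{L},\mathcal{B})$ is a collection $\{p_A:A\in\mathcal{B}\}$ of projections and a collection $\{s_a:a\in\mathcal{L}(E^1)\}$ of partial isometries such that: (1) for $A,B\in\mathcal{B}$, $p_Ap_B=p_{A\cap B}$ and $p_{A\cup B}=p_A+p_B-p_{A\cap B}$, where $p_\emptyset=0$; (2) for $a\in\mathcal{L}(E^1)$ and $A\in\mathcal{B}$, $p_As_a=s_ap_{r(A,a)}$; (3) for $a,b\in\mathcal{L}(E^1)$, $s_a^*s_a=p_{r(a)}$ and $s_a^*s_b=0$ unless $a=b$; (4) for $A\in\mathcal{B}$ define $L^1(A)=\{a\in\mathcal{L}(E^1):s(a)\cap A\ne\emptyset\}$; if $L^1(A)$ is finite and non-empty, then $p_A=\sum_{a\in L^1(A)}s_ap_{r(A,a)}s_a^*+\sum_{v\in A,\ v\text{ a sink}}p_{\{v\}}$. A representation $\{s_a,p_A\}$ generating a $C^*$-algebra $B$ is universal if for every representation $\{t_a,q_A\}$ in a $C^*$-algebra $D$ there is a $*$-homomorphism $B\to D$ with $s_a\mapsto t_a$ and $p_A\mapsto q_A$.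
   Formalization: Relation (4) is imposed only when A contains finitely many sinks, as an infinite sum of nonzero orthogonal projections cannot converge in norm; universality is stated for each type of target algebra, the resulting algebras B being canonically isomorphic. *)

theory Defs
  imports
    "HOL-Analysis.Abstract_Metric_Spaces"
    "HOL-Algebra.Algebraic_Closure_Type"
    "Graph_Theory.Arc_Walk"
begin

section \<open>C*-algebras\<close>

text \<open>
  C*-algebras are not assumed unital; the field \<open>one\<close>, which the record inherits from
  the HOL-Algebra type of modules, carries no meaning.
\<close>

record 'x cstar_struct = "(complex, 'x) module" +
  star :: "'x \<Rightarrow> 'x" (\<open>(_\<^sup>\<star>\<index>)\<close> [1000] 999)
  nrm :: "'x \<Rightarrow> real"

text \<open>
  The value off the carrier is irrelevant, but the library's \<^locale>\<open>Metric_space\<close> asks for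
  a nonnegative symmetric function on the whole type.
\<close>

definition cstar_dist :: "'x cstar_struct \<Rightarrow> 'x \<Rightarrow> 'x \<Rightarrow> real" where
  "cstar_dist B x y =
     (if x \<in> carrier B \<and> y \<in> carrier B then nrm B (x \<ominus>\<^bsub>B\<^esub> y) else 0)"

locale cstar_algebra =
  Module.module "ring_of_type_algebra :: complex ring" B
  for B :: "'x cstar_struct" (structure) +
  assumes mult_closed: "\<lbrakk>x \<in> carrier B; y \<in> carrier B\<rbrakk> \<Longrightarrow> x \<otimes> y \<in> carrier B"
    and mult_assoc: "\<lbrakk>x \<in> carrier B; y \<in> carrier B; z \<in> carrier B\<rbrakk>
        \<Longrightarrow> (x \<otimes> y) \<otimes> z = x \<otimes> (y \<otimes> z)"
    and mult_add_left: "\<lbrakk>x \<in> carrier B; y \<in> carrier B; z \<in> carrier B\<rbrakk>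
        \<Longrightarrow> (x \<oplus> y) \<otimes> z = x \<otimes> z \<oplus> y \<otimes> z"
    and mult_add_right: "\<lbrakk>x \<in> carrier B; y \<in> carrier B; z \<in> carrier B\<rbrakk>
        \<Longrightarrow> z \<otimes> (x \<oplus> y) = z \<otimes> x \<oplus> z \<otimes> y"
    and smult_mult_left: "\<lbrakk>x \<in> carrier B; y \<in> carrier B\<rbrakk>
        \<Longrightarrow> (c \<odot> x) \<otimes> y = c \<odot> (x \<otimes> y)"
    and smult_mult_right: "\<lbrakk>x \<in> carrier B; y \<in> carrier B\<rbrakk>
        \<Longrightarrow> x \<otimes> (c \<odot> y) = c \<odot> (x \<otimes> y)"
    and star_closed: "x \<in> carrier B \<Longrightarrow> x\<^sup>\<star> \<in> carrier B"
    and star_star: "x \<in> carrier B \<Longrightarrow> (x\<^sup>\<star>)\<^sup>\<star> = x"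
    and star_add: "\<lbrakk>x \<in> carrier B; y \<in> carrier B\<rbrakk> \<Longrightarrow> (x \<oplus> y)\<^sup>\<star> = x\<^sup>\<star> \<oplus> y\<^sup>\<star>"
    and star_smult: "x \<in> carrier B \<Longrightarrow> (c \<odot> x)\<^sup>\<star> = cnj c \<odot> x\<^sup>\<star>"
    and star_mult: "\<lbrakk>x \<in> carrier B; y \<in> carrier B\<rbrakk> \<Longrightarrow> (x \<otimes> y)\<^sup>\<star> = y\<^sup>\<star> \<otimes> x\<^sup>\<star>"
    and nrm_nonneg: "x \<in> carrier B \<Longrightarrow> 0 \<le> nrm B x"
    and nrm_eq_zero: "x \<in> carrier B \<Longrightarrow> nrm B x = 0 \<longleftrightarrow> x = \<zero>"
    and nrm_triangle: "\<lbrakk>x \<in> carrier B; y \<in> carrier B\<rbrakk>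
        \<Longrightarrow> nrm B (x \<oplus> y) \<le> nrm B x + nrm B y"
    and nrm_smult: "x \<in> carrier B \<Longrightarrow> nrm B (c \<odot> x) = cmod c * nrm B x"
    and nrm_mult: "\<lbrakk>x \<in> carrier B; y \<in> carrier B\<rbrakk>
        \<Longrightarrow> nrm B (x \<otimes> y) \<le> nrm B x * nrm B y"
    and nrm_cstar: "x \<in> carrier B \<Longrightarrow> nrm B (x\<^sup>\<star> \<otimes> x) = (nrm B x)\<^sup>2"
    and complete: "Metric_space.mcomplete (carrier B) (cstar_dist B)"
begin

sublocale metric: Metric_space "carrier B" "cstar_dist B"
proof
  fix x y z
  show "0 \<le> cstar_dist B x y"
    by (simp add: cstar_dist_def nrm_nonneg)
  show "cstar_dist B x y = cstar_dist B y x"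
  proof (cases "x \<in> carrier B \<and> y \<in> carrier B")
    case True
    have "(-1) \<odot> (x \<ominus> y) \<oplus> (x \<ominus> y) = \<zero>"
      using True smult_l_distr[of "-1" 1 "x \<ominus> y"] smult_one[of "x \<ominus> y"]
        smult_l_null[of "x \<ominus> y"]
      by (simp add: ring_of_type_algebra_def)
    hence "\<ominus> (x \<ominus> y) = (-1) \<odot> (x \<ominus> y)"
      using True smult_closed[of "-1" "x \<ominus> y"]
      by (intro M.minus_equality) (simp_all add: ring_of_type_algebra_def)
    hence "nrm B (\<ominus> (x \<ominus> y)) = nrm B (x \<ominus> y)"
      using True by (simp add: nrm_smult)
    moreover have "\<ominus> (x \<ominus> y) = y \<ominus> x"
      using True by (simp add: M.minus_add M.minus_minus a_minus_def M.a_comm)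
    ultimately show ?thesis
      using True by (simp add: cstar_dist_def)
  qed (auto simp: cstar_dist_def)
  show "cstar_dist B x y = 0 \<longleftrightarrow> x = y" if "x \<in> carrier B" "y \<in> carrier B"
    using that M.minus_equality[of x "\<ominus> y"] M.r_neg[of y]
    by (auto simp: cstar_dist_def nrm_eq_zero a_minus_def)
  show "cstar_dist B x z \<le> cstar_dist B x y + cstar_dist B y z"
    if "x \<in> carrier B" "y \<in> carrier B" "z \<in> carrier B"
  proof -
    have "x \<ominus> z = (x \<ominus> y) \<oplus> (y \<ominus> z)"
      using that
      by (simp add: a_minus_def M.a_assoc M.r_neg1)
    thus ?thesis
      using that by (simp add: cstar_dist_def nrm_triangle)
  qed
qed

definition projection :: "'x \<Rightarrow> bool" where
  "projection x \<longleftrightarrow> x \<in> carrier B \<and> x\<^sup>\<star> = x \<and> x \<otimes> x = x"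

definition partial_isometry :: "'x \<Rightarrow> bool" where
  "partial_isometry x \<longleftrightarrow> x \<in> carrier B \<and> x \<otimes> x\<^sup>\<star> \<otimes> x = x"

definition cstar_subalgebra :: "'x set \<Rightarrow> bool" where
  "cstar_subalgebra C \<longleftrightarrow>
     C \<subseteq> carrier B \<and> \<zero> \<in> C \<and>
     (\<forall>x\<in>C. \<forall>y\<in>C. x \<oplus> y \<in> C \<and> x \<otimes> y \<in> C) \<and>
     (\<forall>x\<in>C. x\<^sup>\<star> \<in> C \<and> (\<forall>c. c \<odot> x \<in> C)) \<and>
     closedin metric.mtopology C"

definition generated_by :: "'x set \<Rightarrow> bool" where
  "generated_by S \<longleftrightarrow>
     S \<subseteq> carrier B \<and> \<Inter> {C. cstar_subalgebra C \<and> S \<subseteq> C} = carrier B"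

end

definition star_hom :: "'x cstar_struct \<Rightarrow> 'y cstar_struct \<Rightarrow> ('x \<Rightarrow> 'y) \<Rightarrow> bool" where
  "star_hom B D \<phi> \<longleftrightarrow>
     \<phi> \<in> carrier B \<rightarrow> carrier D \<and>
     (\<forall>x\<in>carrier B. \<forall>y\<in>carrier B.
        \<phi> (x \<oplus>\<^bsub>B\<^esub> y) = \<phi> x \<oplus>\<^bsub>D\<^esub> \<phi> y \<and> \<phi> (x \<otimes>\<^bsub>B\<^esub> y) = \<phi> x \<otimes>\<^bsub>D\<^esub> \<phi> y) \<and>
     (\<forall>x\<in>carrier B.
        \<phi> (x\<^sup>\<star>\<^bsub>B\<^esub>) = (\<phi> x)\<^sup>\<star>\<^bsub>D\<^esub> \<and> (\<forall>c. \<phi> (c \<odot>\<^bsub>B\<^esub> x) = c \<odot>\<^bsub>D\<^esub> \<phi> x))"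


section \<open>Labelled graphs and labelled spaces\<close>

text \<open>
  The source and range maps of the graph are \<^const>\<open>tail\<close> and \<^const>\<open>head\<close>. The alphabet is a
  type; \<open>letters\<close> is the set of letters that occur as labels. Labelled paths are nonempty
  lists of letters.
\<close>

locale labelled_graph = wf_digraph G
  for G :: "('v, 'e) pre_digraph" (structure) +
  fixes L :: "'e \<Rightarrow> 'a"
begin

definition letters :: "'a set" where
  "letters = L ` arcs G"

definition labelled_paths :: "'a list set" where
  "labelled_paths = {map L es | es u v. es \<noteq> [] \<and> awalk u es v}"

definition rel_range :: "'v set \<Rightarrow> 'a list \<Rightarrow> 'v set" where
  "rel_range A \<alpha> = {v. \<exists>u\<in>A. \<exists>es. es \<noteq> [] \<and> awalk u es v \<and> map L es = \<alpha>}"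

definition lab_range :: "'a list \<Rightarrow> 'v set" where
  "lab_range \<alpha> = rel_range (verts G) \<alpha>"

definition lab_source :: "'a list \<Rightarrow> 'v set" where
  "lab_source \<alpha> = {u. \<exists>es v. es \<noteq> [] \<and> awalk u es v \<and> map L es = \<alpha>}"

definition sinks :: "'v set" where
  "sinks = {v \<in> verts G. out_arcs G v = {}}"

definition emitted :: "'v set \<Rightarrow> 'a set" where
  "emitted A = {a \<in> letters. lab_source [a] \<inter> A \<noteq> {}}"

end

text \<open>
  Closure under finite unions and intersections means nonempty ones, so neither the empty
  set nor the full vertex set is required to be in \<open>\<B>\<close>.
\<close>

locale labelled_space = labelled_graph G L
  for G :: "('v, 'e) pre_digraph" (structure) and L :: "'e \<Rightarrow> 'a" +
  fixes \<B> :: "'v set set"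
  assumes sub_verts: "A \<in> \<B> \<Longrightarrow> A \<subseteq> verts G"
    and rel_range_closed: "\<lbrakk>A \<in> \<B>; \<alpha> \<in> labelled_paths\<rbrakk> \<Longrightarrow> rel_range A \<alpha> \<in> \<B>"
    and lab_range_closed: "\<alpha> \<in> labelled_paths \<Longrightarrow> lab_range \<alpha> \<in> \<B>"
    and sink_closed: "v \<in> sinks \<Longrightarrow> {v} \<in> \<B>"
    and Un_closed: "\<lbrakk>A \<in> \<B>; A' \<in> \<B>\<rbrakk> \<Longrightarrow> A \<union> A' \<in> \<B>"
    and Int_closed: "\<lbrakk>A \<in> \<B>; A' \<in> \<B>\<rbrakk> \<Longrightarrow> A \<inter> A' \<in> \<B>"

locale wlr_labelled_space = labelled_space G L \<B>
  for G :: "('v, 'e) pre_digraph" (structure) and L :: "'e \<Rightarrow> 'a" and \<B> +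
  assumes weakly_left_resolving: "\<lbrakk>A \<in> \<B>; A' \<in> \<B>; \<alpha> \<in> labelled_paths\<rbrakk>
      \<Longrightarrow> rel_range A \<alpha> \<inter> rel_range A' \<alpha> = rel_range (A \<inter> A') \<alpha>"


section \<open>Representations\<close>

text \<open>
  The sum over the sinks of \<open>A\<close> in \<open>rep_sum\<close> only makes sense in a C*-algebra if \<open>A\<close>
  contains finitely many sinks: a sum of infinitely many nonzero mutually orthogonal
  projections does not converge in norm. The relation is imposed exactly when its right-hand
  side is a finite sum.
\<close>

locale labelled_space_rep =
  wlr_labelled_space G L \<B> + cstar_algebra D
  for G :: "('v, 'e) pre_digraph" and L :: "'e \<Rightarrow> 'a" and \<B>
    and D :: "'x cstar_struct" (structure) +
  fixes s :: "'a \<Rightarrow> 'x" and p :: "'v set \<Rightarrow> 'x"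
  assumes rep_projection: "A \<in> \<B> \<Longrightarrow> projection (p A)"
    and rep_partial_isometry: "a \<in> letters \<Longrightarrow> partial_isometry (s a)"
    and rep_Int: "\<lbrakk>A \<in> \<B>; A' \<in> \<B>\<rbrakk> \<Longrightarrow> p A \<otimes> p A' = p (A \<inter> A')"
    and rep_Un: "\<lbrakk>A \<in> \<B>; A' \<in> \<B>\<rbrakk> \<Longrightarrow> p (A \<union> A') = p A \<oplus> p A' \<ominus> p (A \<inter> A')"
    and rep_empty: "{} \<in> \<B> \<Longrightarrow> p {} = \<zero>"
    and rep_commute: "\<lbrakk>a \<in> letters; A \<in> \<B>\<rbrakk> \<Longrightarrow> p A \<otimes> s a = s a \<otimes> p (rel_range A [a])"
    and rep_initial: "a \<in> letters \<Longrightarrow> (s a)\<^sup>\<star> \<otimes> s a = p (lab_range [a])"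
    and rep_orthogonal: "\<lbrakk>a \<in> letters; b \<in> letters; a \<noteq> b\<rbrakk> \<Longrightarrow> (s a)\<^sup>\<star> \<otimes> s b = \<zero>"
    and rep_sum: "\<lbrakk>A \<in> \<B>; finite (emitted A); emitted A \<noteq> {}; finite (A \<inter> sinks)\<rbrakk>
      \<Longrightarrow> p A = (\<Oplus>a\<in>emitted A. s a \<otimes> p (rel_range A [a]) \<otimes> (s a)\<^sup>\<star>)
               \<oplus> (\<Oplus>v\<in>A \<inter> sinks. p {v})"

definition rep_generates ::
  "('v, 'e) pre_digraph \<Rightarrow> ('e \<Rightarrow> 'a) \<Rightarrow> 'v set set \<Rightarrow>
    'x cstar_struct \<Rightarrow> ('a \<Rightarrow> 'x) \<Rightarrow> ('v set \<Rightarrow> 'x) \<Rightarrow> bool" where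
  "rep_generates G L \<B> B s p \<longleftrightarrow>
     cstar_algebra.generated_by B (s ` labelled_graph.letters G L \<union> p ` \<B>)"

text \<open>
  The mapping property is quantified over representations in C*-algebras whose elements
  have a fixed type, since HOL has no quantification over types. Arbitrary targets are reached
  by leaving \<open>'d\<close> a type variable.
\<close>

definition rep_universal_for ::
  "'d itself \<Rightarrow> ('v, 'e) pre_digraph \<Rightarrow> ('e \<Rightarrow> 'a) \<Rightarrow> 'v set set \<Rightarrow>
    'x cstar_struct \<Rightarrow> ('a \<Rightarrow> 'x) \<Rightarrow> ('v set \<Rightarrow> 'x) \<Rightarrow> bool" where
  "rep_universal_for (_ :: 'd itself) G L \<B> B s p \<longleftrightarrow>
     (\<forall>(D :: 'd cstar_struct) t q. labelled_space_rep G L \<B> D t q \<longrightarrow>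
        (\<exists>\<phi>. star_hom B D \<phi> \<and>
           (\<forall>a\<in>labelled_graph.letters G L. \<phi> (s a) = t a) \<and> (\<forall>A\<in>\<B>. \<phi> (p A) = q A)))"

text \<open>
  A concrete type large enough to carry the universal C*-algebra: its elements can be taken to
  be classes of Cauchy sequences in the free *-algebra on the symbols \<open>p\<^sub>A\<close> and \<open>s\<^sub>a\<close>, whose
  elements are complex-valued functions on words in the symbols and their adjoints (marked by
  the \<open>bool\<close> component). Only the cardinality of the type matters.

  The witness of an existential statement may depend on the type variable \<open>'d\<close> of
  \<^const>\<open>rep_universal_for\<close>. If the mapping property is also required for targets in the type
  of the witness itself, then the witnesses for different \<open>'d\<close> are canonically isomorphic, so
  each of them is universal for all targets.
\<close>

type_synonym ('v, 'a) univ_carrier =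
  "(nat \<Rightarrow> (('v set + 'a) \<times> bool) list \<Rightarrow> complex) set"

end

theory Submission
  imports Defs "HOL-Analysis.Infinite_Sum" "HOL-Analysis.Bounded_Linear_Function"
begin

text \<open>
  Every representation generates a C*-algebra in which the terms in the generators are dense, so
  an element can be encoded by the set of term sequences converging to it. Hence every
  representation, in whatever type, has a copy inside \<open>univ_carrier\<close>, and the universal
  one is the copy of the representation in the bounded product of all representations carried by
  \<open>univ_carrier\<close>; generators have norm at most 1, so they do lie in the bounded product.

  For the projections to be nonzero one representation suffices. It lives on the square-summable
  functions on sequences of letters and lattice characters of \<open>\<B>\<close>, where \<open>s\<^sub>a\<close> prepends
  the letter \<open>a\<close> and pulls the first character back along the relative range of \<open>a\<close>, and
  \<open>p\<^sub>A\<close> restricts to the sequences whose first character holds on \<open>A\<close>. Weak left-resolvingness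
  is what makes the pullback of a character a character.
\<close>

section \<open>Generalities on C*-algebras\<close>

text \<open>Types shape the first half. Only representations carried by one fixed type form a set
  over which a product can be taken, and that product lives in a larger function type. Copying is
  therefore done twice: to bring an arbitrary target into the fixed type, and to bring the product
  back into it. This route avoids a free star-algebra and the supremum of its C*-seminorms.

  For the second half, paths in the graph itself are the wrong basis. Several edges with the same
  label may end in one vertex v, and then prepending the label to v singles out no source vertex.
  What is well defined is the family of sets A whose relative range contains v. It behaves like a
  point of the lattice but need not be evaluation at a vertex; repeating the step backwards leads to
  sequences of characters. The relation \<open>rep_sum\<close> decides where such a sequence may
  stop: a character that is true on a set to which the relation applies must be true on the
  singleton of some sink in that set, or the sequence has to go on.\<close>

context cstar_algebra
begin

lemma smult_in_carrier [simp, intro]: "x \<in> carrier B \<Longrightarrow> c \<odot> x \<in> carrier B"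
  using smult_closed[of c x] by (simp add: ring_of_type_algebra_def)

lemma zero_smult: "x \<in> carrier B \<Longrightarrow> 0 \<odot> x = \<zero>"
  using smult_l_null[of x] by (simp add: ring_of_type_algebra_def)

lemma one_smult: "x \<in> carrier B \<Longrightarrow> 1 \<odot> x = x"
  using smult_one[of x] by (simp add: ring_of_type_algebra_def)

lemma add_smult: "x \<in> carrier B \<Longrightarrow> (c + d) \<odot> x = c \<odot> x \<oplus> d \<odot> x"
  using smult_l_distr[of c d x] by (simp add: ring_of_type_algebra_def)

lemma smult_add: "\<lbrakk>x \<in> carrier B; y \<in> carrier B\<rbrakk> \<Longrightarrow> c \<odot> (x \<oplus> y) = c \<odot> x \<oplus> c \<odot> y"
  using smult_r_distr[of c x y] by (simp add: ring_of_type_algebra_def)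

lemma smult_smult: "x \<in> carrier B \<Longrightarrow> c \<odot> (d \<odot> x) = (c * d) \<odot> x"
  using smult_assoc1[of c d x] by (simp add: ring_of_type_algebra_def)

lemma uminus_conv_smult: "x \<in> carrier B \<Longrightarrow> \<ominus> x = (-1) \<odot> x"
  using add_smult[of x "-1" 1] by (intro M.minus_equality) (simp_all add: zero_smult one_smult)

lemma minus_conv_smult: "\<lbrakk>x \<in> carrier B; y \<in> carrier B\<rbrakk> \<Longrightarrow> x \<ominus> y = x \<oplus> (-1) \<odot> y"
  by (simp add: a_minus_def uminus_conv_smult)

lemma cstar_dist_eq: "\<lbrakk>x \<in> carrier B; y \<in> carrier B\<rbrakk> \<Longrightarrow> cstar_dist B x y = nrm B (x \<ominus> y)"
  by (simp add: cstar_dist_def)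

lemma nrm_zero: "nrm B \<zero> = 0"
  by (simp add: nrm_eq_zero)

lemma zero_mult: "x \<in> carrier B \<Longrightarrow> \<zero> \<otimes> x = \<zero>"
  using smult_mult_left[of \<zero> x 0] by (simp add: zero_smult mult_closed)

lemma zero_star: "\<zero>\<^sup>\<star> = \<zero>"
  using star_smult[of \<zero> 0] by (simp add: zero_smult star_closed)

text \<open>By the C*-identity and submultiplicativity, the square of the norm of y is at most the
  norm of its adjoint times the norm of y. Cancelling a factor gives one inequality for every y;
  applied to x and to its adjoint it gives equality.\<close>

lemma nrm_star: assumes "x \<in> carrier B" shows "nrm B (x\<^sup>\<star>) = nrm B x"
proof -
  have le: "nrm B y \<le> nrm B (y\<^sup>\<star>)" if "y \<in> carrier B" for y
  proof (cases "nrm B y = 0")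
    case True
    then show ?thesis using nrm_nonneg[of "y\<^sup>\<star>"] that star_closed by simp
  next
    case False
    have "nrm B y * nrm B y \<le> nrm B (y\<^sup>\<star>) * nrm B y"
      using nrm_mult[of "y\<^sup>\<star>" y] nrm_cstar[of y] that star_closed by (simp add: power2_eq_square)
    then show ?thesis using False nrm_nonneg[OF that] by simp
  qed
  show ?thesis using le[OF assms] le[OF star_closed[OF assms]] star_star[OF assms] by simp
qed

text \<open>A projection is its adjoint times itself, so its norm equals its own square. Together
  with \<open>nrm_s_le\<close> this is the uniform bound that puts the generators into bounded
  products.\<close>

lemma nrm_projection_le:
  assumes "projection x" shows "nrm B x \<le> 1"
proof -
  have x: "x \<in> carrier B" "x\<^sup>\<star> = x" "x \<otimes> x = x"
    using assms by (auto simp: projection_def)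
  then have "nrm B x = (nrm B x)\<^sup>2" using nrm_cstar[of x] by simp
  then have "nrm B x = 0 \<or> nrm B x = 1" by (simp add: power2_eq_square)
  then show ?thesis by auto
qed

section \<open>Limits in norm and continuity of the operations\<close>

lemma limitin_iff_nrm:
  "limitin metric.mtopology u l sequentially \<longleftrightarrow>
     l \<in> carrier B \<and> (\<forall>\<^sub>F n in sequentially. u n \<in> carrier B) \<and>
     (\<lambda>n. nrm B (u n \<ominus> l)) \<longlonglongrightarrow> 0"
proof -
  have "((\<lambda>n. cstar_dist B (u n) l) \<longlonglongrightarrow> 0) \<longleftrightarrow> ((\<lambda>n. nrm B (u n \<ominus> l)) \<longlonglongrightarrow> 0)"
    if "l \<in> carrier B" "\<forall>\<^sub>F n in sequentially. u n \<in> carrier B"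
    by (rule filterlim_cong[OF refl refl]) (use that in \<open>auto elim!: eventually_mono simp: cstar_dist_eq\<close>)
  then show ?thesis
    unfolding metric.limitin_metric_dist_null by blast
qed

lemma limitin_range_iff:
  assumes "range u \<subseteq> carrier B"
  shows "limitin metric.mtopology u l sequentially \<longleftrightarrow>
     l \<in> carrier B \<and> (\<lambda>n. nrm B (u n \<ominus> l)) \<longlonglongrightarrow> 0"
  using assms by (auto simp: limitin_iff_nrm image_subset_iff)

lemma limitin_add:
  assumes "range u \<subseteq> carrier B" "range v \<subseteq> carrier B"
    and "limitin metric.mtopology u l sequentially" "limitin metric.mtopology v m sequentially"
  shows "limitin metric.mtopology (\<lambda>n. u n \<oplus> v n) (l \<oplus> m) sequentially"
proof -
  have c: "u n \<in> carrier B" "v n \<in> carrier B" for n using assms by auto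
  have lm: "l \<in> carrier B" "m \<in> carrier B"
    and lim: "(\<lambda>n. nrm B (u n \<ominus> l)) \<longlonglongrightarrow> 0" "(\<lambda>n. nrm B (v n \<ominus> m)) \<longlonglongrightarrow> 0"
    using assms by (auto simp: limitin_range_iff)
  have "(u n \<oplus> v n) \<ominus> (l \<oplus> m) = (u n \<ominus> l) \<oplus> (v n \<ominus> m)" for n
    using c lm by (simp add: a_minus_def M.minus_add M.a_ac)
  then have bound: "nrm B ((u n \<oplus> v n) \<ominus> (l \<oplus> m)) \<le> nrm B (u n \<ominus> l) + nrm B (v n \<ominus> m)" for n
    using c lm by (simp add: nrm_triangle)
  have lim0: "(\<lambda>n. nrm B (u n \<ominus> l) + nrm B (v n \<ominus> m)) \<longlonglongrightarrow> 0"
    using tendsto_add[OF lim] by simp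
  have "(\<lambda>n. nrm B ((u n \<oplus> v n) \<ominus> (l \<oplus> m))) \<longlonglongrightarrow> 0"
    by (rule Lim_null_comparison[OF always_eventually lim0]) (simp add: bound nrm_nonneg c lm)
  then show ?thesis using c lm by (subst limitin_range_iff) auto
qed

lemma limitin_mult:
  assumes "range u \<subseteq> carrier B" "range v \<subseteq> carrier B"
    and "limitin metric.mtopology u l sequentially" "limitin metric.mtopology v m sequentially"
  shows "limitin metric.mtopology (\<lambda>n. u n \<otimes> v n) (l \<otimes> m) sequentially"
proof -
  have c: "u n \<in> carrier B" "v n \<in> carrier B" for n using assms by auto
  have lm: "l \<in> carrier B" "m \<in> carrier B"
    and lim: "(\<lambda>n. nrm B (u n \<ominus> l)) \<longlonglongrightarrow> 0" "(\<lambda>n. nrm B (v n \<ominus> m)) \<longlonglongrightarrow> 0"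
    using assms by (auto simp: limitin_range_iff)
  \<comment> \<open>In terms of the errors e and f the difference of the products is ef + em + lf.
    Every summand has a factor tending to 0, so no separate bound on the sequences has to be
    found.\<close>
  define e f where "e n = u n \<ominus> l" and "f n = v n \<ominus> m" for n
  have ef: "e n \<in> carrier B" "f n \<in> carrier B" "u n = e n \<oplus> l" "v n = f n \<oplus> m" for n
    using c lm by (auto simp: e_def f_def a_minus_def M.a_assoc M.l_neg)
  note closed = mult_closed ef(1,2) lm
  have "u n \<otimes> v n \<ominus> l \<otimes> m = e n \<otimes> f n \<oplus> e n \<otimes> m \<oplus> l \<otimes> f n" for n
  proof -
    have "u n \<otimes> v n = (e n \<otimes> f n \<oplus> e n \<otimes> m \<oplus> l \<otimes> f n) \<oplus> l \<otimes> m"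
      unfolding ef(3,4) using closed by (simp add: mult_add_left mult_add_right M.a_ac)
    then show ?thesis using closed by (simp add: a_minus_def M.a_assoc M.r_neg)
  qed
  then have bound: "nrm B (u n \<otimes> v n \<ominus> l \<otimes> m)
      \<le> nrm B (e n) * nrm B (f n) + nrm B (e n) * nrm B m + nrm B l * nrm B (f n)" for n
    using closed nrm_triangle[of "e n \<otimes> f n \<oplus> e n \<otimes> m" "l \<otimes> f n"]
      nrm_triangle[of "e n \<otimes> f n" "e n \<otimes> m"] nrm_mult[of "e n" "f n"] nrm_mult[of "e n" m]
      nrm_mult[of l "f n"] by (smt (verit) M.a_closed)
  have "(\<lambda>n. nrm B (e n) * nrm B (f n) + nrm B (e n) * nrm B m + nrm B l * nrm B (f n)) \<longlonglongrightarrow>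
      0 * 0 + 0 * nrm B m + nrm B l * 0"
    using lim unfolding e_def f_def by (intro tendsto_intros)
  then have lim0: "(\<lambda>n. nrm B (e n) * nrm B (f n) + nrm B (e n) * nrm B m + nrm B l * nrm B (f n)) \<longlonglongrightarrow> 0"
    by simp
  have "(\<lambda>n. nrm B (u n \<otimes> v n \<ominus> l \<otimes> m)) \<longlonglongrightarrow> 0"
    by (rule Lim_null_comparison[OF always_eventually lim0]) (simp add: bound nrm_nonneg c lm mult_closed)
  then show ?thesis using c lm by (subst limitin_range_iff) (auto simp: mult_closed)
qed

lemma limitin_smult:
  assumes "range u \<subseteq> carrier B" "limitin metric.mtopology u l sequentially"
  shows "limitin metric.mtopology (\<lambda>n. c \<odot> u n) (c \<odot> l) sequentially"
proof -
  have c: "u n \<in> carrier B" for n using assms by auto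
  have l: "l \<in> carrier B" and lim: "(\<lambda>n. nrm B (u n \<ominus> l)) \<longlonglongrightarrow> 0"
    using assms by (auto simp: limitin_range_iff)
  have "c \<odot> u n \<ominus> c \<odot> l = c \<odot> (u n \<ominus> l)" for n
    using c l by (simp add: minus_conv_smult smult_add smult_smult mult.commute)
  then have "nrm B (c \<odot> u n \<ominus> c \<odot> l) = cmod c * nrm B (u n \<ominus> l)" for n
    using c l by (simp add: nrm_smult)
  then show ?thesis using c l tendsto_mult_right_zero[OF lim, of "cmod c"]
    by (subst limitin_range_iff) auto
qed

lemma limitin_star:
  assumes "range u \<subseteq> carrier B" "limitin metric.mtopology u l sequentially"
  shows "limitin metric.mtopology (\<lambda>n. (u n)\<^sup>\<star>) (l\<^sup>\<star>) sequentially"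
proof -
  have c: "u n \<in> carrier B" for n using assms by auto
  have l: "l \<in> carrier B" and lim: "(\<lambda>n. nrm B (u n \<ominus> l)) \<longlonglongrightarrow> 0"
    using assms by (auto simp: limitin_range_iff)
  have "(u n)\<^sup>\<star> \<ominus> l\<^sup>\<star> = (u n \<ominus> l)\<^sup>\<star>" for n
    using c l by (simp add: minus_conv_smult star_add star_smult star_closed)
  then have "nrm B ((u n)\<^sup>\<star> \<ominus> l\<^sup>\<star>) = nrm B (u n \<ominus> l)" for n
    using c l by (simp add: nrm_star)
  then show ?thesis using c l lim by (subst limitin_range_iff) (auto simp: star_closed)
qed

end

section \<open>Star-homomorphisms\<close>

locale star_homomorphism = dom: cstar_algebra B + cod: cstar_algebra D
  for B :: "'x cstar_struct" and D :: "'y cstar_struct" +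
  fixes \<phi> :: "'x \<Rightarrow> 'y"
  assumes star_hom: "star_hom B D \<phi>"
begin

lemma hom_closed: "x \<in> carrier B \<Longrightarrow> \<phi> x \<in> carrier D"
  and hom_add: "\<lbrakk>x \<in> carrier B; y \<in> carrier B\<rbrakk> \<Longrightarrow> \<phi> (x \<oplus>\<^bsub>B\<^esub> y) = \<phi> x \<oplus>\<^bsub>D\<^esub> \<phi> y"
  and hom_mult: "\<lbrakk>x \<in> carrier B; y \<in> carrier B\<rbrakk> \<Longrightarrow> \<phi> (x \<otimes>\<^bsub>B\<^esub> y) = \<phi> x \<otimes>\<^bsub>D\<^esub> \<phi> y"
  and hom_star: "x \<in> carrier B \<Longrightarrow> \<phi> (x\<^sup>\<star>\<^bsub>B\<^esub>) = (\<phi> x)\<^sup>\<star>\<^bsub>D\<^esub>"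
  and hom_smult: "x \<in> carrier B \<Longrightarrow> \<phi> (c \<odot>\<^bsub>B\<^esub> x) = c \<odot>\<^bsub>D\<^esub> \<phi> x"
  using star_hom by (auto simp: star_hom_def)

lemma hom_zero: "\<phi> \<zero>\<^bsub>B\<^esub> = \<zero>\<^bsub>D\<^esub>"
  using hom_smult[of "\<zero>\<^bsub>B\<^esub>" 0] hom_closed[of "\<zero>\<^bsub>B\<^esub>"]
  by (simp add: dom.zero_smult cod.zero_smult)

lemma hom_minus: "\<lbrakk>x \<in> carrier B; y \<in> carrier B\<rbrakk> \<Longrightarrow> \<phi> (x \<ominus>\<^bsub>B\<^esub> y) = \<phi> x \<ominus>\<^bsub>D\<^esub> \<phi> y"
  by (simp add: dom.minus_conv_smult cod.minus_conv_smult hom_add hom_smult hom_closed)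

text \<open>Over an infinite index set both sums are zero by convention, and the claim is
  \<open>hom_zero\<close>.\<close>

lemma hom_finsum:
  "f \<in> S \<rightarrow> carrier B \<Longrightarrow> \<phi> (\<Oplus>\<^bsub>B\<^esub>i\<in>S. f i) = (\<Oplus>\<^bsub>D\<^esub>i\<in>S. \<phi> (f i))"
proof (induction S rule: infinite_finite_induct)
  case (insert x F)
  then show ?case
    by (simp add: Pi_iff hom_add hom_closed dom.M.finsum_insert cod.M.finsum_insert dom.M.finsum_closed)
qed (simp_all add: hom_zero dom.M.finsum_infinite cod.M.finsum_infinite)

end

lemma star_hom_compose:
  "\<lbrakk>star_hom A B \<phi>; star_hom B D \<psi>\<rbrakk> \<Longrightarrow> star_hom A D (\<psi> \<circ> \<phi>)"
  by (auto simp: star_hom_def Pi_iff)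

text \<open>Completeness is stated through the separating family, so that no subtraction in the
  structure \<open>B\<close>, not yet known to be a group, occurs.\<close>

lemma cstar_algebra_of_separating_homs:
  fixes B :: "'x cstar_struct" and D :: "'i \<Rightarrow> 'y cstar_struct" and \<phi> :: "'i \<Rightarrow> 'x \<Rightarrow> 'y"
  assumes ne: "I \<noteq> {}"
    and alg: "\<And>i. i \<in> I \<Longrightarrow> cstar_algebra (D i)"
    and hom: "\<And>i. i \<in> I \<Longrightarrow> star_hom B (D i) (\<phi> i)"
    and hom_zero: "\<And>i. i \<in> I \<Longrightarrow> \<phi> i \<zero>\<^bsub>B\<^esub> = \<zero>\<^bsub>D i\<^esub>"
    and sep: "\<And>x y. \<lbrakk>x \<in> carrier B; y \<in> carrier B; \<And>i. i \<in> I \<Longrightarrow> \<phi> i x = \<phi> i y\<rbrakk> \<Longrightarrow> x = y"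
    and zero_closed: "\<zero>\<^bsub>B\<^esub> \<in> carrier B"
    and add_closed: "\<And>x y. \<lbrakk>x \<in> carrier B; y \<in> carrier B\<rbrakk> \<Longrightarrow> x \<oplus>\<^bsub>B\<^esub> y \<in> carrier B"
    and mult_closed: "\<And>x y. \<lbrakk>x \<in> carrier B; y \<in> carrier B\<rbrakk> \<Longrightarrow> x \<otimes>\<^bsub>B\<^esub> y \<in> carrier B"
    and smult_closed: "\<And>c x. x \<in> carrier B \<Longrightarrow> c \<odot>\<^bsub>B\<^esub> x \<in> carrier B"
    and star_closed: "\<And>x. x \<in> carrier B \<Longrightarrow> x\<^sup>\<star>\<^bsub>B\<^esub> \<in> carrier B"
    and bdd: "\<And>x. x \<in> carrier B \<Longrightarrow> bdd_above ((\<lambda>i. nrm (D i) (\<phi> i x)) ` I)"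
    and nrm: "\<And>x. x \<in> carrier B \<Longrightarrow> nrm B x = (SUP i\<in>I. nrm (D i) (\<phi> i x))"
    and complete: "\<And>u :: nat \<Rightarrow> 'x. \<lbrakk>range u \<subseteq> carrier B;
        \<And>\<epsilon>. \<epsilon> > 0 \<Longrightarrow> \<exists>N. \<forall>m\<ge>N. \<forall>n\<ge>N. \<forall>i\<in>I. nrm (D i) (\<phi> i (u m) \<ominus>\<^bsub>D i\<^esub> \<phi> i (u n)) \<le> \<epsilon>\<rbrakk>
      \<Longrightarrow> \<exists>l\<in>carrier B. \<forall>\<epsilon>>0. \<exists>N. \<forall>n\<ge>N. \<forall>i\<in>I. nrm (D i) (\<phi> i (u n) \<ominus>\<^bsub>D i\<^esub> \<phi> i l) \<le> \<epsilon>"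
  shows "cstar_algebra B"
proof -
  have ev1: "\<phi> i x \<in> carrier (D i)" "\<phi> i (x\<^sup>\<star>\<^bsub>B\<^esub>) = (\<phi> i x)\<^sup>\<star>\<^bsub>D i\<^esub>"
    "\<phi> i (c \<odot>\<^bsub>B\<^esub> x) = c \<odot>\<^bsub>D i\<^esub> \<phi> i x"
    if "i \<in> I" "x \<in> carrier B" for i x c
    using hom[OF that(1)] that by (auto simp: star_hom_def)
  have ev2: "\<phi> i (x \<oplus>\<^bsub>B\<^esub> y) = \<phi> i x \<oplus>\<^bsub>D i\<^esub> \<phi> i y"
    "\<phi> i (x \<otimes>\<^bsub>B\<^esub> y) = \<phi> i x \<otimes>\<^bsub>D i\<^esub> \<phi> i y"
    if "i \<in> I" "x \<in> carrier B" "y \<in> carrier B" for i x y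
    using hom[OF that(1)] that by (auto simp: star_hom_def)
  note ev = ev1 ev2
  note closed = zero_closed add_closed mult_closed smult_closed star_closed
  have abelian: "abelian_group (D i)" if "i \<in> I" for i
    using alg[OF that] by (simp add: cstar_algebra_def Module.module_def)
  \<comment> \<open>Each equational axiom holds after every \<open>\<phi> i\<close> and hence in
    \<open>B\<close> by \<open>sep\<close>. Only the additive inverse asks for a witness, the
    multiple by -1.\<close>
  have group: "abelian_group B"
  proof (rule abelian_groupI)
    fix x y z assume xyz: "x \<in> carrier B" "y \<in> carrier B" "z \<in> carrier B"
    show "x \<oplus>\<^bsub>B\<^esub> y \<oplus>\<^bsub>B\<^esub> z = x \<oplus>\<^bsub>B\<^esub> (y \<oplus>\<^bsub>B\<^esub> z)"
      by (rule sep) (simp_all add: xyz closed ev abelian_monoid.a_assoc[OF abelian_group.axioms(1)[OF abelian]])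
  next
    fix x y assume xy: "x \<in> carrier B" "y \<in> carrier B"
    show "x \<oplus>\<^bsub>B\<^esub> y = y \<oplus>\<^bsub>B\<^esub> x"
      by (rule sep) (simp_all add: xy closed ev abelian_monoid.a_comm[OF abelian_group.axioms(1)[OF abelian]])
  next
    fix x assume x: "x \<in> carrier B"
    show "\<zero>\<^bsub>B\<^esub> \<oplus>\<^bsub>B\<^esub> x = x"
      by (rule sep) (simp_all add: x closed ev hom_zero abelian_monoid.l_zero[OF abelian_group.axioms(1)[OF abelian]])
    have "(-1) \<odot>\<^bsub>B\<^esub> x \<oplus>\<^bsub>B\<^esub> x = \<zero>\<^bsub>B\<^esub>"
    proof (rule sep)
      fix i assume i: "i \<in> I"
      interpret D: cstar_algebra "D i" by (rule alg[OF i])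
      show "\<phi> i ((-1) \<odot>\<^bsub>B\<^esub> x \<oplus>\<^bsub>B\<^esub> x) = \<phi> i \<zero>\<^bsub>B\<^esub>"
        using D.uminus_conv_smult[of "\<phi> i x"] D.M.l_neg[of "\<phi> i x"]
        by (simp add: i x closed ev hom_zero)
    qed (simp_all add: x closed)
    then show "\<exists>y\<in>carrier B. y \<oplus>\<^bsub>B\<^esub> x = \<zero>\<^bsub>B\<^esub>" using x closed by blast
  qed (simp_all add: closed)
  have module: "Module.module (ring_of_type_algebra :: complex ring) B"
  proof (rule moduleI[OF cring_from_type_algebra group])
    fix c d :: complex and x y
    assume x: "x \<in> carrier B"
    show "(c \<oplus>\<^bsub>ring_of_type_algebra\<^esub> d) \<odot>\<^bsub>B\<^esub> x = c \<odot>\<^bsub>B\<^esub> x \<oplus>\<^bsub>B\<^esub> d \<odot>\<^bsub>B\<^esub> x"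
      by (rule sep) (simp_all add: x closed ev cstar_algebra.add_smult[OF alg] ring_of_type_algebra_def)
    show "(c \<otimes>\<^bsub>ring_of_type_algebra\<^esub> d) \<odot>\<^bsub>B\<^esub> x = c \<odot>\<^bsub>B\<^esub> (d \<odot>\<^bsub>B\<^esub> x)"
      by (rule sep) (simp_all add: x closed ev cstar_algebra.smult_smult[OF alg] ring_of_type_algebra_def)
    show "\<one>\<^bsub>ring_of_type_algebra\<^esub> \<odot>\<^bsub>B\<^esub> x = x"
      by (rule sep) (simp_all add: x closed ev cstar_algebra.one_smult[OF alg] ring_of_type_algebra_def)
    assume y: "y \<in> carrier B"
    show "c \<odot>\<^bsub>B\<^esub> (x \<oplus>\<^bsub>B\<^esub> y) = c \<odot>\<^bsub>B\<^esub> x \<oplus>\<^bsub>B\<^esub> c \<odot>\<^bsub>B\<^esub> y"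
      by (rule sep) (simp_all add: x y closed ev cstar_algebra.smult_add[OF alg])
  qed (simp_all add: closed)
  \<comment> \<open>The two halves of the supremum: it is an upper bound, where \<open>bdd\<close>
    enters, and the least one, where \<open>ne\<close> enters. The norm inequalities below rest on
    these two.\<close>
  have le: "nrm (D i) (\<phi> i x) \<le> nrm B x" if "i \<in> I" "x \<in> carrier B" for i x
    using that cSUP_upper[OF _ bdd] by (simp add: nrm)
  have least: "nrm B x \<le> K" if "x \<in> carrier B" "\<And>i. i \<in> I \<Longrightarrow> nrm (D i) (\<phi> i x) \<le> K" for x K
    using that by (auto simp: nrm intro!: cSUP_least[OF ne])
  note pos = cstar_algebra.nrm_nonneg[OF alg]
  have nonneg: "0 \<le> nrm B x" if "x \<in> carrier B" for x
  proof -
    obtain i where i: "i \<in> I" using ne by blast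
    show ?thesis using order_trans[OF pos[OF i ev1(1)[OF i that]] le[OF i that]] .
  qed
  have minus: "\<phi> i (x \<ominus>\<^bsub>B\<^esub> y) = \<phi> i x \<ominus>\<^bsub>D i\<^esub> \<phi> i y" "x \<ominus>\<^bsub>B\<^esub> y \<in> carrier B"
    if "i \<in> I" "x \<in> carrier B" "y \<in> carrier B" for i x y
  proof -
    interpret D: cstar_algebra "D i" by (rule alg[OF that(1)])
    interpret B: abelian_group B by (rule group)
    interpret M: Module.module "ring_of_type_algebra :: complex ring" B by (rule module)
    have "\<ominus>\<^bsub>B\<^esub> y = (-1) \<odot>\<^bsub>B\<^esub> y"
      using M.smult_l_distr[of "-1" 1 y] M.smult_one[of y] M.smult_l_null[of y] that closed
      by (intro B.minus_equality) (simp_all add: ring_of_type_algebra_def)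
    then show "\<phi> i (x \<ominus>\<^bsub>B\<^esub> y) = \<phi> i x \<ominus>\<^bsub>D i\<^esub> \<phi> i y"
      using that closed by (simp add: a_minus_def ev D.uminus_conv_smult)
    show "x \<ominus>\<^bsub>B\<^esub> y \<in> carrier B" using that by simp
  qed
  note minus_closed = abelian_group.minus_closed[OF group]
  have axioms: "cstar_algebra_axioms B" if mc: "Metric_space.mcomplete (carrier B) (cstar_dist B)"
  proof
    fix x y z c
    assume x: "x \<in> carrier B"
    show "x \<otimes>\<^bsub>B\<^esub> y \<in> carrier B" if "y \<in> carrier B" using x that by (rule closed)
    show "x\<^sup>\<star>\<^bsub>B\<^esub> \<in> carrier B" by (simp add: closed x)
    show "(x\<^sup>\<star>\<^bsub>B\<^esub>)\<^sup>\<star>\<^bsub>B\<^esub> = x"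
      by (rule sep) (simp_all add: x closed ev cstar_algebra.star_star[OF alg])
    show "(c \<odot>\<^bsub>B\<^esub> x)\<^sup>\<star>\<^bsub>B\<^esub> = cnj c \<odot>\<^bsub>B\<^esub> x\<^sup>\<star>\<^bsub>B\<^esub>"
      by (rule sep) (simp_all add: x closed ev cstar_algebra.star_smult[OF alg])
    show "0 \<le> nrm B x" by (rule nonneg[OF x])
    show "(nrm B x = 0) = (x = \<zero>\<^bsub>B\<^esub>)"
    proof
      assume "nrm B x = 0"
      then have "\<phi> i x = \<zero>\<^bsub>D i\<^esub>" if "i \<in> I" for i
        using le[OF that x] pos[OF that ev1(1)[OF that x]] cstar_algebra.nrm_eq_zero[OF alg[OF that] ev1(1)[OF that x]] by simp
      then show "x = \<zero>\<^bsub>B\<^esub>" by (intro sep) (simp_all add: x closed hom_zero)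
    next
      assume "x = \<zero>\<^bsub>B\<^esub>"
      then show "nrm B x = 0" using ne by (simp add: nrm closed hom_zero cstar_algebra.nrm_zero[OF alg])
    qed
    show "nrm B (x\<^sup>\<star>\<^bsub>B\<^esub> \<otimes>\<^bsub>B\<^esub> x) = (nrm B x)\<^sup>2"
    proof (rule antisym)
      have *: "nrm (D i) (\<phi> i (x\<^sup>\<star>\<^bsub>B\<^esub> \<otimes>\<^bsub>B\<^esub> x)) = (nrm (D i) (\<phi> i x))\<^sup>2" if "i \<in> I" for i
        using that x closed by (simp add: ev cstar_algebra.nrm_cstar[OF alg])
      show "nrm B (x\<^sup>\<star>\<^bsub>B\<^esub> \<otimes>\<^bsub>B\<^esub> x) \<le> (nrm B x)\<^sup>2"
      proof (rule least)
        fix i assume i: "i \<in> I"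
        show "nrm (D i) (\<phi> i (x\<^sup>\<star>\<^bsub>B\<^esub> \<otimes>\<^bsub>B\<^esub> x)) \<le> (nrm B x)\<^sup>2"
          using power_mono[OF le[OF i x] pos[OF i ev1(1)[OF i x]], of 2] by (simp add: *[OF i])
      qed (simp add: x closed)
      \<comment> \<open>The square root is taken because \<open>least\<close> bounds the norm and
        not its square.\<close>
      have "nrm B x \<le> sqrt (nrm B (x\<^sup>\<star>\<^bsub>B\<^esub> \<otimes>\<^bsub>B\<^esub> x))"
      proof (rule least)
        fix i assume i: "i \<in> I"
        have "nrm (D i) (\<phi> i (x\<^sup>\<star>\<^bsub>B\<^esub> \<otimes>\<^bsub>B\<^esub> x)) \<le> nrm B (x\<^sup>\<star>\<^bsub>B\<^esub> \<otimes>\<^bsub>B\<^esub> x)" by (rule le) (simp_all add: i x closed)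
        then show "nrm (D i) (\<phi> i x) \<le> sqrt (nrm B (x\<^sup>\<star>\<^bsub>B\<^esub> \<otimes>\<^bsub>B\<^esub> x))"
          by (simp add: *[OF i] real_le_rsqrt)
      qed (rule x)
      then show "(nrm B x)\<^sup>2 \<le> nrm B (x\<^sup>\<star>\<^bsub>B\<^esub> \<otimes>\<^bsub>B\<^esub> x)"
        using power_mono[OF _ nonneg[OF x], of _ 2] nonneg[of "x\<^sup>\<star>\<^bsub>B\<^esub> \<otimes>\<^bsub>B\<^esub> x"]
        by (fastforce simp: x closed)
    qed
    show "nrm B (c \<odot>\<^bsub>B\<^esub> x) = cmod c * nrm B x"
    \<comment> \<open>The reverse inequality divides by \<open>cmod c\<close>, so the scalar 0 is
      settled apart.\<close>
    proof (cases "c = 0")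
      case True
      have "c \<odot>\<^bsub>B\<^esub> x = \<zero>\<^bsub>B\<^esub>"
        by (rule sep) (simp_all add: True x closed ev hom_zero cstar_algebra.zero_smult[OF alg])
      then show ?thesis using ne by (simp add: True nrm closed hom_zero cstar_algebra.nrm_zero[OF alg])
    next
      case False
      have *: "nrm (D i) (\<phi> i (c \<odot>\<^bsub>B\<^esub> x)) = cmod c * nrm (D i) (\<phi> i x)" if "i \<in> I" for i
        using that x closed by (simp add: ev cstar_algebra.nrm_smult[OF alg])
      show ?thesis
      proof (rule antisym)
        show "nrm B (c \<odot>\<^bsub>B\<^esub> x) \<le> cmod c * nrm B x"
          by (rule least) (simp_all add: x closed * le mult_left_mono)
        have "nrm B x \<le> nrm B (c \<odot>\<^bsub>B\<^esub> x) / cmod c"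
        proof (rule least)
          fix i assume i: "i \<in> I"
          have "nrm (D i) (\<phi> i (c \<odot>\<^bsub>B\<^esub> x)) \<le> nrm B (c \<odot>\<^bsub>B\<^esub> x)"
            by (rule le) (simp_all add: i x closed)
          then show "nrm (D i) (\<phi> i x) \<le> nrm B (c \<odot>\<^bsub>B\<^esub> x) / cmod c"
            using False by (simp add: *[OF i] field_simps)
        qed (rule x)
        then show "cmod c * nrm B x \<le> nrm B (c \<odot>\<^bsub>B\<^esub> x)" using False by (simp add: field_simps)
      qed
    qed
    assume y: "y \<in> carrier B"
    show "(c \<odot>\<^bsub>B\<^esub> x) \<otimes>\<^bsub>B\<^esub> y = c \<odot>\<^bsub>B\<^esub> (x \<otimes>\<^bsub>B\<^esub> y)"
      by (rule sep) (simp_all add: x y closed ev cstar_algebra.smult_mult_left[OF alg])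
    show "x \<otimes>\<^bsub>B\<^esub> (c \<odot>\<^bsub>B\<^esub> y) = c \<odot>\<^bsub>B\<^esub> (x \<otimes>\<^bsub>B\<^esub> y)"
      by (rule sep) (simp_all add: x y closed ev cstar_algebra.smult_mult_right[OF alg])
    show "(x \<oplus>\<^bsub>B\<^esub> y)\<^sup>\<star>\<^bsub>B\<^esub> = x\<^sup>\<star>\<^bsub>B\<^esub> \<oplus>\<^bsub>B\<^esub> y\<^sup>\<star>\<^bsub>B\<^esub>"
      by (rule sep) (simp_all add: x y closed ev cstar_algebra.star_add[OF alg])
    show "(x \<otimes>\<^bsub>B\<^esub> y)\<^sup>\<star>\<^bsub>B\<^esub> = y\<^sup>\<star>\<^bsub>B\<^esub> \<otimes>\<^bsub>B\<^esub> x\<^sup>\<star>\<^bsub>B\<^esub>"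
      by (rule sep) (simp_all add: x y closed ev cstar_algebra.star_mult[OF alg])
    show "nrm B (x \<oplus>\<^bsub>B\<^esub> y) \<le> nrm B x + nrm B y"
    proof (rule least)
      fix i assume i: "i \<in> I"
      show "nrm (D i) (\<phi> i (x \<oplus>\<^bsub>B\<^esub> y)) \<le> nrm B x + nrm B y"
        using cstar_algebra.nrm_triangle[OF alg[OF i], of "\<phi> i x" "\<phi> i y"] le[OF i x] le[OF i y]
        by (simp add: i x y ev)
    qed (simp add: x y closed)
    show "nrm B (x \<otimes>\<^bsub>B\<^esub> y) \<le> nrm B x * nrm B y"
    proof (rule least)
      fix i assume i: "i \<in> I"
      show "nrm (D i) (\<phi> i (x \<otimes>\<^bsub>B\<^esub> y)) \<le> nrm B x * nrm B y"
        using cstar_algebra.nrm_mult[OF alg[OF i], of "\<phi> i x" "\<phi> i y"]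
          mult_mono[OF le[OF i x] le[OF i y] nonneg[OF x] pos[OF i]]
        by (simp add: i x y ev)
    qed (simp add: x y closed)
    assume z: "z \<in> carrier B"
    show "x \<otimes>\<^bsub>B\<^esub> y \<otimes>\<^bsub>B\<^esub> z = x \<otimes>\<^bsub>B\<^esub> (y \<otimes>\<^bsub>B\<^esub> z)"
      by (rule sep) (simp_all add: x y z closed ev cstar_algebra.mult_assoc[OF alg])
    show "(x \<oplus>\<^bsub>B\<^esub> y) \<otimes>\<^bsub>B\<^esub> z = x \<otimes>\<^bsub>B\<^esub> z \<oplus>\<^bsub>B\<^esub> y \<otimes>\<^bsub>B\<^esub> z"
      by (rule sep) (simp_all add: x y z closed ev cstar_algebra.mult_add_left[OF alg])
    show "z \<otimes>\<^bsub>B\<^esub> (x \<oplus>\<^bsub>B\<^esub> y) = z \<otimes>\<^bsub>B\<^esub> x \<oplus>\<^bsub>B\<^esub> z \<otimes>\<^bsub>B\<^esub> y"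
      by (rule sep) (simp_all add: x y z closed ev cstar_algebra.mult_add_right[OF alg])
  qed (rule mc)
  have dist: "cstar_dist B x y \<le> \<epsilon>" if "x \<in> carrier B" "y \<in> carrier B"
    "\<And>i. i \<in> I \<Longrightarrow> nrm (D i) (\<phi> i x \<ominus>\<^bsub>D i\<^esub> \<phi> i y) \<le> \<epsilon>" for x y \<epsilon>
    using that least[of "x \<ominus>\<^bsub>B\<^esub> y" \<epsilon>] minus_closed by (simp add: cstar_dist_def minus)
  have dist': "nrm (D i) (\<phi> i x \<ominus>\<^bsub>D i\<^esub> \<phi> i y) \<le> cstar_dist B x y"
    if "i \<in> I" "x \<in> carrier B" "y \<in> carrier B" for i x y
    using that le[of i "x \<ominus>\<^bsub>B\<^esub> y"] minus_closed by (simp add: cstar_dist_def minus)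
  \<comment> \<open>The metric is a sublocale of \<open>cstar_algebra\<close>, which already
    contains completeness. To work towards completeness, the metric axioms are first derived here
    from the family.\<close>
  have metric: "Metric_space (carrier B) (cstar_dist B)"
  proof
    note D_dist = cstar_algebra.cstar_dist_eq[OF alg, symmetric]
    have D_metric: "Metric_space (carrier (D i)) (cstar_dist (D i))" if "i \<in> I" for i
    proof -
      interpret D: cstar_algebra "D i" by (rule alg[OF that])
      show ?thesis by (rule D.metric.Metric_space_axioms)
    qed
    fix x y z
    show "0 \<le> cstar_dist B x y" by (simp add: cstar_dist_def nonneg minus_closed)
    have swap: "cstar_dist B x y \<le> cstar_dist B y x" for x y
    proof (cases "x \<in> carrier B \<and> y \<in> carrier B")
      case True
      show ?thesis
      proof (rule dist)
        fix i assume i: "i \<in> I"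
        have "nrm (D i) (\<phi> i x \<ominus>\<^bsub>D i\<^esub> \<phi> i y) = nrm (D i) (\<phi> i y \<ominus>\<^bsub>D i\<^esub> \<phi> i x)"
          using i True by (simp add: D_dist ev Metric_space.commute[OF D_metric])
        then show "nrm (D i) (\<phi> i x \<ominus>\<^bsub>D i\<^esub> \<phi> i y) \<le> cstar_dist B y x"
          using dist'[OF i] True by simp
      qed (use True in auto)
    qed (auto simp: cstar_dist_def)
    show "cstar_dist B x y = cstar_dist B y x" using swap[of x y] swap[of y x] by simp
    assume x: "x \<in> carrier B" and y: "y \<in> carrier B"
    show "(cstar_dist B x y = 0) = (x = y)"
    proof
      assume 0: "cstar_dist B x y = 0"
      show "x = y"
      proof (rule sep[OF x y])
        fix i assume i: "i \<in> I"
        have "cstar_dist (D i) (\<phi> i x) (\<phi> i y) \<le> 0" using dist'[OF i x y] 0 i x y by (simp add: cstar_algebra.cstar_dist_eq[OF alg] ev)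
        then show "\<phi> i x = \<phi> i y"
          using Metric_space.zero[OF D_metric[OF i] ev1(1)[OF i x] ev1(1)[OF i y]]
            Metric_space.nonneg[OF D_metric[OF i], of "\<phi> i x" "\<phi> i y"] by simp
      qed
    next
      assume "x = y"
      moreover have "cstar_dist B y y \<le> 0"
        by (rule dist) (simp_all add: y D_dist ev Metric_space.mdist_zero[OF D_metric])
      ultimately show "cstar_dist B x y = 0"
        using nonneg minus_closed x y by (simp add: cstar_dist_def antisym)
    qed
    assume z: "z \<in> carrier B"
    show "cstar_dist B x z \<le> cstar_dist B x y + cstar_dist B y z"
    proof (rule dist[OF x z])
      fix i assume i: "i \<in> I"
      show "nrm (D i) (\<phi> i x \<ominus>\<^bsub>D i\<^esub> \<phi> i z) \<le> cstar_dist B x y + cstar_dist B y z"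
        using Metric_space.triangle[OF D_metric[OF i], of "\<phi> i x" "\<phi> i y" "\<phi> i z"]
          dist'[OF i x y] dist'[OF i y z] i x y z
        by (simp add: cstar_algebra.cstar_dist_eq[OF alg] ev)
    qed
  qed
  interpret B: Metric_space "carrier B" "cstar_dist B" by (rule metric)
  have mc: "B.mcomplete"
    unfolding B.mcomplete_def
  proof (intro allI impI)
    fix u assume cauchy: "B.MCauchy u"
    then have u: "range u \<subseteq> carrier B" by (simp add: B.MCauchy_def)
    then have u': "u n \<in> carrier B" for n by auto
    have unif: "\<exists>N. \<forall>m\<ge>N. \<forall>n\<ge>N. \<forall>i\<in>I. nrm (D i) (\<phi> i (u m) \<ominus>\<^bsub>D i\<^esub> \<phi> i (u n)) \<le> \<epsilon>"
      if "\<epsilon> > 0" for \<epsilon>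
    proof -
      obtain N where N: "\<forall>m n. N \<le> m \<longrightarrow> N \<le> n \<longrightarrow> cstar_dist B (u m) (u n) < \<epsilon>"
        using cauchy[unfolded B.MCauchy_def, THEN conjunct2, rule_format, OF \<open>\<epsilon> > 0\<close>] by blast
      have "nrm (D i) (\<phi> i (u m) \<ominus>\<^bsub>D i\<^esub> \<phi> i (u n)) \<le> \<epsilon>" if "m \<ge> N" "n \<ge> N" "i \<in> I" for m n i
        using order_trans[OF dist'[OF that(3) u' u'] less_imp_le] N that(1,2) by simp
      then show ?thesis by blast
    qed
    have "\<exists>l\<in>carrier B. \<forall>\<epsilon>>0. \<exists>N. \<forall>n\<ge>N. \<forall>i\<in>I. nrm (D i) (\<phi> i (u n) \<ominus>\<^bsub>D i\<^esub> \<phi> i l) \<le> \<epsilon>"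
      by (rule complete[OF u]) (rule unif)
    then obtain l where l: "l \<in> carrier B"
      and lim: "\<forall>\<epsilon>>0. \<exists>N. \<forall>n\<ge>N. \<forall>i\<in>I. nrm (D i) (\<phi> i (u n) \<ominus>\<^bsub>D i\<^esub> \<phi> i l) \<le> \<epsilon>"
      by blast
    have "\<forall>\<^sub>F n in sequentially. u n \<in> carrier B \<and> cstar_dist B (u n) l < \<epsilon>" if "\<epsilon> > 0" for \<epsilon>
    proof -
      \<comment> \<open>Half of \<epsilon> turns the weak bound supplied by \<open>complete\<close>
        into the strict one that convergence asks for.\<close>
      obtain N where N: "\<forall>n\<ge>N. \<forall>i\<in>I. nrm (D i) (\<phi> i (u n) \<ominus>\<^bsub>D i\<^esub> \<phi> i l) \<le> \<epsilon> / 2"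
        using lim[THEN spec, of "\<epsilon> / 2"] \<open>\<epsilon> > 0\<close> by auto
      have "cstar_dist B (u n) l < \<epsilon>" if "n \<ge> N" for n
      proof -
        have "cstar_dist B (u n) l \<le> \<epsilon> / 2"
          by (rule dist[OF u' l]) (use N that in blast)
        also have "\<dots> < \<epsilon>" using \<open>\<epsilon> > 0\<close> by simp
        finally show ?thesis .
      qed
      then show ?thesis using u' by (auto simp: eventually_sequentially)
    qed
    then show "\<exists>x. limitin B.mtopology u x sequentially"
      using l unfolding B.limitin_metric by blast
  qed
  show ?thesis by (rule cstar_algebra.intro[OF module axioms[OF mc]])
qed

section \<open>Products and copies of C*-algebras\<close>

text \<open>The bounded product with the supremum norm. All operations end in a restriction to
  \<open>I\<close>, so that elements stay extensional and are determined by their coordinates in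
  \<open>I\<close>.\<close>

definition product_algebra :: "'i set \<Rightarrow> ('i \<Rightarrow> 'y cstar_struct) \<Rightarrow> ('i \<Rightarrow> 'y) cstar_struct" where
  "product_algebra I D =
    \<lparr>carrier = {f \<in> PiE I (\<lambda>i. carrier (D i)). bdd_above ((\<lambda>i. nrm (D i) (f i)) ` I)},
     monoid.mult = (\<lambda>f g. \<lambda>i\<in>I. f i \<otimes>\<^bsub>D i\<^esub> g i), one = undefined,
     ring.zero = (\<lambda>i\<in>I. \<zero>\<^bsub>D i\<^esub>), add = (\<lambda>f g. \<lambda>i\<in>I. f i \<oplus>\<^bsub>D i\<^esub> g i),
     module.smult = (\<lambda>c f. \<lambda>i\<in>I. c \<odot>\<^bsub>D i\<^esub> f i),
     star = (\<lambda>f. \<lambda>i\<in>I. (f i)\<^sup>\<star>\<^bsub>D i\<^esub>), nrm = (\<lambda>f. SUP i\<in>I. nrm (D i) (f i))\<rparr>"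

lemma carrier_product_algebra:
  "carrier (product_algebra I D) =
    {f \<in> PiE I (\<lambda>i. carrier (D i)). bdd_above ((\<lambda>i. nrm (D i) (f i)) ` I)}"
  by (simp add: product_algebra_def)

lemma product_algebra_in_carrier_iff:
  "f \<in> carrier (product_algebra I D) \<longleftrightarrow>
    f \<in> extensional I \<and> (\<forall>i\<in>I. f i \<in> carrier (D i)) \<and> (\<exists>K. \<forall>i\<in>I. nrm (D i) (f i) \<le> K)"
  by (auto simp: carrier_product_algebra bdd_above_def PiE_def Pi_iff)

text \<open>The coordinate maps separate points and the norm is by definition the supremum of their
  norms, so the work left is boundedness of the results and completeness.\<close>

lemma product_algebra_cstar:
  fixes D :: "'i \<Rightarrow> 'y cstar_struct"
  assumes ne: "I \<noteq> {}" and alg: "\<And>i. i \<in> I \<Longrightarrow> cstar_algebra (D i)"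
  shows "cstar_algebra (product_algebra I D)"
    and "i \<in> I \<Longrightarrow> star_hom (product_algebra I D) (D i) (\<lambda>f. f i)"
proof -
  let ?P = "product_algebra I D"
  note abelian = abelian_group.axioms(1)[OF module.axioms(2)[OF cstar_algebra.axioms(1)[OF alg]]]
  show hom: "star_hom ?P (D i) (\<lambda>f. f i)" if "i \<in> I" for i
    using that by (auto simp: star_hom_def product_algebra_def)
  show "cstar_algebra ?P"
  proof (rule cstar_algebra_of_separating_homs[where \<phi> = "\<lambda>i f. f i", OF ne alg hom])
    show "\<zero>\<^bsub>?P\<^esub> i = \<zero>\<^bsub>D i\<^esub>" if "i \<in> I" for i
      using that by (simp add: product_algebra_def)
    show "f = g" if "f \<in> carrier ?P" "g \<in> carrier ?P" "\<And>i. i \<in> I \<Longrightarrow> f i = g i" for f g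
      using that by (auto simp: product_algebra_in_carrier_iff intro: extensionalityI)
    have "\<zero>\<^bsub>?P\<^esub> = (\<lambda>i\<in>I. \<zero>\<^bsub>D i\<^esub>)" by (simp add: product_algebra_def)
    then show "\<zero>\<^bsub>?P\<^esub> \<in> carrier ?P"
      by (auto simp: product_algebra_in_carrier_iff cstar_algebra.nrm_zero[OF alg]
          abelian_monoid.zero_closed[OF abelian])
    show "f \<oplus>\<^bsub>?P\<^esub> g \<in> carrier ?P" if fg: "f \<in> carrier ?P" "g \<in> carrier ?P" for f g
    proof -
      obtain K M where KM: "\<And>i. i \<in> I \<Longrightarrow> nrm (D i) (f i) \<le> K" "\<And>i. i \<in> I \<Longrightarrow> nrm (D i) (g i) \<le> M"
        using fg unfolding product_algebra_in_carrier_iff by blast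
      have c: "f i \<in> carrier (D i)" "g i \<in> carrier (D i)" if "i \<in> I" for i
        using fg that by (auto simp: product_algebra_in_carrier_iff)
      have "nrm (D i) (f i \<oplus>\<^bsub>D i\<^esub> g i) \<le> K + M" if "i \<in> I" for i
        using cstar_algebra.nrm_triangle[OF alg[OF that] c[OF that]] KM[OF that] by linarith
      moreover have "f \<oplus>\<^bsub>?P\<^esub> g = (\<lambda>i\<in>I. f i \<oplus>\<^bsub>D i\<^esub> g i)" by (simp add: product_algebra_def)
      ultimately show ?thesis
        by (auto simp: product_algebra_in_carrier_iff c abelian_monoid.a_closed[OF abelian])
    qed
    show "f \<otimes>\<^bsub>?P\<^esub> g \<in> carrier ?P" if fg: "f \<in> carrier ?P" "g \<in> carrier ?P" for f g
    proof -
      obtain K M where KM: "\<And>i. i \<in> I \<Longrightarrow> nrm (D i) (f i) \<le> K" "\<And>i. i \<in> I \<Longrightarrow> nrm (D i) (g i) \<le> M"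
        using fg unfolding product_algebra_in_carrier_iff by blast
      have c: "f i \<in> carrier (D i)" "g i \<in> carrier (D i)" if "i \<in> I" for i
        using fg that by (auto simp: product_algebra_in_carrier_iff)
      have "nrm (D i) (f i \<otimes>\<^bsub>D i\<^esub> g i) \<le> K * M" if i: "i \<in> I" for i
      proof -
        note nn = cstar_algebra.nrm_nonneg[OF alg[OF i]]
        have "nrm (D i) (f i \<otimes>\<^bsub>D i\<^esub> g i) \<le> nrm (D i) (f i) * nrm (D i) (g i)"
          by (rule cstar_algebra.nrm_mult[OF alg[OF i] c[OF i]])
        also have "\<dots> \<le> K * M"
          using KM[OF i] nn[OF c(1)[OF i]] nn[OF c(2)[OF i]] by (intro mult_mono) linarith+
        finally show ?thesis .
      qed
      moreover have "f \<otimes>\<^bsub>?P\<^esub> g = (\<lambda>i\<in>I. f i \<otimes>\<^bsub>D i\<^esub> g i)" by (simp add: product_algebra_def)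
      ultimately show ?thesis
        by (auto simp: product_algebra_in_carrier_iff c cstar_algebra.mult_closed[OF alg])
    qed
    show "c \<odot>\<^bsub>?P\<^esub> f \<in> carrier ?P" if f: "f \<in> carrier ?P" for c f
    proof -
      obtain K where K: "\<And>i. i \<in> I \<Longrightarrow> nrm (D i) (f i) \<le> K"
        using f unfolding product_algebra_in_carrier_iff by blast
      have fi: "f i \<in> carrier (D i)" if "i \<in> I" for i
        using f that by (auto simp: product_algebra_in_carrier_iff)
      have "nrm (D i) (c \<odot>\<^bsub>D i\<^esub> f i) \<le> cmod c * K" if "i \<in> I" for i
        using that by (simp add: cstar_algebra.nrm_smult[OF alg] fi K mult_left_mono)
      moreover have "c \<odot>\<^bsub>?P\<^esub> f = (\<lambda>i\<in>I. c \<odot>\<^bsub>D i\<^esub> f i)" by (simp add: product_algebra_def)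
      ultimately show ?thesis
        by (auto simp: product_algebra_in_carrier_iff fi cstar_algebra.smult_in_carrier[OF alg])
    qed
    show "f\<^sup>\<star>\<^bsub>?P\<^esub> \<in> carrier ?P" if f: "f \<in> carrier ?P" for f
    proof -
      have "f\<^sup>\<star>\<^bsub>?P\<^esub> = (\<lambda>i\<in>I. (f i)\<^sup>\<star>\<^bsub>D i\<^esub>)" by (simp add: product_algebra_def)
      then show ?thesis
        using f by (auto simp: product_algebra_in_carrier_iff cstar_algebra.star_closed[OF alg] cstar_algebra.nrm_star[OF alg])
    qed
    show "bdd_above ((\<lambda>i. nrm (D i) (f i)) ` I)" if "f \<in> carrier ?P" for f
      using that by (simp add: carrier_product_algebra)
    show "nrm ?P f = (SUP i\<in>I. nrm (D i) (f i))" for f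
      by (simp add: product_algebra_def)
  next
    fix u :: "nat \<Rightarrow> 'i \<Rightarrow> 'y"
    assume u: "range u \<subseteq> carrier ?P"
      and cauchy: "\<And>\<epsilon>. \<epsilon> > 0 \<Longrightarrow> \<exists>N. \<forall>m\<ge>N. \<forall>n\<ge>N. \<forall>i\<in>I. nrm (D i) (u m i \<ominus>\<^bsub>D i\<^esub> u n i) \<le> \<epsilon>"
    have ui: "u n i \<in> carrier (D i)" if "i \<in> I" for n i
    proof -
      have "u n \<in> carrier ?P" using u by auto
      then show ?thesis using that by (simp add: product_algebra_in_carrier_iff)
    qed
    have "\<exists>l. l \<in> carrier (D i) \<and> (\<lambda>n. nrm (D i) (u n i \<ominus>\<^bsub>D i\<^esub> l)) \<longlonglongrightarrow> 0" if i: "i \<in> I" for i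
    proof -
      interpret D: cstar_algebra "D i" by (rule alg[OF i])
      have r: "range (\<lambda>n. u n i) \<subseteq> carrier (D i)" using ui[OF i] by auto
      have "D.metric.MCauchy (\<lambda>n. u n i)"
        unfolding D.metric.MCauchy_def
      proof (intro conjI r allI impI)
        fix \<epsilon> :: real assume \<epsilon>: "\<epsilon> > 0"
        obtain N where N: "\<forall>m\<ge>N. \<forall>n\<ge>N. \<forall>i\<in>I. nrm (D i) (u m i \<ominus>\<^bsub>D i\<^esub> u n i) \<le> \<epsilon> / 2"
          using cauchy[of "\<epsilon> / 2"] \<epsilon> by auto
        have "cstar_dist (D i) (u m i) (u n i) < \<epsilon>" if "N \<le> m" "N \<le> n" for m n
        proof -
          have "cstar_dist (D i) (u m i) (u n i) \<le> \<epsilon> / 2"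
            using N that i by (simp add: D.cstar_dist_eq ui)
          then show ?thesis using \<epsilon> by linarith
        qed
        then show "\<exists>N. \<forall>n n'. N \<le> n \<longrightarrow> N \<le> n' \<longrightarrow> cstar_dist (D i) (u n i) (u n' i) < \<epsilon>" by blast
      qed
      then obtain l where "limitin D.metric.mtopology (\<lambda>n. u n i) l sequentially"
        using D.complete unfolding D.metric.mcomplete_def by blast
      then show ?thesis using r by (auto simp: D.limitin_range_iff)
    qed
    then obtain l0 where l0: "\<forall>i\<in>I. l0 i \<in> carrier (D i) \<and> (\<lambda>n. nrm (D i) (u n i \<ominus>\<^bsub>D i\<^esub> l0 i)) \<longlonglongrightarrow> 0"
      by metis
    define l where "l = restrict l0 I"
    have l: "l i \<in> carrier (D i)" "(\<lambda>n. nrm (D i) (u n i \<ominus>\<^bsub>D i\<^esub> l i)) \<longlonglongrightarrow> 0" if "i \<in> I" for i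
      using l0 that by (auto simp: l_def)
    \<comment> \<open>Coordinatewise convergence becomes uniform: n and i stay fixed in the triangle
      inequality while m tends to infinity, so N does not depend on i.\<close>
    have lim: "\<exists>N. \<forall>n\<ge>N. \<forall>i\<in>I. nrm (D i) (u n i \<ominus>\<^bsub>D i\<^esub> l i) \<le> \<epsilon>" if \<epsilon>: "\<epsilon> > 0" for \<epsilon>
    proof -
      obtain N where N: "\<forall>m\<ge>N. \<forall>n\<ge>N. \<forall>i\<in>I. nrm (D i) (u m i \<ominus>\<^bsub>D i\<^esub> u n i) \<le> \<epsilon>"
        using cauchy[OF \<epsilon>] by blast
      have "nrm (D i) (u n i \<ominus>\<^bsub>D i\<^esub> l i) \<le> \<epsilon>" if n: "n \<ge> N" and i: "i \<in> I" for n i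
      proof -
        interpret D: cstar_algebra "D i" by (rule alg[OF i])
        have lim0: "(\<lambda>m. \<epsilon> + nrm (D i) (u m i \<ominus>\<^bsub>D i\<^esub> l i)) \<longlonglongrightarrow> \<epsilon> + 0"
          by (intro tendsto_intros l i)
        have "nrm (D i) (u n i \<ominus>\<^bsub>D i\<^esub> l i) \<le> \<epsilon> + nrm (D i) (u m i \<ominus>\<^bsub>D i\<^esub> l i)" if "m \<ge> N" for m
        proof -
          have "nrm (D i) (u n i \<ominus>\<^bsub>D i\<^esub> u m i) \<le> \<epsilon>" using N n that i by blast
          then show ?thesis
            using D.metric.triangle[OF ui[OF i] ui[OF i] l(1)[OF i], of n m]
            by (simp add: D.cstar_dist_eq ui[OF i] l(1)[OF i])
        qed
        then show ?thesis
          using LIMSEQ_le_const[OF lim0] by auto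
      qed
      then show ?thesis by blast
    qed
    \<comment> \<open>The limit is bounded because one member of the sequence, itself bounded, lies
      within 1 of it in every coordinate.\<close>
    have "l \<in> carrier ?P"
    proof -
      obtain N where N: "\<forall>n\<ge>N. \<forall>i\<in>I. nrm (D i) (u n i \<ominus>\<^bsub>D i\<^esub> l i) \<le> 1"
        using lim[of 1] by auto
      have "u N \<in> carrier ?P" using u by auto
      then obtain K where K: "\<forall>i\<in>I. nrm (D i) (u N i) \<le> K"
        unfolding product_algebra_in_carrier_iff by blast
      have "nrm (D i) (l i) \<le> K + 1" if i: "i \<in> I" for i
      proof -
        interpret D: cstar_algebra "D i" by (rule alg[OF i])
        have "cstar_dist (D i) (l i) \<zero>\<^bsub>D i\<^esub> \<le> cstar_dist (D i) (u N i) (l i) + cstar_dist (D i) (u N i) \<zero>\<^bsub>D i\<^esub>"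
          using D.metric.triangle[OF l(1)[OF i] ui[OF i] D.M.zero_closed] by (simp add: D.metric.commute)
        moreover have "x \<ominus>\<^bsub>D i\<^esub> \<zero>\<^bsub>D i\<^esub> = x" if "x \<in> carrier (D i)" for x
          using that by (simp add: a_minus_def)
        ultimately have "nrm (D i) (l i) \<le> nrm (D i) (u N i \<ominus>\<^bsub>D i\<^esub> l i) + nrm (D i) (u N i)"
          by (simp add: D.cstar_dist_eq ui[OF i] l(1)[OF i])
        then show ?thesis using K N i by force
      qed
      then show ?thesis
        using l by (auto simp: product_algebra_in_carrier_iff l_def)
    qed
    then show "\<exists>l\<in>carrier ?P. \<forall>\<epsilon>>0. \<exists>N. \<forall>n\<ge>N. \<forall>i\<in>I. nrm (D i) (u n i \<ominus>\<^bsub>D i\<^esub> l i) \<le> \<epsilon>"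
      using lim by blast
  qed
qed

section \<open>Terms in the generators and their encoding\<close>

text \<open>Terms stay formal, with no algebra laws imposed, since they only name elements. Zero is
  named by \<open>Scale 0\<close> of any term.\<close>

datatype 'g star_term =
    Gen 'g
  | Add "'g star_term" "'g star_term"
  | Mul "'g star_term" "'g star_term"
  | Scale complex "'g star_term"
  | Star "'g star_term"

primrec star_eval :: "'x cstar_struct \<Rightarrow> ('g \<Rightarrow> 'x) \<Rightarrow> 'g star_term \<Rightarrow> 'x" where
  "star_eval B g (Gen a) = g a"
| "star_eval B g (Add t u) = star_eval B g t \<oplus>\<^bsub>B\<^esub> star_eval B g u"
| "star_eval B g (Mul t u) = star_eval B g t \<otimes>\<^bsub>B\<^esub> star_eval B g u"
| "star_eval B g (Scale c t) = c \<odot>\<^bsub>B\<^esub> star_eval B g t"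
| "star_eval B g (Star t) = (star_eval B g t)\<^sup>\<star>\<^bsub>B\<^esub>"

text \<open>Terms are stored as functions on words: the value at the empty word identifies the head
  symbol, and the marker of the first letter selects one of two subtrees.\<close>

definition term_node ::
  "complex \<Rightarrow> (('g \<times> bool) list \<Rightarrow> complex) \<Rightarrow> (('g \<times> bool) list \<Rightarrow> complex) \<Rightarrow> ('g \<times> bool) list \<Rightarrow> complex" where
  "term_node c f h w = (case w of [] \<Rightarrow> c | x # v \<Rightarrow> if snd x then f v else h v)"

lemma term_node_eq_iff: "term_node c f h = term_node c' f' h' \<longleftrightarrow> c = c' \<and> f = f' \<and> h = h'"
proof
  assume eq: "term_node c f h = term_node c' f' h'"
  have "f v = f' v" "h v = h' v" for v
    using fun_cong[OF eq, of "(undefined, True) # v"] fun_cong[OF eq, of "(undefined, False) # v"]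
    by (simp_all add: term_node_def)
  then show "c = c' \<and> f = f' \<and> h = h'"
    using fun_cong[OF eq, of "[]"] by (auto simp: term_node_def)
qed simp

text \<open>The numbers 1 to 5 tag the head constructor. A symbol is stored as the indicator of a
  one-letter word and a scalar as a constant function, so that both fit into the slot of a subtree;
  the zero function fills an empty slot.\<close>

primrec term_code :: "'g star_term \<Rightarrow> ('g \<times> bool) list \<Rightarrow> complex" where
  "term_code (Gen a) = term_node 1 (\<lambda>w. of_bool (w = [(a, True)])) (\<lambda>_. 0)"
| "term_code (Add t u) = term_node 2 (term_code t) (term_code u)"
| "term_code (Mul t u) = term_node 3 (term_code t) (term_code u)"
| "term_code (Scale c t) = term_node 4 (term_code t) (\<lambda>_. c)"
| "term_code (Star t) = term_node 5 (term_code t) (\<lambda>_. 0)"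

lemma inj_term_code: "inj term_code"
proof (rule injI)
  show "term_code t = term_code u \<Longrightarrow> t = u" for t u :: "'g star_term"
  proof (induction t arbitrary: u)
    case (Gen a)
    show ?case
    proof (cases u)
      case [simp]: (Gen b)
      have "(\<lambda>w. of_bool (w = [(a, True)]) :: complex) = (\<lambda>w. of_bool (w = [(b, True)]))"
        using Gen.prems by (simp add: term_node_eq_iff)
      from fun_cong[OF this, of "[(a, True)]"] show ?thesis by (simp split: if_splits)
    qed (use Gen in \<open>simp_all add: term_node_eq_iff\<close>)
  next
    case (Add t1 t2)
    then show ?case by (cases u) (simp_all add: term_node_eq_iff)
  next
    case (Mul t1 t2)
    then show ?case by (cases u) (simp_all add: term_node_eq_iff)
  next
    case (Scale c t)
    then show ?case by (cases u) (auto simp: term_node_eq_iff dest: fun_cong)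
  next
    case (Star t)
    then show ?case by (cases u) (simp_all add: term_node_eq_iff)
  qed
qed

text \<open>The approximating sequence is taken among the arguments of \<open>f\<close>: later these
  are terms, and the term sequences are what encodes a limit.\<close>

lemma (in Metric_space) in_closure_of_range_iff:
  assumes "range f \<subseteq> M"
  shows "l \<in> mtopology closure_of range f \<longleftrightarrow> (\<exists>u. limitin mtopology (\<lambda>n. f (u n)) l sequentially)"
proof
  assume l: "l \<in> mtopology closure_of range f"
  then have "l \<in> M" by (simp add: metric_closure_of)
  have "\<exists>t. d (f t) l < inverse (real (Suc n))" for n
  proof -
    have "\<exists>y\<in>range f. y \<in> mball l (inverse (real (Suc n)))"
      using l by (simp add: metric_closure_of)
    then show ?thesis by (auto simp: commute)
  qed
  then obtain u where u: "\<And>n. d (f (u n)) l < inverse (real (Suc n))" by metis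
  have "(\<lambda>n. d (f (u n)) l) \<longlonglongrightarrow> 0"
    by (rule Lim_null_comparison[OF always_eventually LIMSEQ_inverse_real_of_nat])
       (simp add: u less_imp_le del: of_nat_Suc)
  then show "\<exists>u. limitin mtopology (\<lambda>n. f (u n)) l sequentially"
    using assms \<open>l \<in> M\<close> by (auto simp: limitin_metric_dist_null image_subset_iff)
next
  assume "\<exists>u. limitin mtopology (\<lambda>n. f (u n)) l sequentially"
  then obtain u where u: "limitin mtopology (\<lambda>n. f (u n)) l sequentially" by blast
  have "\<exists>y\<in>range f. y \<in> mball l r" if "r > 0" for r
  proof -
    have "eventually (\<lambda>n. f (u n) \<in> M \<and> d (f (u n)) l < r) sequentially"
      using u that by (simp add: limitin_metric)
    then obtain n where "f (u n) \<in> M" "d (f (u n)) l < r"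
      by (auto simp: eventually_sequentially)
    then have "f (u n) \<in> mball l r"
      using limitin_mspace[OF u] by (simp add: commute)
    then show ?thesis by blast
  qed
  then show "l \<in> mtopology closure_of range f"
    using limitin_mspace[OF u] by (simp add: metric_closure_of)
qed

text \<open>An element of the C*-subalgebra generated by \<open>g\<close> is represented by the set of all
  sequences of terms converging to it.\<close>

lemma (in cstar_algebra) generated_copy:
  fixes g :: "'g \<Rightarrow> 'x"
  assumes g: "\<And>a. g a \<in> carrier B"
  obtains C :: "(nat \<Rightarrow> ('g \<times> bool) list \<Rightarrow> complex) set cstar_struct" and \<psi> g'
  where "cstar_algebra C" "star_hom C B \<psi>" "inj_on \<psi> (carrier C)"
    "\<And>a. g' a \<in> carrier C" "\<And>a. \<psi> (g' a) = g a" "cstar_algebra.generated_by C (range g')"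
proof -
  define T where "T = star_eval B g"
  have T: "T t \<in> carrier B" for t
    unfolding T_def by (induction t) (simp_all add: g mult_closed star_closed)
  have rT: "range (\<lambda>n. T (u n)) \<subseteq> carrier B" for u :: "nat \<Rightarrow> 'g star_term" using T by auto
  define K where "K = metric.mtopology closure_of range T"
  have K_iff: "x \<in> K \<longleftrightarrow> (\<exists>u. limitin metric.mtopology (\<lambda>n. T (u n)) x sequentially)" for x
    unfolding K_def using T by (intro metric.in_closure_of_range_iff) auto
  have K_sub: "K \<subseteq> carrier B"
    unfolding K_iff subset_iff using metric.limitin_mspace by blast
  have K_closed: "closedin metric.mtopology K" by (simp add: K_def)
  have TK: "T t \<in> K" for t
    unfolding K_iff by (rule exI[of _ "\<lambda>_. t"]) (simp add: T)
  \<comment> \<open>Each operation on limits is matched by a constructor applied termwise to the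
    approximating term sequences; this is how \<open>K\<close> is closed under all of them.\<close>
  have K_add: "x \<oplus> y \<in> K" if "x \<in> K" "y \<in> K" for x y
  proof -
    obtain u v where "limitin metric.mtopology (\<lambda>n. T (u n)) x sequentially"
      "limitin metric.mtopology (\<lambda>n. T (v n)) y sequentially"
      using \<open>x \<in> K\<close> \<open>y \<in> K\<close> unfolding K_iff by blast
    from limitin_add[OF rT rT this] show ?thesis
      unfolding K_iff by (intro exI[of _ "\<lambda>n. Add (u n) (v n)"]) (simp add: T_def)
  qed
  have K_mult: "x \<otimes> y \<in> K" if "x \<in> K" "y \<in> K" for x y
  proof -
    obtain u v where "limitin metric.mtopology (\<lambda>n. T (u n)) x sequentially"
      "limitin metric.mtopology (\<lambda>n. T (v n)) y sequentially"
      using \<open>x \<in> K\<close> \<open>y \<in> K\<close> unfolding K_iff by blast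
    from limitin_mult[OF rT rT this] show ?thesis
      unfolding K_iff by (intro exI[of _ "\<lambda>n. Mul (u n) (v n)"]) (simp add: T_def)
  qed
  have K_smult: "c \<odot> x \<in> K" if "x \<in> K" for c x
  proof -
    obtain u where "limitin metric.mtopology (\<lambda>n. T (u n)) x sequentially"
      using \<open>x \<in> K\<close> unfolding K_iff by blast
    from limitin_smult[OF rT this] show ?thesis
      unfolding K_iff by (intro exI[of _ "\<lambda>n. Scale c (u n)"]) (simp add: T_def)
  qed
  have K_star: "x\<^sup>\<star> \<in> K" if "x \<in> K" for x
  proof -
    obtain u where "limitin metric.mtopology (\<lambda>n. T (u n)) x sequentially"
      using \<open>x \<in> K\<close> unfolding K_iff by blast
    from limitin_star[OF rT this] show ?thesis
      unfolding K_iff by (intro exI[of _ "\<lambda>n. Star (u n)"]) (simp add: T_def)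
  qed
  \<comment> \<open>The type of symbols is inhabited, so there is some term, and its multiple by 0
    is the zero element.\<close>
  have K_zero: "\<zero> \<in> K"
    using K_smult[OF TK[of undefined], of 0] zero_smult[OF T[of undefined]] by simp

  define code where
    "code x = {term_code \<circ> u | u. limitin metric.mtopology (\<lambda>n. T (u n)) x sequentially}" for x
  \<comment> \<open>A common member determines both limits: \<open>term_code\<close> recovers the
    terms, and limits are unique. Membership in \<open>K\<close> ensures that the code has a
    member.\<close>
  have code_inj: "inj_on code K"
  proof (rule inj_onI)
    fix x y assume xy: "x \<in> K" "code x = code y"
    obtain u where u: "limitin metric.mtopology (\<lambda>n. T (u n)) x sequentially"
      using xy(1) unfolding K_iff by blast
    then have "term_code \<circ> u \<in> code y" using xy(2) by (auto simp: code_def)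
    then obtain v where v: "limitin metric.mtopology (\<lambda>n. T (v n)) y sequentially"
      and eq: "term_code \<circ> u = term_code \<circ> v" by (auto simp: code_def)
    have "u n = v n" for n using fun_cong[OF eq, of n] by (simp add: inj_eq[OF inj_term_code])
    then show "x = y" using metric.limitin_metric_unique[OF u] v by simp
  qed
  define dec where "dec = inv_into K code"
  have dec_code [simp]: "dec (code x) = x" if "x \<in> K" for x
    using that code_inj by (simp add: dec_def)
  \<comment> \<open>Transport of structure along the bijection \<open>code\<close>, which makes
    \<open>dec\<close> an isometric homomorphism by construction.\<close>
  define C where "C =
    \<lparr>carrier = code ` K, monoid.mult = (\<lambda>x y. code (dec x \<otimes> dec y)), one = undefined,
     ring.zero = code \<zero>, add = (\<lambda>x y. code (dec x \<oplus> dec y)),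
     module.smult = (\<lambda>c x. code (c \<odot> dec x)), star = (\<lambda>x. code ((dec x)\<^sup>\<star>)),
     nrm = (\<lambda>x. nrm B (dec x))\<rparr>"
  have carrier_C: "carrier C = code ` K" by (simp add: C_def)
  have C_simps:
    "\<zero>\<^bsub>C\<^esub> = code \<zero>" "x \<oplus>\<^bsub>C\<^esub> y = code (dec x \<oplus> dec y)" "x \<otimes>\<^bsub>C\<^esub> y = code (dec x \<otimes> dec y)"
    "c \<odot>\<^bsub>C\<^esub> x = code (c \<odot> dec x)" "x\<^sup>\<star>\<^bsub>C\<^esub> = code ((dec x)\<^sup>\<star>)" "nrm C x = nrm B (dec x)" for x y c
    by (simp_all add: C_def)
  note K_ops = K_zero K_add K_mult K_smult K_star
  have hom: "star_hom C B dec"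
    using K_sub by (auto simp: star_hom_def carrier_C C_simps K_ops)
  have inj_dec: "inj_on dec (carrier C)"
    by (auto simp: carrier_C inj_on_def)
  have C: "cstar_algebra C"
  \<comment> \<open>A single injective homomorphism is a separating family; the index type
    \<open>unit\<close> makes the supremum trivial. Completeness is where closedness of
    \<open>K\<close> enters.\<close>
  proof (rule cstar_algebra_of_separating_homs[where I = "UNIV :: unit set" and D = "\<lambda>_. B" and \<phi> = "\<lambda>_. dec"])
    show "cstar_algebra B" by (rule cstar_algebra_axioms)
    show "star_hom C B dec" by (rule hom)
    fix u :: "nat \<Rightarrow> (nat \<Rightarrow> ('g \<times> bool) list \<Rightarrow> complex) set"
    assume u: "range u \<subseteq> carrier C"
      and cauchy: "\<And>\<epsilon>. 0 < \<epsilon> \<Longrightarrow> \<exists>N. \<forall>m\<ge>N. \<forall>n\<ge>N. \<forall>i\<in>(UNIV :: unit set). nrm B (dec (u m) \<ominus> dec (u n)) \<le> \<epsilon>"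
    have du: "dec (u n) \<in> K" for n
    proof -
      have "u n \<in> code ` K" using u carrier_C by auto
      then show ?thesis by auto
    qed
    then have dB: "dec (u n) \<in> carrier B" for n using K_sub by auto
    have "metric.MCauchy (\<lambda>n. dec (u n))"
      unfolding metric.MCauchy_def
    proof (intro conjI allI impI)
      fix \<epsilon> :: real assume \<epsilon>: "\<epsilon> > 0"
      obtain N where N: "\<forall>m\<ge>N. \<forall>n\<ge>N. nrm B (dec (u m) \<ominus> dec (u n)) \<le> \<epsilon> / 2"
        using cauchy[of "\<epsilon> / 2"] \<epsilon> by auto
      have "cstar_dist B (dec (u m)) (dec (u n)) < \<epsilon>" if "N \<le> m" "N \<le> n" for m n
      proof -
        have "cstar_dist B (dec (u m)) (dec (u n)) \<le> \<epsilon> / 2"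
          using N that by (simp add: cstar_dist_eq dB)
        then show ?thesis using \<epsilon> by linarith
      qed
      then show "\<exists>N. \<forall>n n'. N \<le> n \<longrightarrow> N \<le> n' \<longrightarrow> cstar_dist B (dec (u n)) (dec (u n')) < \<epsilon>" by blast
    qed (use dB in auto)
    then obtain l where l: "limitin metric.mtopology (\<lambda>n. dec (u n)) l sequentially"
      using complete unfolding metric.mcomplete_def by blast
    have "range (\<lambda>n. dec (u n)) \<subseteq> K" using du by auto
    then have lK: "l \<in> K"
      using K_closed l unfolding metric.metric_closedin_iff_sequentially_closed by blast
    have lim: "(\<lambda>n. nrm B (dec (u n) \<ominus> dec (code l))) \<longlonglongrightarrow> 0"
      using l dB by (simp add: limitin_range_iff image_subset_iff lK)
    have "\<exists>N. \<forall>n\<ge>N. nrm B (dec (u n) \<ominus> dec (code l)) \<le> \<epsilon>" if "\<epsilon> > 0" for \<epsilon>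
      using order_tendstoD(2)[OF lim that] by (auto simp: eventually_sequentially intro: less_imp_le)
    then show "\<exists>l\<in>carrier C. \<forall>\<epsilon>>0. \<exists>N. \<forall>n\<ge>N. \<forall>i\<in>(UNIV :: unit set). nrm B (dec (u n) \<ominus> dec l) \<le> \<epsilon>"
      using lK by (intro bexI[of _ "code l"]) (simp_all add: carrier_C)
  qed (use inj_dec in \<open>auto simp: carrier_C C_simps K_ops inj_on_def\<close>)
  interpret C: cstar_algebra C by (rule C)
  interpret dec: star_homomorphism C B dec by unfold_locales (rule hom)
  define g' where "g' a = code (g a)" for a
  have gK: "g a \<in> K" for a using TK[of "Gen a"] by (simp add: T_def)
  have "C.generated_by (range g')"
    unfolding C.generated_by_def
  proof (intro conjI antisym)
    show "range g' \<subseteq> carrier C" by (auto simp: g'_def carrier_C gK)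
    have "C.cstar_subalgebra (carrier C)"
      unfolding C.cstar_subalgebra_def
      using C.metric.closedin_mspace[unfolded C.metric.topspace_mtopology]
      by (auto intro: C.mult_closed C.star_closed)
    then show "\<Inter> {A. C.cstar_subalgebra A \<and> range g' \<subseteq> A} \<subseteq> carrier C"
      by (rule_tac Inter_lower) (auto simp: g'_def carrier_C gK)
    show "carrier C \<subseteq> \<Inter> {A. C.cstar_subalgebra A \<and> range g' \<subseteq> A}"
    proof (intro subsetI InterI, clarify)
      fix x A assume x: "x \<in> carrier C" and A: "C.cstar_subalgebra A" "range g' \<subseteq> A"
      \<comment> \<open>Values of terms lie in every subalgebra containing the generators, by
        induction on the term. All other elements are limits of such values, and \<open>A\<close> is
        closed.\<close>
      have TA: "code (T t) \<in> A" for t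
      proof (induction t)
        case (Gen a)
        then show ?case using A(2) by (auto simp: T_def g'_def)
      next
        case (Add t u)
        then have "code (T t) \<oplus>\<^bsub>C\<^esub> code (T u) \<in> A" using A(1) by (simp add: C.cstar_subalgebra_def)
        then show ?case by (simp add: C_simps TK) (simp add: T_def)
      next
        case (Mul t u)
        then have "code (T t) \<otimes>\<^bsub>C\<^esub> code (T u) \<in> A" using A(1) by (simp add: C.cstar_subalgebra_def)
        then show ?case by (simp add: C_simps TK) (simp add: T_def)
      next
        case (Scale c t)
        then have "c \<odot>\<^bsub>C\<^esub> code (T t) \<in> A" using A(1) by (simp add: C.cstar_subalgebra_def)
        then show ?case by (simp add: C_simps TK) (simp add: T_def)
      next
        case (Star t)
        then have "(code (T t))\<^sup>\<star>\<^bsub>C\<^esub> \<in> A" using A(1) by (simp add: C.cstar_subalgebra_def)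
        then show ?case by (simp add: C_simps TK) (simp add: T_def)
      qed
      obtain y where y: "y \<in> K" "x = code y" using x by (auto simp: carrier_C)
      obtain u where u: "limitin metric.mtopology (\<lambda>n. T (u n)) y sequentially"
        using y(1) unfolding K_iff by blast
      have lim: "(\<lambda>n. nrm B (T (u n) \<ominus> y)) \<longlonglongrightarrow> 0" using u rT by (simp add: limitin_range_iff)
      have in_C: "code (T (u n)) \<in> carrier C" for n by (simp add: carrier_C TK)
      have "nrm C (code (T (u n)) \<ominus>\<^bsub>C\<^esub> x) = nrm B (T (u n) \<ominus> y)" for n
        using in_C x y by (simp add: C_simps(6) dec.hom_minus TK)
      then have "limitin C.metric.mtopology (\<lambda>n. code (T (u n))) x sequentially"
        using lim in_C x by (subst C.limitin_range_iff) auto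
      moreover have "range (\<lambda>n. code (T (u n))) \<subseteq> A" using TA by auto
      ultimately show "x \<in> A"
        using A(1) unfolding C.cstar_subalgebra_def C.metric.metric_closedin_iff_sequentially_closed
        by blast
    qed
  qed
  moreover have "g' a \<in> carrier C" "dec (g' a) = g a" for a
    by (simp_all add: g'_def carrier_C gK)
  ultimately show thesis using that[OF C hom inj_dec] by blast
qed

section \<open>Universal representations\<close>

lemma (in labelled_graph) letter_in_labelled_paths:
  assumes "a \<in> letters" shows "[a] \<in> labelled_paths"
proof -
  obtain e where e: "e \<in> arcs G" "a = L e" using assms by (auto simp: letters_def)
  then have "awalk (tail G e) [e] (head G e)" by (simp add: awalk_def cas_simp)
  then show ?thesis using e(2) unfolding labelled_paths_def by (intro CollectI exI[of _ "[e]"]) auto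
qed

lemma (in labelled_graph) letter_range_iff:
  "v \<in> rel_range A [a] \<longleftrightarrow> (\<exists>e\<in>arcs G. tail G e \<in> A \<and> L e = a \<and> head G e = v)"
proof
  assume "\<exists>e\<in>arcs G. tail G e \<in> A \<and> L e = a \<and> head G e = v"
  then obtain e where e: "e \<in> arcs G" "tail G e \<in> A" "L e = a" "head G e = v" by blast
  then have "awalk (tail G e) [e] v" by (simp add: awalk_def cas_simp)
  then show "v \<in> rel_range A [a]"
    using e unfolding rel_range_def
    by (intro CollectI bexI[of _ "tail G e"] exI[of _ "[e]"]) simp_all
qed (auto simp: rel_range_def awalk_def cas_simp)

lemma (in labelled_space) lab_range_in_space: "a \<in> letters \<Longrightarrow> lab_range [a] \<in> \<B>"
  by (rule lab_range_closed[OF letter_in_labelled_paths])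

lemma (in labelled_space) letter_range_in_space:
  "\<lbrakk>a \<in> letters; A \<in> \<B>\<rbrakk> \<Longrightarrow> rel_range A [a] \<in> \<B>"
  by (rule rel_range_closed[OF _ letter_in_labelled_paths])

text \<open>All relations of a representation are equations in the operations, which homomorphisms
  preserve and a separating family reflects. It serves for a copy, with one injective homomorphism,
  and for a product, with all coordinate maps.\<close>

lemma labelled_space_rep_of_separating_homs:
  fixes C :: "'x cstar_struct" and D :: "'i \<Rightarrow> 'y cstar_struct" and \<phi> :: "'i \<Rightarrow> 'x \<Rightarrow> 'y"
  assumes space: "wlr_labelled_space G L \<B>" and C: "cstar_algebra C"
    and rep: "\<And>i. i \<in> I \<Longrightarrow> labelled_space_rep G L \<B> (D i) (t i) (q i)"
    and hom: "\<And>i. i \<in> I \<Longrightarrow> star_hom C (D i) (\<phi> i)"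
    and sep: "\<And>x y. \<lbrakk>x \<in> carrier C; y \<in> carrier C; \<And>i. i \<in> I \<Longrightarrow> \<phi> i x = \<phi> i y\<rbrakk> \<Longrightarrow> x = y"
    and s: "\<And>a. a \<in> labelled_graph.letters G L \<Longrightarrow> s a \<in> carrier C"
    and p: "\<And>A. A \<in> \<B> \<Longrightarrow> p A \<in> carrier C"
    and \<phi>_s: "\<And>i a. \<lbrakk>i \<in> I; a \<in> labelled_graph.letters G L\<rbrakk> \<Longrightarrow> \<phi> i (s a) = t i a"
    and \<phi>_p: "\<And>i A. \<lbrakk>i \<in> I; A \<in> \<B>\<rbrakk> \<Longrightarrow> \<phi> i (p A) = q i A"
  shows "labelled_space_rep G L \<B> C s p"
proof -
  interpret wlr_labelled_space G L \<B> by (rule space)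
  interpret C: cstar_algebra C by (rule C)
  have homs: "star_homomorphism C (D i) (\<phi> i)" if "i \<in> I" for i
    by (intro star_homomorphism.intro star_homomorphism_axioms.intro C hom that
        labelled_space_rep.axioms(2)[OF rep])
  note ev = star_homomorphism.hom_add[OF homs] star_homomorphism.hom_mult[OF homs]
    star_homomorphism.hom_star[OF homs] star_homomorphism.hom_zero[OF homs]
    star_homomorphism.hom_minus[OF homs] \<phi>_s \<phi>_p
  note closed = s p C.mult_closed C.star_closed
  note rr = letter_range_in_space and lr = lab_range_in_space
  show ?thesis
  proof unfold_locales
    fix A assume A: "A \<in> \<B>"
    have "(p A)\<^sup>\<star>\<^bsub>C\<^esub> = p A"
    proof (rule sep)
      fix i assume i: "i \<in> I"
      interpret D: labelled_space_rep G L \<B> "D i" "t i" "q i" by (rule rep[OF i])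
      show "\<phi> i ((p A)\<^sup>\<star>\<^bsub>C\<^esub>) = \<phi> i (p A)"
        using D.rep_projection[OF A] by (simp add: i A p ev D.projection_def)
    qed (simp_all add: A closed)
    moreover have "p A \<otimes>\<^bsub>C\<^esub> p A = p A"
    proof (rule sep)
      fix i assume i: "i \<in> I"
      interpret D: labelled_space_rep G L \<B> "D i" "t i" "q i" by (rule rep[OF i])
      show "\<phi> i (p A \<otimes>\<^bsub>C\<^esub> p A) = \<phi> i (p A)"
        using D.rep_projection[OF A] by (simp add: i A p ev D.projection_def)
    qed (simp_all add: A closed)
    ultimately show "C.projection (p A)" by (simp add: C.projection_def A p)
  next
    fix a assume a: "a \<in> letters"
    have "s a \<otimes>\<^bsub>C\<^esub> (s a)\<^sup>\<star>\<^bsub>C\<^esub> \<otimes>\<^bsub>C\<^esub> s a = s a"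
    proof (rule sep)
      fix i assume i: "i \<in> I"
      interpret D: labelled_space_rep G L \<B> "D i" "t i" "q i" by (rule rep[OF i])
      show "\<phi> i (s a \<otimes>\<^bsub>C\<^esub> (s a)\<^sup>\<star>\<^bsub>C\<^esub> \<otimes>\<^bsub>C\<^esub> s a) = \<phi> i (s a)"
        using D.rep_partial_isometry[OF a] by (simp add: i a closed ev D.partial_isometry_def)
    qed (simp_all add: a closed)
    then show "C.partial_isometry (s a)" by (simp add: C.partial_isometry_def a s)
    show "(s a)\<^sup>\<star>\<^bsub>C\<^esub> \<otimes>\<^bsub>C\<^esub> s a = p (lab_range [a])"
    proof (rule sep)
      fix i assume i: "i \<in> I"
      interpret D: labelled_space_rep G L \<B> "D i" "t i" "q i" by (rule rep[OF i])
      show "\<phi> i ((s a)\<^sup>\<star>\<^bsub>C\<^esub> \<otimes>\<^bsub>C\<^esub> s a) = \<phi> i (p (lab_range [a]))"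
        using D.rep_initial[OF a] by (simp add: i a closed lr ev)
    qed (simp_all add: a closed lr)
  next
    fix A A' assume A: "A \<in> \<B>" "A' \<in> \<B>"
    note AA = Un_closed[OF A] Int_closed[OF A]
    show "p A \<otimes>\<^bsub>C\<^esub> p A' = p (A \<inter> A')"
    proof (rule sep)
      fix i assume i: "i \<in> I"
      interpret D: labelled_space_rep G L \<B> "D i" "t i" "q i" by (rule rep[OF i])
      show "\<phi> i (p A \<otimes>\<^bsub>C\<^esub> p A') = \<phi> i (p (A \<inter> A'))"
        using D.rep_Int[OF A] by (simp add: i A AA closed ev)
    qed (simp_all add: A AA closed)
    show "p (A \<union> A') = p A \<oplus>\<^bsub>C\<^esub> p A' \<ominus>\<^bsub>C\<^esub> p (A \<inter> A')"
    proof (rule sep)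
      fix i assume i: "i \<in> I"
      interpret D: labelled_space_rep G L \<B> "D i" "t i" "q i" by (rule rep[OF i])
      show "\<phi> i (p (A \<union> A')) = \<phi> i (p A \<oplus>\<^bsub>C\<^esub> p A' \<ominus>\<^bsub>C\<^esub> p (A \<inter> A'))"
        using D.rep_Un[OF A] by (simp add: i A AA closed ev)
    qed (simp_all add: A AA closed)
  next
    assume e: "{} \<in> \<B>"
    show "p {} = \<zero>\<^bsub>C\<^esub>"
    proof (rule sep)
      fix i assume i: "i \<in> I"
      interpret D: labelled_space_rep G L \<B> "D i" "t i" "q i" by (rule rep[OF i])
      show "\<phi> i (p {}) = \<phi> i \<zero>\<^bsub>C\<^esub>"
        using D.rep_empty[OF e] by (simp add: i e ev)
    qed (simp_all add: e closed)
  next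
    fix a A assume a: "a \<in> letters" and A: "A \<in> \<B>"
    show "p A \<otimes>\<^bsub>C\<^esub> s a = s a \<otimes>\<^bsub>C\<^esub> p (rel_range A [a])"
    proof (rule sep)
      fix i assume i: "i \<in> I"
      interpret D: labelled_space_rep G L \<B> "D i" "t i" "q i" by (rule rep[OF i])
      show "\<phi> i (p A \<otimes>\<^bsub>C\<^esub> s a) = \<phi> i (s a \<otimes>\<^bsub>C\<^esub> p (rel_range A [a]))"
        using D.rep_commute[OF a A] by (simp add: i a A closed rr ev)
    qed (simp_all add: a A closed rr)
  next
    fix a b assume ab: "a \<in> letters" "b \<in> letters" "a \<noteq> b"
    show "(s a)\<^sup>\<star>\<^bsub>C\<^esub> \<otimes>\<^bsub>C\<^esub> s b = \<zero>\<^bsub>C\<^esub>"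
    proof (rule sep)
      fix i assume i: "i \<in> I"
      interpret D: labelled_space_rep G L \<B> "D i" "t i" "q i" by (rule rep[OF i])
      show "\<phi> i ((s a)\<^sup>\<star>\<^bsub>C\<^esub> \<otimes>\<^bsub>C\<^esub> s b) = \<phi> i \<zero>\<^bsub>C\<^esub>"
        using D.rep_orthogonal[OF ab] by (simp add: i ab(1,2) closed ev)
    qed (simp_all add: ab closed)
  next
    fix A assume A: "A \<in> \<B>" "finite (emitted A)" "emitted A \<noteq> {}" "finite (A \<inter> sinks)"
    \<comment> \<open>For \<open>rep_sum\<close> the homomorphism has to be moved inside finite
      sums, whose summands must first be known to lie in the carriers.\<close>
    let ?f = "\<lambda>a. s a \<otimes>\<^bsub>C\<^esub> p (rel_range A [a]) \<otimes>\<^bsub>C\<^esub> (s a)\<^sup>\<star>\<^bsub>C\<^esub>" and ?h = "\<lambda>v. p {v}"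
    have f: "?f \<in> emitted A \<rightarrow> carrier C" using A by (auto simp: emitted_def closed rr)
    have h: "?h \<in> A \<inter> sinks \<rightarrow> carrier C" by (auto intro: p sink_closed)
    note fin = C.M.finsum_closed[OF f] C.M.finsum_closed[OF h]
    show "p A = (\<Oplus>\<^bsub>C\<^esub>a\<in>emitted A. ?f a) \<oplus>\<^bsub>C\<^esub> (\<Oplus>\<^bsub>C\<^esub>v\<in>A \<inter> sinks. ?h v)"
    proof (rule sep)
      fix i assume i: "i \<in> I"
      interpret D: labelled_space_rep G L \<B> "D i" "t i" "q i" by (rule rep[OF i])
      have c: "t i a \<in> carrier (D i)" "q i A' \<in> carrier (D i)" if "a \<in> letters" "A' \<in> \<B>" for a A'
        using D.rep_partial_isometry[OF that(1)] D.rep_projection[OF that(2)]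
        by (simp_all add: D.partial_isometry_def D.projection_def)
      have "(\<Oplus>\<^bsub>D i\<^esub>a\<in>emitted A. \<phi> i (?f a))
          = (\<Oplus>\<^bsub>D i\<^esub>a\<in>emitted A. t i a \<otimes>\<^bsub>D i\<^esub> q i (rel_range A [a]) \<otimes>\<^bsub>D i\<^esub> (t i a)\<^sup>\<star>\<^bsub>D i\<^esub>)"
        using A(1) by (intro D.M.finsum_cong') (auto simp: emitted_def i closed rr ev c D.mult_closed D.star_closed)
      moreover have "(\<Oplus>\<^bsub>D i\<^esub>v\<in>A \<inter> sinks. \<phi> i (?h v)) = (\<Oplus>\<^bsub>D i\<^esub>v\<in>A \<inter> sinks. q i {v})"
        using c(2)[OF _ sink_closed] A(3)
        by (intro D.M.finsum_cong') (auto simp: emitted_def i ev sink_closed)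
      ultimately show "\<phi> i (p A) = \<phi> i ((\<Oplus>\<^bsub>C\<^esub>a\<in>emitted A. ?f a) \<oplus>\<^bsub>C\<^esub> (\<Oplus>\<^bsub>C\<^esub>v\<in>A \<inter> sinks. ?h v))"
        using D.rep_sum[OF A]
        by (simp add: i A(1) ev fin star_homomorphism.hom_finsum[OF homs] f h)
    qed (simp_all add: A closed fin)
  qed
qed

section \<open>Norm bounds, copies and products of representations\<close>

context labelled_space_rep
begin

lemma p_in_carrier: "A \<in> \<B> \<Longrightarrow> p A \<in> carrier D"
  using rep_projection by (simp add: projection_def)

lemma s_in_carrier: "a \<in> letters \<Longrightarrow> s a \<in> carrier D"
  using rep_partial_isometry by (simp add: partial_isometry_def)

lemma nrm_p_le: "A \<in> \<B> \<Longrightarrow> nrm D (p A) \<le> 1"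
  by (rule nrm_projection_le[OF rep_projection])

lemma nrm_s_le: assumes "a \<in> letters" shows "nrm D (s a) \<le> 1"
proof -
  have "(nrm D (s a))\<^sup>2 \<le> 1\<^sup>2"
    using nrm_cstar[OF s_in_carrier[OF assms]] rep_initial[OF assms]
      nrm_p_le[OF lab_range_in_space[OF assms]] by simp
  then show ?thesis by (rule power2_le_imp_le) simp
qed

text \<open>The homomorphism runs from the copy to the original. A homomorphism into the copy can
  therefore be continued to the original, which is why testing universality on the fixed type
  suffices.\<close>

lemma generated_copy_rep:
  obtains C :: "('v, 'a) univ_carrier cstar_struct" and s' p' \<psi>
  where "labelled_space_rep G L \<B> C s' p'" "rep_generates G L \<B> C s' p'" "star_hom C D \<psi>"
    "\<And>a. a \<in> letters \<Longrightarrow> \<psi> (s' a) = s a" "\<And>A. A \<in> \<B> \<Longrightarrow> \<psi> (p' A) = p A"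
proof -
  \<comment> \<open>\<open>generated_copy\<close> expects a family on all symbols. Those outside
    \<open>\<B>\<close> and \<open>letters\<close> get the value zero, which lies in every
    subalgebra and so does not affect generation.\<close>
  define g where "g x = (case x of Inl A \<Rightarrow> if A \<in> \<B> then p A else \<zero> | Inr a \<Rightarrow> if a \<in> letters then s a else \<zero>)"
    for x :: "'v set + 'a"
  have g: "g x \<in> carrier D" for x
    by (simp add: g_def p_in_carrier s_in_carrier split: sum.split)
  from generated_copy[of g, OF g] obtain C :: "('v, 'a) univ_carrier cstar_struct" and \<psi> g'
    where C: "cstar_algebra C" and \<psi>: "star_hom C D \<psi>" "inj_on \<psi> (carrier C)"
      and g': "\<And>x. g' x \<in> carrier C" "\<And>x. \<psi> (g' x) = g x"
      and gen: "cstar_algebra.generated_by C (range g')" by blast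
  define s' p' where "s' a = g' (Inr a)" and "p' A = g' (Inl A)" for a A
  interpret C: cstar_algebra C by (rule C)
  interpret \<psi>: star_homomorphism C D \<psi> by unfold_locales (rule \<psi>)
  have \<psi>_s: "\<psi> (s' a) = s a" if "a \<in> letters" for a using that by (simp add: s'_def g' g_def)
  have \<psi>_p: "\<psi> (p' A) = p A" if "A \<in> \<B>" for A using that by (simp add: p'_def g' g_def)
  have rep: "labelled_space_rep G L \<B> C s' p'"
  proof (rule labelled_space_rep_of_separating_homs[where I = "UNIV :: unit set" and
        D = "\<lambda>_. D" and \<phi> = "\<lambda>_. \<psi>" and t = "\<lambda>_. s" and q = "\<lambda>_. p"])
    show "wlr_labelled_space G L \<B>" by (rule wlr_labelled_space_axioms)
    show "labelled_space_rep G L \<B> D s p" by (rule labelled_space_rep_axioms)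
    show "x = y" if "x \<in> carrier C" "y \<in> carrier C" "\<And>i. i \<in> (UNIV :: unit set) \<Longrightarrow> \<psi> x = \<psi> y" for x y
      using that \<psi>(2) by (auto simp: inj_on_def)
  qed (simp_all add: C \<psi> \<psi>_s \<psi>_p, simp_all add: s'_def p'_def g')
  have "C.generated_by (s' ` letters \<union> p' ` \<B>)"
  proof -
    have "g' x \<in> A" if A: "C.cstar_subalgebra A" "s' ` letters \<union> p' ` \<B> \<subseteq> A" for x A
    proof (cases "g x = \<zero>")
      case True
      then have "g' x = \<zero>\<^bsub>C\<^esub>"
        using inj_onD[OF \<psi>(2), of "g' x" "\<zero>\<^bsub>C\<^esub>"] by (simp add: g' \<psi>.hom_zero)
      then show ?thesis using A(1) by (simp add: C.cstar_subalgebra_def)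
    next
      case False
      then show ?thesis
        using A(2) by (cases x) (auto simp: g_def s'_def p'_def split: if_splits)
    qed
    then have "{A. C.cstar_subalgebra A \<and> s' ` letters \<union> p' ` \<B> \<subseteq> A}
        = {A. C.cstar_subalgebra A \<and> range g' \<subseteq> A}"
      by (auto simp: s'_def p'_def)
    then show ?thesis
      using gen g' by (auto simp: C.generated_by_def s'_def p'_def)
  qed
  then have "rep_generates G L \<B> C s' p'" by (simp add: rep_generates_def)
  from that[OF rep this \<psi>(1) \<psi>_s \<psi>_p] show thesis .
qed

end

text \<open>Representations serve as their own indices, so evaluation at \<open>(D, t, q)\<close> is
  the homomorphism that universality asks for. Nonemptiness of \<open>R\<close> gives the supremum
  norm its meaning.\<close>

lemma product_rep:
  fixes R :: "('x cstar_struct \<times> ('a \<Rightarrow> 'x) \<times> ('v set \<Rightarrow> 'x)) set" and G :: "('v, 'e) pre_digraph"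
  assumes space: "wlr_labelled_space G L \<B>" and ne: "R \<noteq> {}"
    and rep: "\<And>D t q. (D, t, q) \<in> R \<Longrightarrow> labelled_space_rep G L \<B> D t q"
  obtains P s p where "labelled_space_rep G L \<B> (P :: ('x cstar_struct \<times> ('a \<Rightarrow> 'x) \<times> ('v set \<Rightarrow> 'x) \<Rightarrow> 'x) cstar_struct) s p"
    "\<And>D t q. (D, t, q) \<in> R \<Longrightarrow> star_hom P D (\<lambda>f. f (D, t, q))"
    "\<And>D t q a. (D, t, q) \<in> R \<Longrightarrow> s a (D, t, q) = t a"
    "\<And>D t q A. (D, t, q) \<in> R \<Longrightarrow> p A (D, t, q) = q A"
proof -
  interpret wlr_labelled_space G L \<B> by (rule space)
  have rep': "labelled_space_rep G L \<B> (fst r) (fst (snd r)) (snd (snd r))" if "r \<in> R" for r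
    using rep[of "fst r" "fst (snd r)" "snd (snd r)"] that by simp
  note alg = labelled_space_rep.axioms(2)[OF rep']
  define P where "P = product_algebra R (fst :: _ \<Rightarrow> 'x cstar_struct)"
  define s p where "s a = (\<lambda>r\<in>R. fst (snd r) a)" and "p A = (\<lambda>r\<in>R. snd (snd r) A)" for a A
  have P: "cstar_algebra P" unfolding P_def by (rule product_algebra_cstar(1)[OF ne alg])
  have hom: "star_hom P (fst r) (\<lambda>f. f r)" if "r \<in> R" for r
    unfolding P_def by (rule product_algebra_cstar(2)[OF ne alg that])
  have "labelled_space_rep G L \<B> P s p"
  proof (rule labelled_space_rep_of_separating_homs[OF space P rep' hom])
    show "x = y" if "x \<in> carrier P" "y \<in> carrier P" "\<And>r. r \<in> R \<Longrightarrow> x r = y r" for x y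
      using that by (auto simp: P_def product_algebra_in_carrier_iff intro: extensionalityI)
    show "s a \<in> carrier P" if "a \<in> letters" for a
      using that labelled_space_rep.s_in_carrier[OF rep'] labelled_space_rep.nrm_s_le[OF rep']
      by (auto simp: P_def product_algebra_in_carrier_iff s_def intro!: exI[of _ "1 :: real"])
    show "p A \<in> carrier P" if "A \<in> \<B>" for A
      using that labelled_space_rep.p_in_carrier[OF rep'] labelled_space_rep.nrm_p_le[OF rep']
      by (auto simp: P_def product_algebra_in_carrier_iff p_def intro!: exI[of _ "1 :: real"])
  qed (simp_all add: s_def p_def)
  moreover have "star_hom P D (\<lambda>f. f (D, t, q))" if "(D, t, q) \<in> R" for D t q
    using hom[OF that] by simp
  ultimately show thesis using that by (simp add: s_def p_def)
qed

text \<open>Since every representation factors through one carried by \<open>univ_carrier\<close>, a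
  representation universal for that type is universal for every type.\<close>

lemma universal_rep_exists:
  fixes G :: "('v, 'e) pre_digraph" and L :: "'e \<Rightarrow> 'a" and D0 :: "'x cstar_struct"
  assumes rep0: "labelled_space_rep G L \<B> D0 s0 p0"
  obtains B :: "('v, 'a) univ_carrier cstar_struct" and s p \<phi>
  where "labelled_space_rep G L \<B> B s p" "rep_generates G L \<B> B s p"
    "rep_universal_for TYPE(('v, 'a) univ_carrier) G L \<B> B s p"
    "rep_universal_for TYPE('d) G L \<B> B s p"
    "star_hom B D0 \<phi>" "\<And>A. A \<in> \<B> \<Longrightarrow> \<phi> (p A) = p0 A"
proof -
  have space: "wlr_labelled_space G L \<B>" by (rule labelled_space_rep.axioms(1)[OF rep0])
  define R :: "(('v, 'a) univ_carrier cstar_struct \<times> ('a \<Rightarrow> ('v, 'a) univ_carrier) \<times> ('v set \<Rightarrow> ('v, 'a) univ_carrier)) set"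
    where "R = {(D, t, q). labelled_space_rep G L \<B> D t q}"
  \<comment> \<open>The copy of the given representation makes \<open>R\<close> nonempty, and
    through it \<open>p\<close> is later sent to \<open>p0\<close>.\<close>
  obtain C1 :: "('v, 'a) univ_carrier cstar_struct" and s1 p1 \<psi>1
    where C1: "labelled_space_rep G L \<B> C1 s1 p1" "star_hom C1 D0 \<psi>1" "\<And>A. A \<in> \<B> \<Longrightarrow> \<psi>1 (p1 A) = p0 A"
    using labelled_space_rep.generated_copy_rep[OF rep0] by metis
  have "R \<noteq> {}" using C1(1) by (auto simp: R_def)
  moreover have "\<And>D t q. (D, t, q) \<in> R \<Longrightarrow> labelled_space_rep G L \<B> D t q" by (simp add: R_def)
  ultimately obtain P :: "(('v, 'a) univ_carrier cstar_struct \<times> ('a \<Rightarrow> ('v, 'a) univ_carrier) \<times> ('v set \<Rightarrow> ('v, 'a) univ_carrier)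
      \<Rightarrow> ('v, 'a) univ_carrier) cstar_struct" and s2 p2
    where P: "labelled_space_rep G L \<B> P s2 p2"
      "\<And>D t q. (D, t, q) \<in> R \<Longrightarrow> star_hom P D (\<lambda>f. f (D, t, q))"
      "\<And>D t q a. (D, t, q) \<in> R \<Longrightarrow> s2 a (D, t, q) = t a"
      "\<And>D t q A. (D, t, q) \<in> R \<Longrightarrow> p2 A (D, t, q) = q A"
    using product_rep[OF space] by blast
  \<comment> \<open>The second copying brings the product back into the fixed type and at the same
    time cuts it down to the part generated by the representation.\<close>
  obtain B :: "('v, 'a) univ_carrier cstar_struct" and s p \<psi>
    where B: "labelled_space_rep G L \<B> B s p" "rep_generates G L \<B> B s p" "star_hom B P \<psi>"
      "\<And>a. a \<in> labelled_graph.letters G L \<Longrightarrow> \<psi> (s a) = s2 a" "\<And>A. A \<in> \<B> \<Longrightarrow> \<psi> (p A) = p2 A"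
    using labelled_space_rep.generated_copy_rep[OF P(1)] by metis
  have univ: "\<exists>\<phi>. star_hom B D \<phi> \<and> (\<forall>a\<in>labelled_graph.letters G L. \<phi> (s a) = t a) \<and> (\<forall>A\<in>\<B>. \<phi> (p A) = q A)"
    if "labelled_space_rep G L \<B> D t q" for D :: "('v, 'a) univ_carrier cstar_struct" and t q
  proof -
    have R: "(D, t, q) \<in> R" using that by (simp add: R_def)
    have "star_hom B D ((\<lambda>f. f (D, t, q)) \<circ> \<psi>)" by (rule star_hom_compose[OF B(3) P(2)[OF R]])
    then show ?thesis
      using B(4,5) P(3,4)[OF R] by (intro exI[of _ "(\<lambda>f. f (D, t, q)) \<circ> \<psi>"]) simp
  qed
  have univ': "\<exists>\<phi>. star_hom B D \<phi> \<and> (\<forall>a\<in>labelled_graph.letters G L. \<phi> (s a) = t a) \<and> (\<forall>A\<in>\<B>. \<phi> (p A) = q A)"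
    if D: "labelled_space_rep G L \<B> D t q" for D :: "'d cstar_struct" and t q
  proof -
    obtain C :: "('v, 'a) univ_carrier cstar_struct" and s' p' \<eta>
      where C: "labelled_space_rep G L \<B> C s' p'" "star_hom C D \<eta>"
      "\<And>a. a \<in> labelled_graph.letters G L \<Longrightarrow> \<eta> (s' a) = t a" "\<And>A. A \<in> \<B> \<Longrightarrow> \<eta> (p' A) = q A"
      using labelled_space_rep.generated_copy_rep[OF D] by metis
    obtain \<phi> where "star_hom B C \<phi>" "\<forall>a\<in>labelled_graph.letters G L. \<phi> (s a) = s' a" "\<forall>A\<in>\<B>. \<phi> (p A) = p' A"
      using univ[OF C(1)] by blast
    then show ?thesis
      using star_hom_compose[OF _ C(2)] C(3,4) by (intro exI[of _ "\<eta> \<circ> \<phi>"]) simp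
  qed
  obtain \<phi>0 where \<phi>0: "star_hom B C1 \<phi>0" "\<forall>A\<in>\<B>. \<phi>0 (p A) = p1 A"
    using univ[OF C1(1)] by blast
  show thesis
  proof (rule that[OF B(1,2)])
    show "rep_universal_for TYPE(('v, 'a) univ_carrier) G L \<B> B s p"
      using univ by (simp add: rep_universal_for_def)
    show "rep_universal_for TYPE('d) G L \<B> B s p"
      using univ' by (simp add: rep_universal_for_def)
    show "star_hom B D0 (\<psi>1 \<circ> \<phi>0)" by (rule star_hom_compose[OF \<phi>0(1) C1(2)])
    show "(\<psi>1 \<circ> \<phi>0) (p A) = p0 A" if "A \<in> \<B>" for A
      using that \<phi>0 C1(3) by simp
  qed
qed

section \<open>Square-summable functions\<close>

definition square_summable :: "('i \<Rightarrow> complex) \<Rightarrow> bool" where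
  "square_summable f \<longleftrightarrow> (\<lambda>x. (cmod (f x))\<^sup>2) summable_on UNIV"

lemma square_summableI:
  assumes "\<And>F. finite F \<Longrightarrow> (\<Sum>x\<in>F. (cmod (f x))\<^sup>2) \<le> K"
  shows "square_summable f"
  unfolding square_summable_def
  by (rule nonneg_bdd_above_summable_on) (use assms in \<open>auto intro!: bdd_aboveI2\<close>)

lemma square_summable_0: "square_summable (\<lambda>_. 0)"
  by (simp add: square_summable_def)

lemma square_summable_scale:
  assumes "square_summable f" shows "square_summable (\<lambda>x. c * f x)"
  using summable_on_cmult_right[of _ _ "(cmod c)\<^sup>2", OF assms[unfolded square_summable_def]]
  by (simp add: square_summable_def norm_mult power_mult_distrib)

lemma square_summable_add:
  assumes "square_summable f" "square_summable g"
  shows "square_summable (\<lambda>x. f x + g x)"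
  unfolding square_summable_def
proof (rule summable_on_comparison_test)
  show "(\<lambda>x. 2 * (cmod (f x))\<^sup>2 + 2 * (cmod (g x))\<^sup>2) summable_on UNIV"
    using assms unfolding square_summable_def by (intro summable_on_add summable_on_cmult_right)
  fix x
  have "(cmod (f x + g x))\<^sup>2 \<le> (cmod (f x) + cmod (g x))\<^sup>2"
    by (intro power_mono norm_triangle_ineq) simp
  also have "\<dots> \<le> 2 * (cmod (f x))\<^sup>2 + 2 * (cmod (g x))\<^sup>2"
    using zero_le_power2[of "cmod (f x) - cmod (g x)"] by (simp add: power2_eq_square algebra_simps)
  finally show "(cmod (f x + g x))\<^sup>2 \<le> 2 * (cmod (f x))\<^sup>2 + 2 * (cmod (g x))\<^sup>2" .
qed simp

lemma square_summable_inner: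
  assumes "square_summable f" "square_summable g"
  shows "(\<lambda>x. inner (f x) (g x)) summable_on UNIV"
proof (rule summable_on_iff_abs_summable_on_real[THEN iffD2], rule abs_summable_on_comparison_test')
  show "(\<lambda>x. (cmod (f x))\<^sup>2 + (cmod (g x))\<^sup>2) summable_on UNIV"
    using assms unfolding square_summable_def by (intro summable_on_add)
  fix x
  have "norm (inner (f x) (g x)) \<le> cmod (f x) * cmod (g x)"
    using Cauchy_Schwarz_ineq2 by simp
  also have "\<dots> \<le> 2 * (cmod (f x) * cmod (g x))" by simp
  also have "\<dots> \<le> (cmod (f x))\<^sup>2 + (cmod (g x))\<^sup>2"
    using zero_le_power2[of "cmod (f x) - cmod (g x)"] by (simp add: power2_eq_square algebra_simps)
  finally show "norm (inner (f x) (g x)) \<le> (cmod (f x))\<^sup>2 + (cmod (g x))\<^sup>2" .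
qed

typedef 'i ell2 = "{f :: 'i \<Rightarrow> complex. square_summable f}"
  morphisms ell2_nth Abs_ell2
  using square_summable_0 by blast

setup_lifting type_definition_ell2

lemma square_summable_nth: "square_summable (ell2_nth f)"
  using ell2_nth by simp

lemma ell2_eqI: "(\<And>x. ell2_nth f x = ell2_nth g x) \<Longrightarrow> f = g"
  by (simp add: ell2_nth_inject[symmetric] fun_eq_iff)

lift_definition ell2_scale :: "complex \<Rightarrow> 'i ell2 \<Rightarrow> 'i ell2" is "\<lambda>c f x. c * f x"
  by (rule square_summable_scale)

instantiation ell2 :: (type) real_vector
begin

lift_definition zero_ell2 :: "'a ell2" is "\<lambda>_. 0" by (rule square_summable_0)

lift_definition plus_ell2 :: "'a ell2 \<Rightarrow> 'a ell2 \<Rightarrow> 'a ell2" is "\<lambda>f g x. f x + g x"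
  by (rule square_summable_add)

lift_definition uminus_ell2 :: "'a ell2 \<Rightarrow> 'a ell2" is "\<lambda>f x. - f x"
  using square_summable_scale[of _ "-1"] by simp

lift_definition minus_ell2 :: "'a ell2 \<Rightarrow> 'a ell2 \<Rightarrow> 'a ell2" is "\<lambda>f g x. f x - g x"
  using square_summable_add square_summable_scale[of _ "-1"] by fastforce

lift_definition scaleR_ell2 :: "real \<Rightarrow> 'a ell2 \<Rightarrow> 'a ell2" is "\<lambda>r f x. r *\<^sub>R f x"
  unfolding scaleR_conv_of_real by (rule square_summable_scale)

instance
  by standard (transfer; simp add: fun_eq_iff algebra_simps)+

end

lemma ell2_nth_simps [simp]:
  "ell2_nth 0 x = 0" "ell2_nth (f + g) x = ell2_nth f x + ell2_nth g x"
  "ell2_nth (- f) x = - ell2_nth f x" "ell2_nth (f - g) x = ell2_nth f x - ell2_nth g x"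
  "ell2_nth (r *\<^sub>R f) x = r *\<^sub>R ell2_nth f x" "ell2_nth (ell2_scale c f) x = c * ell2_nth f x"
  by (transfer; simp)+

text \<open>The inner product is the real part of the usual sesquilinear one: a complex Hilbert
  space is treated as a real one on which complex scalars act by \<open>ell2_scale\<close>. A real
  adjoint of a complex-linear operator is again complex-linear, by
  \<open>complex_linear_adjoint\<close>, and hence is the complex adjoint.\<close>

instantiation ell2 :: (type) real_inner
begin

definition "inner_ell2 f g = (\<Sum>\<^sub>\<infinity>x. inner (ell2_nth f x) (ell2_nth g x))" for f g :: "'a ell2"

definition "norm_ell2 f = sqrt (inner f f)" for f :: "'a ell2"

definition "sgn_ell2 f = inverse (norm f) *\<^sub>R f" for f :: "'a ell2"

definition "dist_ell2 f g = norm (f - g)" for f g :: "'a ell2"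

definition "uniformity_ell2 = (INF e\<in>{0 <..}. principal {(x :: 'a ell2, y). dist x y < e})"

definition "open_ell2 U = (\<forall>x\<in>U. \<forall>\<^sub>F (x', y) in uniformity. x' = x \<longrightarrow> y \<in> U)" for U :: "'a ell2 set"

instance
proof
  fix f g h :: "'a ell2" and r :: real and U :: "'a ell2 set"
  note summ = square_summable_inner[OF square_summable_nth square_summable_nth]
  show "inner f g = inner g f" by (simp add: inner_ell2_def inner_commute)
  show "inner (f + g) h = inner f h + inner g h"
    by (simp add: inner_ell2_def inner_add_left infsum_add summ)
  show "inner (r *\<^sub>R f) g = r * inner f g"
    by (simp add: inner_ell2_def infsum_cmult_right')
  show "0 \<le> inner f f" by (simp add: inner_ell2_def infsum_nonneg)
  show "(inner f f = 0) = (f = 0)"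
  proof
    assume 0: "inner f f = 0"
    have "ell2_nth f x = 0" for x
    proof -
      have "(\<Sum>x\<in>{x}. inner (ell2_nth f x) (ell2_nth f x)) \<le> inner f f"
        unfolding inner_ell2_def by (rule finite_sum_le_infsum[OF summ]) auto
      then show ?thesis using 0 inner_ge_zero[of "ell2_nth f x"] by (simp add: antisym)
    qed
    then show "f = 0" by (intro ell2_eqI) simp
  qed (simp add: inner_ell2_def)
  show "norm f = sqrt (inner f f)" by (rule norm_ell2_def)
  show "sgn f = f /\<^sub>R norm f" by (rule sgn_ell2_def)
  show "dist f g = norm (f - g)" by (rule dist_ell2_def)
  show "(uniformity :: ('a ell2 \<times> 'a ell2) filter) = (INF e\<in>{0 <..}. principal {(x, y). dist x y < e})"
    by (rule uniformity_ell2_def)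
  show "open U = (\<forall>x\<in>U. \<forall>\<^sub>F (x', y) in uniformity. x' = x \<longrightarrow> y \<in> U)"
    by (rule open_ell2_def)
qed

end

lemma norm_ell2_sq: "(norm f)\<^sup>2 = (\<Sum>\<^sub>\<infinity>x. (cmod (ell2_nth f x))\<^sup>2)"
  by (simp add: power2_norm_eq_inner inner_ell2_def)

lemma sum_le_norm_ell2: "finite F \<Longrightarrow> (\<Sum>x\<in>F. (cmod (ell2_nth f x))\<^sup>2) \<le> (norm f)\<^sup>2"
  unfolding norm_ell2_sq
  by (rule finite_sum_le_infsum) (use square_summable_nth[of f] in \<open>auto simp: square_summable_def\<close>)

lemma cmod_nth_le_norm: "cmod (ell2_nth f x) \<le> norm f"
  using sum_le_norm_ell2[of "{x}" f] by (simp add: power2_le_iff_abs_le)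

text \<open>Norm bounds are tested on finite sums because these pass to pointwise limits, as
  completeness requires, and can be reindexed, as boundedness of \<open>map_op\<close>
  requires.\<close>

lemma norm_ell2_leI:
  assumes "K \<ge> 0" "\<And>F. finite F \<Longrightarrow> (\<Sum>x\<in>F. (cmod (ell2_nth f x))\<^sup>2) \<le> K\<^sup>2"
  shows "norm f \<le> K"
proof -
  have "(norm f)\<^sup>2 \<le> K\<^sup>2"
    unfolding norm_ell2_sq
    by (rule infsum_le_finite_sums) (use assms(2) square_summable_nth[of f] in \<open>auto simp: square_summable_def\<close>)
  then show ?thesis using assms(1) by (simp add: power2_le_iff_abs_le)
qed

instance ell2 :: (type) complete_space
proof
  fix u :: "nat \<Rightarrow> 'a ell2"
  assume u: "Cauchy u"
  have "Cauchy (\<lambda>n. ell2_nth (u n) x)" for x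
  proof (rule metric_CauchyI)
    fix e :: real assume "0 < e"
    then obtain M where M: "\<forall>m\<ge>M. \<forall>n\<ge>M. dist (u m) (u n) < e" using metric_CauchyD[OF u] by blast
    have "dist (ell2_nth (u m) x) (ell2_nth (u n) x) < e" if "m \<ge> M" "n \<ge> M" for m n
    proof -
      have "dist (ell2_nth (u m) x) (ell2_nth (u n) x) \<le> dist (u m) (u n)"
        using cmod_nth_le_norm[of "u m - u n" x] by (simp add: dist_norm)
      then show ?thesis using M that by fastforce
    qed
    then show "\<exists>M. \<forall>m\<ge>M. \<forall>n\<ge>M. dist (ell2_nth (u m) x) (ell2_nth (u n) x) < e" by blast
  qed
  then have "\<exists>l. (\<lambda>n. ell2_nth (u n) x) \<longlonglongrightarrow> l" for x
    using Cauchy_convergent convergent_def by blast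
  then obtain l where l: "\<And>x. (\<lambda>n. ell2_nth (u n) x) \<longlonglongrightarrow> l x" by metis
  \<comment> \<open>For a fixed finite set F the Cauchy bound passes to the limit in m, and N does
    not depend on F.\<close>
  have tail: "\<exists>N. \<forall>n\<ge>N. \<forall>F. finite F \<longrightarrow> (\<Sum>x\<in>F. (cmod (ell2_nth (u n) x - l x))\<^sup>2) \<le> e\<^sup>2"
    if e: "e > 0" for e
  proof -
    obtain N where N: "\<forall>m\<ge>N. \<forall>n\<ge>N. dist (u m) (u n) < e" using metric_CauchyD[OF u e] by blast
    have "(\<Sum>x\<in>F. (cmod (ell2_nth (u n) x - l x))\<^sup>2) \<le> e\<^sup>2" if n: "n \<ge> N" and F: "finite F" for n F
    proof (rule LIMSEQ_le_const2)
      show "(\<lambda>m. \<Sum>x\<in>F. (cmod (ell2_nth (u n) x - ell2_nth (u m) x))\<^sup>2)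
          \<longlonglongrightarrow> (\<Sum>x\<in>F. (cmod (ell2_nth (u n) x - l x))\<^sup>2)"
        by (intro tendsto_intros l)
      have "(\<Sum>x\<in>F. (cmod (ell2_nth (u n) x - ell2_nth (u m) x))\<^sup>2) \<le> e\<^sup>2" if "m \<ge> N" for m
      proof -
        have "(\<Sum>x\<in>F. (cmod (ell2_nth (u n) x - ell2_nth (u m) x))\<^sup>2) \<le> (norm (u n - u m))\<^sup>2"
          using sum_le_norm_ell2[OF F, of "u n - u m"] by simp
        also have "\<dots> \<le> e\<^sup>2"
          using N n that by (intro power_mono) (simp_all add: dist_norm less_imp_le)
        finally show ?thesis .
      qed
      then show "\<exists>N. \<forall>m\<ge>N. (\<Sum>x\<in>F. (cmod (ell2_nth (u n) x - ell2_nth (u m) x))\<^sup>2) \<le> e\<^sup>2" by blast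
    qed
    then show ?thesis by blast
  qed
  obtain N where N: "\<forall>n\<ge>N. \<forall>F. finite F \<longrightarrow> (\<Sum>x\<in>F. (cmod (ell2_nth (u n) x - l x))\<^sup>2) \<le> 1\<^sup>2"
    using tail[of 1] by auto
  have "square_summable (\<lambda>x. ell2_nth (u N) x - l x)"
    by (rule square_summableI) (use N in blast)
  \<comment> \<open>The pointwise limit is \<open>u N\<close> minus the error, and both are
    square-summable.\<close>
  from square_summable_add[OF square_summable_nth[of "u N"] square_summable_scale[OF this, of "-1"]]
  have "square_summable l" by simp
  then have nth: "ell2_nth (Abs_ell2 l) = l" by (simp add: Abs_ell2_inverse)
  have "u \<longlonglongrightarrow> Abs_ell2 l"
  proof (rule metric_LIMSEQ_I)
    fix r :: real assume r: "0 < r"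
    then obtain N where N: "\<forall>n\<ge>N. \<forall>F. finite F \<longrightarrow> (\<Sum>x\<in>F. (cmod (ell2_nth (u n) x - l x))\<^sup>2) \<le> (r / 2)\<^sup>2"
      using tail[of "r / 2"] by auto
    have "dist (u n) (Abs_ell2 l) < r" if "n \<ge> N" for n
    proof -
      have "norm (u n - Abs_ell2 l) \<le> r / 2"
        by (rule norm_ell2_leI) (use r N that in \<open>auto simp: nth\<close>)
      then show ?thesis using r by (simp add: dist_norm)
    qed
    then show "\<exists>no. \<forall>n\<ge>no. dist (u n) (Abs_ell2 l) < r" by blast
  qed
  then show "convergent u" by (auto simp: convergent_def)
qed

instance ell2 :: (type) banach ..

lemma norm_ell2_scale: "norm (ell2_scale c f) = cmod c * norm f"
proof -
  have "(norm (ell2_scale c f))\<^sup>2 = (cmod c * norm f)\<^sup>2"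
    by (simp add: norm_ell2_sq norm_mult power_mult_distrib infsum_cmult_right')
  then show ?thesis by simp
qed

lemma inner_ell2_scale: "inner (ell2_scale c f) g = inner f (ell2_scale (cnj c) g)"
  by (auto simp: inner_ell2_def inner_complex_def algebra_simps intro!: infsum_cong)

section \<open>Adjointable operators on square-summable functions\<close>

lift_definition ell2_scalar :: "complex \<Rightarrow> 'i ell2 \<Rightarrow>\<^sub>L 'i ell2" is ell2_scale
proof (rule bounded_linear_intro)
  show "norm (ell2_scale c f) \<le> norm f * cmod c" for c and f :: "'i ell2"
    by (simp add: norm_ell2_scale)
qed (auto intro!: ell2_eqI simp: algebra_simps)

definition is_adjoint :: "('i ell2 \<Rightarrow>\<^sub>L 'i ell2) \<Rightarrow> ('i ell2 \<Rightarrow>\<^sub>L 'i ell2) \<Rightarrow> bool" where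
  "is_adjoint S T \<longleftrightarrow> (\<forall>f g. inner (T f) g = inner f (S g))"

definition complex_linear :: "('i ell2 \<Rightarrow>\<^sub>L 'i ell2) \<Rightarrow> bool" where
  "complex_linear T \<longleftrightarrow> (\<forall>c f. T (ell2_scale c f) = ell2_scale c (T f))"

definition adj :: "('i ell2 \<Rightarrow>\<^sub>L 'i ell2) \<Rightarrow> 'i ell2 \<Rightarrow>\<^sub>L 'i ell2" where
  "adj T = (THE S. is_adjoint S T)"

lemma is_adjoint_unique: "\<lbrakk>is_adjoint S T; is_adjoint S' T\<rbrakk> \<Longrightarrow> S = S'"
  unfolding is_adjoint_def by (metis blinfun_eqI vector_eq_ldot)

lemma adj_eqI: "is_adjoint S T \<Longrightarrow> adj T = S"
  unfolding adj_def by (rule the_equality) (auto intro: is_adjoint_unique)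

lemma is_adjoint_sym: "is_adjoint S T \<Longrightarrow> is_adjoint T S"
  unfolding is_adjoint_def by (metis inner_commute)

lemma is_adjoint_0: "is_adjoint 0 0"
  by (simp add: is_adjoint_def)

lemma is_adjoint_add: "\<lbrakk>is_adjoint S T; is_adjoint S' T'\<rbrakk> \<Longrightarrow> is_adjoint (S + S') (T + T')"
  by (simp add: is_adjoint_def blinfun.add_left inner_add_left inner_add_right)

lemma is_adjoint_diff: "\<lbrakk>is_adjoint S T; is_adjoint S' T'\<rbrakk> \<Longrightarrow> is_adjoint (S - S') (T - T')"
  by (simp add: is_adjoint_def blinfun.diff_left inner_diff_left inner_diff_right)

lemma is_adjoint_compose: "\<lbrakk>is_adjoint S T; is_adjoint S' T'\<rbrakk> \<Longrightarrow> is_adjoint (S' o\<^sub>L S) (T o\<^sub>L T')"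
  by (simp add: is_adjoint_def)

lemma is_adjoint_scalar: "is_adjoint (ell2_scalar (cnj c)) (ell2_scalar c)"
  by (simp add: is_adjoint_def ell2_scalar.rep_eq inner_ell2_scale)

lemma complex_linear_scalar: "complex_linear T \<Longrightarrow> ell2_scalar c o\<^sub>L T = T o\<^sub>L ell2_scalar c"
  by (auto intro!: blinfun_eqI simp: complex_linear_def ell2_scalar.rep_eq)

text \<open>The scalar is moved across the inner product, where T commutes with its conjugate, and
  back.\<close>

lemma complex_linear_adjoint:
  assumes "is_adjoint S T" "complex_linear T" shows "complex_linear S"
  unfolding complex_linear_def
proof (intro allI)
  fix c g
  have "inner f (S (ell2_scale c g)) = inner f (ell2_scale c (S g))" for f
    using assms inner_ell2_scale[of "cnj c" f] inner_ell2_scale[of "cnj c" "T f"]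
    unfolding is_adjoint_def complex_linear_def by (metis complex_cnj_cnj)
  then show "S (ell2_scale c g) = ell2_scale c (S g)"
    using vector_eq_ldot by blast
qed

text \<open>The squared norm of \<open>T f\<close> is the inner product of f with
  \<open>S (T f)\<close>, so Cauchy-Schwarz bounds the squared norm of T by the norm of the
  composite. Cancelling the norm of T shows that it is at most the norm of S; symmetry gives
  equality, and submultiplicativity the reverse bound.\<close>

lemma norm_adjoint_square:
  assumes "is_adjoint S T" shows "norm (S o\<^sub>L T) = (norm T)\<^sup>2" "norm S = norm T"
proof -
  have sq: "(norm T)\<^sup>2 \<le> norm (S o\<^sub>L T)" if "is_adjoint S T" for S T :: "'a ell2 \<Rightarrow>\<^sub>L 'a ell2"
  proof -
    have "norm (T f) \<le> sqrt (norm (S o\<^sub>L T)) * norm f" for f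
    proof -
      have "(norm (T f))\<^sup>2 = inner f ((S o\<^sub>L T) f)"
        using that by (simp add: power2_norm_eq_inner is_adjoint_def)
      also have "\<dots> \<le> norm f * norm ((S o\<^sub>L T) f)" by (rule norm_cauchy_schwarz)
      also have "\<dots> \<le> norm f * (norm (S o\<^sub>L T) * norm f)"
        by (intro mult_left_mono norm_blinfun norm_ge_zero)
      finally have "(norm (T f))\<^sup>2 \<le> (sqrt (norm (S o\<^sub>L T)) * norm f)\<^sup>2"
        by (simp add: power_mult_distrib) (simp add: power2_eq_square mult_ac)
      then show ?thesis by (rule power2_le_imp_le) simp
    qed
    then have "norm T \<le> sqrt (norm (S o\<^sub>L T))"
      by (intro norm_blinfun_bound) simp_all
    then have "(norm T)\<^sup>2 \<le> (sqrt (norm (S o\<^sub>L T)))\<^sup>2" by (intro power_mono) simp_all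
    then show ?thesis by simp
  qed
  have le: "norm T \<le> norm S" if "is_adjoint S T" for S T :: "'a ell2 \<Rightarrow>\<^sub>L 'a ell2"
  proof (cases "norm T = 0")
    case False
    have "norm T * norm T \<le> norm S * norm T"
      using order_trans[OF sq[OF that] norm_blinfun_compose[of S T]] by (simp add: power2_eq_square)
    then show ?thesis using False by simp
  qed simp
  show eq: "norm S = norm T" using le[OF assms] le[OF is_adjoint_sym[OF assms]] by simp
  show "norm (S o\<^sub>L T) = (norm T)\<^sup>2"
    using sq[OF assms] norm_blinfun_compose[of S T] eq by (simp add: power2_eq_square)
qed

text \<open>Demanding an adjoint in the carrier takes the place of the Riesz representation theorem:
  the operators built below come with explicit adjoints, and the condition survives norm
  limits.\<close>

definition ell2_operators :: "('i ell2 \<Rightarrow>\<^sub>L 'i ell2) cstar_struct" where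
  "ell2_operators =
    \<lparr>carrier = {T. complex_linear T \<and> (\<exists>S. is_adjoint S T)},
     monoid.mult = (o\<^sub>L), one = id_blinfun, ring.zero = 0, add = (+),
     module.smult = (\<lambda>c T. ell2_scalar c o\<^sub>L T), star = adj, nrm = norm\<rparr>"

lemma ell2_operators_simps [simp]:
  "T \<in> carrier ell2_operators \<longleftrightarrow> complex_linear T \<and> (\<exists>S. is_adjoint S T)"
  "S \<otimes>\<^bsub>ell2_operators\<^esub> T = S o\<^sub>L T" "\<zero>\<^bsub>ell2_operators\<^esub> = 0" "S \<oplus>\<^bsub>ell2_operators\<^esub> T = S + T"
  "c \<odot>\<^bsub>ell2_operators\<^esub> T = ell2_scalar c o\<^sub>L T" "T\<^sup>\<star>\<^bsub>ell2_operators\<^esub> = adj T"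
  "nrm ell2_operators T = norm T"
  by (simp_all add: ell2_operators_def)

lemma complex_linear_closed:
  "complex_linear 0" "\<lbrakk>complex_linear S; complex_linear T\<rbrakk> \<Longrightarrow> complex_linear (S + T)"
  "\<lbrakk>complex_linear S; complex_linear T\<rbrakk> \<Longrightarrow> complex_linear (S - T)"
  "\<lbrakk>complex_linear S; complex_linear T\<rbrakk> \<Longrightarrow> complex_linear (S o\<^sub>L T)"
  "complex_linear (ell2_scalar c)"
  by (auto simp: complex_linear_def blinfun.add_left blinfun.diff_left ell2_scalar.rep_eq
      intro!: ell2_eqI simp: algebra_simps)

lemma abelian_group_ell2_operators: "abelian_group ell2_operators"
proof (rule abelian_groupI)
  fix T :: "'i ell2 \<Rightarrow>\<^sub>L 'i ell2"
  assume "T \<in> carrier ell2_operators"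
  \<comment> \<open>The negative is written as a difference so that the closure lemmas for
    differences apply; \<open>diff_0\<close> would rewrite it away.\<close>
  then have "0 - T \<in> carrier ell2_operators"
    by (auto simp del: diff_0 intro: complex_linear_closed is_adjoint_diff is_adjoint_0)
  then show "\<exists>S\<in>carrier ell2_operators. S \<oplus>\<^bsub>ell2_operators\<^esub> T = \<zero>\<^bsub>ell2_operators\<^esub>"
    by (intro bexI[of _ "0 - T"]) simp_all
qed (auto intro: complex_linear_closed is_adjoint_add is_adjoint_0)

lemma minus_ell2_operators:
  assumes "S \<in> carrier ell2_operators" "T \<in> carrier ell2_operators"
  shows "S \<ominus>\<^bsub>ell2_operators\<^esub> T = S - T"
proof -
  interpret abelian_group ell2_operators by (rule abelian_group_ell2_operators)
  have "0 - T \<in> carrier ell2_operators"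
    using assms(2) by (auto simp del: diff_0 intro: complex_linear_closed is_adjoint_diff is_adjoint_0)
  then have "\<ominus>\<^bsub>ell2_operators\<^esub> T = - T"
    using assms by (intro minus_equality) simp_all
  then show ?thesis by (simp add: a_minus_def)
qed

lemma is_adjoint_adj: "T \<in> carrier ell2_operators \<Longrightarrow> is_adjoint (adj T) T"
  using adj_eqI by auto

lemma ell2_scalar_add: "ell2_scalar (c + d) = ell2_scalar c + ell2_scalar d"
  by (intro blinfun_eqI ell2_eqI) (simp add: ell2_scalar.rep_eq blinfun.add_left algebra_simps)

lemma ell2_scalar_mult: "ell2_scalar (c * d) = ell2_scalar c o\<^sub>L ell2_scalar d"
  by (intro blinfun_eqI ell2_eqI) (simp add: ell2_scalar.rep_eq)

lemma compose_assoc: "(S o\<^sub>L T) o\<^sub>L U = S o\<^sub>L (T o\<^sub>L U)"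
  by (intro blinfun_eqI) simp

lemma compose_add_right: "(S :: 'i ell2 \<Rightarrow>\<^sub>L 'i ell2) o\<^sub>L (T + U) = (S o\<^sub>L T) + (S o\<^sub>L U)"
  and compose_add_left: "(T + U) o\<^sub>L (S :: 'i ell2 \<Rightarrow>\<^sub>L 'i ell2) = (T o\<^sub>L S) + (U o\<^sub>L S)"
  by (intro blinfun_eqI; simp add: blinfun.add_left blinfun.add_right)+

text \<open>The upper bound, applied to the inverse scalar and the scaled operator, is the lower
  bound.\<close>

lemma norm_ell2_scalar_compose:
  fixes T :: "'a ell2 \<Rightarrow>\<^sub>L 'a ell2"
  shows "norm (ell2_scalar c o\<^sub>L T) = cmod c * norm T"
proof (rule antisym)
  have le: "norm (ell2_scalar c o\<^sub>L T) \<le> cmod c * norm T" for c and T :: "'a ell2 \<Rightarrow>\<^sub>L 'a ell2"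
  proof (rule norm_blinfun_bound)
    fix f
    have "cmod c * norm (T f) \<le> cmod c * (norm T * norm f)"
      by (intro mult_left_mono norm_blinfun norm_ge_zero)
    then show "norm ((ell2_scalar c o\<^sub>L T) f) \<le> cmod c * norm T * norm f"
      by (simp add: ell2_scalar.rep_eq norm_ell2_scale mult.assoc)
  qed simp
  show "norm (ell2_scalar c o\<^sub>L T) \<le> cmod c * norm T" by (rule le)
  show "cmod c * norm T \<le> norm (ell2_scalar c o\<^sub>L T)"
  proof (cases "c = 0")
    case False
    have "ell2_scalar (inverse c) o\<^sub>L (ell2_scalar c o\<^sub>L T) = T"
      using False by (intro blinfun_eqI ell2_eqI) (simp add: ell2_scalar.rep_eq)
    then have "norm T \<le> cmod (inverse c) * norm (ell2_scalar c o\<^sub>L T)"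
      using le[of "inverse c" "ell2_scalar c o\<^sub>L T"] by simp
    then show ?thesis using False by (simp add: norm_divide field_simps)
  qed simp
qed

text \<open>Taking adjoints preserves distances, so the adjoints form a Cauchy sequence too, and
  their limit is an adjoint of the limit.\<close>

lemma ell2_operators_complete:
  assumes T: "\<And>n. T n \<in> carrier ell2_operators" and cauchy: "Cauchy T"
  shows "\<exists>U\<in>carrier ell2_operators. T \<longlonglongrightarrow> U"
proof -
  obtain U where U: "T \<longlonglongrightarrow> U" using Cauchy_convergent[OF cauchy] by (auto simp: convergent_def)
  have adjT: "is_adjoint (adj (T n)) (T n)" for n using is_adjoint_adj[OF T] .
  have "dist (adj (T m)) (adj (T n)) = dist (T m) (T n)" for m n
    using norm_adjoint_square(2)[OF is_adjoint_diff[OF adjT adjT]] by (simp add: dist_norm)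
  then have "Cauchy (\<lambda>n. adj (T n))" using cauchy by (simp add: Cauchy_def)
  then obtain V where V: "(\<lambda>n. adj (T n)) \<longlonglongrightarrow> V"
    using Cauchy_convergent by (auto simp: convergent_def)
  note ap = tendsto_intros blinfun.tendsto[OF _ tendsto_const]
  have "is_adjoint V U"
    unfolding is_adjoint_def
  proof (intro allI)
    fix f g
    have "(\<lambda>n. inner (T n f) g) \<longlonglongrightarrow> inner (U f) g" by (intro ap U)
    moreover have "(\<lambda>n. inner f (adj (T n) g)) \<longlonglongrightarrow> inner f (V g)" by (intro ap V)
    moreover have "inner (T n f) g = inner f (adj (T n) g)" for n
      using adjT[of n] by (simp add: is_adjoint_def)
    ultimately show "inner (U f) g = inner f (V g)" by (simp add: LIMSEQ_unique)
  qed
  moreover have "complex_linear U"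
    unfolding complex_linear_def
  proof (intro allI)
    fix c f
    have "(\<lambda>n. T n (ell2_scale c f)) \<longlonglongrightarrow> U (ell2_scale c f)" by (intro ap U)
    \<comment> \<open>Scaling is written as the bounded operator \<open>ell2_scalar c\<close>, whose
      continuity is at hand.\<close>
    moreover have "(\<lambda>n. ell2_scalar c (T n f)) \<longlonglongrightarrow> ell2_scalar c (U f)"
      by (intro ap blinfun.tendsto[OF tendsto_const] U)
    moreover have "T n (ell2_scale c f) = ell2_scalar c (T n f)" for n
      using T[of n] by (simp add: complex_linear_def ell2_scalar.rep_eq)
    ultimately show "U (ell2_scale c f) = ell2_scale c (U f)"
      by (simp add: ell2_scalar.rep_eq LIMSEQ_unique)
  qed
  ultimately show ?thesis using U by (intro bexI[of _ U]) auto
qed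

lemma cstar_algebra_ell2_operators:
  "cstar_algebra (ell2_operators :: ('i ell2 \<Rightarrow>\<^sub>L 'i ell2) cstar_struct)"
proof -
  let ?B = "ell2_operators :: ('i ell2 \<Rightarrow>\<^sub>L 'i ell2) cstar_struct"
  have module: "Module.module (ring_of_type_algebra :: complex ring) ?B"
    by (rule moduleI[OF cring_from_type_algebra abelian_group_ell2_operators])
       (auto simp: ring_of_type_algebra_def ell2_scalar_add ell2_scalar_mult compose_assoc
         compose_add_left compose_add_right ell2_scalar.rep_eq
         intro!: complex_linear_closed is_adjoint_compose[OF is_adjoint_scalar] blinfun_eqI ell2_eqI)
  note adj = is_adjoint_adj
  \<comment> \<open>On the carrier the abstract distance is that of the operator norm, which lets
    completeness be transferred; off the carrier \<open>cstar_dist\<close> is 0.\<close>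
  have dist: "cstar_dist ?B S T = dist S T" if "S \<in> carrier ?B" "T \<in> carrier ?B" for S T
    using that by (simp add: cstar_dist_def minus_ell2_operators dist_norm del: ell2_operators_simps(1))
  have metric: "Metric_space (carrier ?B) (cstar_dist ?B)"
  proof
    show "0 \<le> cstar_dist ?B S T" for S T
      by (simp add: cstar_dist_def)
    show "cstar_dist ?B S T = cstar_dist ?B T S" for S T
      using dist[of S T] dist[of T S] by (auto simp: cstar_dist_def dist_commute)
  qed (simp_all add: dist dist_triangle del: ell2_operators_simps)
  interpret M: Metric_space "carrier ?B" "cstar_dist ?B" by (rule metric)
  have "M.mcomplete"
    unfolding M.mcomplete_def
  proof (intro allI impI)
    fix T assume cauchy: "M.MCauchy T"
    then have T: "T n \<in> carrier ?B" for n unfolding M.MCauchy_def by blast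
    have "Cauchy T"
      using cauchy unfolding M.MCauchy_def Cauchy_def by (simp add: dist T del: ell2_operators_simps)
    then obtain U where U: "U \<in> carrier ?B" "T \<longlonglongrightarrow> U" using ell2_operators_complete[of T, OF T] by blast
    have "(\<lambda>n. cstar_dist ?B (T n) U) \<longlonglongrightarrow> 0"
      using tendsto_dist_iff[THEN iffD1, OF U(2)] by (simp add: dist T U(1) del: ell2_operators_simps)
    then show "\<exists>U. limitin M.mtopology T U sequentially"
      using T U(1) unfolding M.limitin_metric_dist_null by (intro exI[of _ U]) (simp del: ell2_operators_simps)
  qed
  moreover have adj_closed: "complex_linear (adj T)" "is_adjoint T (adj T)" "adj (adj T) = T"
    if "T \<in> carrier ?B" for T
    using that complex_linear_adjoint[OF adj[OF that]] is_adjoint_sym[OF adj[OF that]] adj_eqI by auto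
  ultimately show ?thesis
  proof (intro cstar_algebra.intro module cstar_algebra_axioms.intro)
    fix S T :: "'i ell2 \<Rightarrow>\<^sub>L 'i ell2" and c
    assume T: "T \<in> carrier ?B"
    show "T\<^sup>\<star>\<^bsub>?B\<^esub> \<in> carrier ?B" "(T\<^sup>\<star>\<^bsub>?B\<^esub>)\<^sup>\<star>\<^bsub>?B\<^esub> = T"
      using adj_closed[OF T] by auto
    \<comment> \<open>The adjoint comes out with the scalar on the right; complex linearity of
      \<open>adj T\<close> moves it to the left.\<close>
    have "is_adjoint (adj T o\<^sub>L ell2_scalar (cnj c)) (ell2_scalar c o\<^sub>L T)"
      by (rule is_adjoint_compose[OF is_adjoint_scalar adj[OF T]])
    then show "(c \<odot>\<^bsub>?B\<^esub> T)\<^sup>\<star>\<^bsub>?B\<^esub> = cnj c \<odot>\<^bsub>?B\<^esub> T\<^sup>\<star>\<^bsub>?B\<^esub>"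
      using complex_linear_scalar[OF adj_closed(1)[OF T], of "cnj c"] by (simp add: adj_eqI)
    show "nrm ?B (c \<odot>\<^bsub>?B\<^esub> T) = cmod c * nrm ?B T" by (simp add: norm_ell2_scalar_compose)
    show "nrm ?B (T\<^sup>\<star>\<^bsub>?B\<^esub> \<otimes>\<^bsub>?B\<^esub> T) = (nrm ?B T)\<^sup>2"
      using norm_adjoint_square(1)[OF adj[OF T]] by simp
    assume S: "S \<in> carrier ?B"
    show "(T \<oplus>\<^bsub>?B\<^esub> S)\<^sup>\<star>\<^bsub>?B\<^esub> = T\<^sup>\<star>\<^bsub>?B\<^esub> \<oplus>\<^bsub>?B\<^esub> S\<^sup>\<star>\<^bsub>?B\<^esub>"
      using adj_eqI[OF is_adjoint_add[OF adj[OF T] adj[OF S]]] by simp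
    show "(T \<otimes>\<^bsub>?B\<^esub> S)\<^sup>\<star>\<^bsub>?B\<^esub> = S\<^sup>\<star>\<^bsub>?B\<^esub> \<otimes>\<^bsub>?B\<^esub> T\<^sup>\<star>\<^bsub>?B\<^esub>"
      using adj_eqI[OF is_adjoint_compose[OF adj[OF T] adj[OF S]]] by simp
    show "T \<otimes>\<^bsub>?B\<^esub> (c \<odot>\<^bsub>?B\<^esub> S) = c \<odot>\<^bsub>?B\<^esub> (T \<otimes>\<^bsub>?B\<^esub> S)"
      using T complex_linear_scalar[of T c] by (simp add: compose_assoc[symmetric])
    show "T \<otimes>\<^bsub>?B\<^esub> S \<in> carrier ?B"
      using S T by (auto intro: complex_linear_closed is_adjoint_compose)
  qed (auto simp: compose_assoc compose_add_left compose_add_right norm_triangle_ineq norm_blinfun_compose)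
qed

section \<open>Partial injections as operators\<close>

definition partial_inj :: "('i \<Rightarrow> 'i option) \<Rightarrow> bool" where
  "partial_inj u \<longleftrightarrow> inj_on u (dom u)"

text \<open>Unspecified unless the map is injective on its domain.\<close>

definition map_op :: "('i \<Rightarrow> 'i option) \<Rightarrow> 'i ell2 \<Rightarrow>\<^sub>L 'i ell2" where
  "map_op u = Blinfun (\<lambda>f. Abs_ell2 (\<lambda>x. case u x of None \<Rightarrow> 0 | Some y \<Rightarrow> ell2_nth f y))"

text \<open>Injectivity makes the finite sums of squares run over distinct points, which bounds them
  by the squared norm of f. The operator composes with u, so it sends the point mass at y to the
  point mass at the preimage of y, or to 0 if there is none.\<close>

lemma nth_map_op:
  assumes "partial_inj u"
  shows "ell2_nth (map_op u f) x = (case u x of None \<Rightarrow> 0 | Some y \<Rightarrow> ell2_nth f y)"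
proof -
  define h where "h f x = (case u x of None \<Rightarrow> 0 | Some y \<Rightarrow> ell2_nth f y)" for f x
  have le: "(\<Sum>x\<in>F. (cmod (h f x))\<^sup>2) \<le> (norm f)\<^sup>2" if F: "finite F" for f F
  proof -
    have "(\<Sum>x\<in>F. (cmod (h f x))\<^sup>2) = (\<Sum>x\<in>F \<inter> dom u. (cmod (ell2_nth f (the (u x))))\<^sup>2)"
      by (rule sum.mono_neutral_cong_right) (auto simp: F h_def dom_def split: option.splits)
    also have "\<dots> = (\<Sum>y\<in>(\<lambda>x. the (u x)) ` (F \<inter> dom u). (cmod (ell2_nth f y))\<^sup>2)"
      using assms by (subst sum.reindex) (auto simp: partial_inj_def inj_on_def dom_def)
    also have "\<dots> \<le> (norm f)\<^sup>2" by (rule sum_le_norm_ell2) (simp add: F)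
    finally show ?thesis .
  qed
  have "square_summable (h f)" for f by (rule square_summableI[OF le])
  then have nth: "ell2_nth (Abs_ell2 (h f)) = h f" for f by (simp add: Abs_ell2_inverse)
  have "bounded_linear (\<lambda>f. Abs_ell2 (h f))"
  proof (rule bounded_linear_intro)
    show "norm (Abs_ell2 (h f)) \<le> norm f * 1" for f
      by (simp, rule norm_ell2_leI) (simp_all add: nth le)
  qed (auto intro!: ell2_eqI simp: nth h_def split: option.splits)
  then have "blinfun_apply (map_op u) f = Abs_ell2 (h f)"
    unfolding map_op_def h_def by (simp add: bounded_linear_Blinfun_apply)
  then show ?thesis by (simp add: nth) (simp add: h_def)
qed

lemma complex_linear_map_op: "partial_inj u \<Longrightarrow> complex_linear (map_op u)"
  by (auto simp: complex_linear_def nth_map_op intro!: ell2_eqI split: option.splits)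

text \<open>Mutually inverse partial maps are bijections between their domains, and reindexing along
  the bijection moves the operator to the other side of the inner product.\<close>

lemma is_adjoint_map_op:
  assumes "\<And>x y. u x = Some y \<longleftrightarrow> v y = Some x"
  shows "partial_inj u" "is_adjoint (map_op v) (map_op u)"
proof -
  show u: "partial_inj u" using assms by (auto simp: partial_inj_def inj_on_def) (metis option.inject)
  have v: "partial_inj v" using assms by (auto simp: partial_inj_def inj_on_def) (metis option.inject)
  show "is_adjoint (map_op v) (map_op u)"
    unfolding is_adjoint_def
  proof (intro allI)
    fix f g :: "'a ell2"
    have bij: "bij_betw (\<lambda>x. the (u x)) (dom u) (dom v)"
      by (rule bij_betw_byWitness[where f' = "\<lambda>y. the (v y)"]) (use assms in \<open>auto simp: dom_def\<close>, (metis option.sel)+)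
    have "inner (map_op u f) g = (\<Sum>\<^sub>\<infinity>x\<in>dom u. inner (ell2_nth f (the (u x))) (ell2_nth g x))"
      unfolding inner_ell2_def by (rule infsum_cong_neutral) (auto simp: nth_map_op[OF u] split: option.splits)
    also have "\<dots> = (\<Sum>\<^sub>\<infinity>x\<in>dom u. inner (ell2_nth f (the (u x))) (ell2_nth g (the (v (the (u x))))))"
      by (rule infsum_cong) (use assms in \<open>auto simp: dom_def\<close>, metis option.sel)
    also have "\<dots> = (\<Sum>\<^sub>\<infinity>y\<in>dom v. inner (ell2_nth f y) (ell2_nth g (the (v y))))"
      by (rule infsum_reindex_bij_betw[OF bij])
    also have "\<dots> = inner f (map_op v g)"
      unfolding inner_ell2_def by (rule infsum_cong_neutral) (auto simp: nth_map_op[OF v] split: option.splits)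
    finally show "inner (map_op u f) g = inner f (map_op v g)" .
  qed
qed

lemma map_op_closed:
  assumes "\<And>x y. u x = Some y \<longleftrightarrow> v y = Some x"
  shows "map_op u \<in> carrier ell2_operators" "adj (map_op u) = map_op v"
  using is_adjoint_map_op[OF assms] adj_eqI by (auto intro: complex_linear_map_op)

definition ell2_point :: "'i \<Rightarrow> 'i ell2" where
  "ell2_point x = Abs_ell2 (\<lambda>y. of_bool (y = x))"

lemma nth_ell2_point: "ell2_nth (ell2_point x) y = of_bool (y = x)"
proof -
  have "square_summable (\<lambda>y. of_bool (y = x) :: complex)"
    unfolding square_summable_def
    by (rule finite_nonzero_values_imp_summable_on) (rule finite_subset[of _ "{x}"], auto)
  then show ?thesis by (simp add: ell2_point_def Abs_ell2_inverse)
qed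

section \<open>A faithful representation on labelled paths of characters\<close>

lemma finsum_ell2_operators:
  assumes "finite S" "f \<in> S \<rightarrow> carrier ell2_operators"
  shows "(\<Oplus>\<^bsub>ell2_operators\<^esub>i\<in>S. f i) = (\<Sum>i\<in>S. f i)"
proof -
  interpret abelian_group ell2_operators by (rule abelian_group_ell2_operators)
  show ?thesis using assms
  proof (induction S)
    case (insert x S)
    then show ?case by (simp add: Pi_iff finsum_insert del: ell2_operators_simps(1))
  qed simp
qed

lemma ell2_nth_sum: "ell2_nth (\<Sum>i\<in>S. f i) x = (\<Sum>i\<in>S. ell2_nth (f i) x)"
  by (induction S rule: infinite_finite_induct) simp_all

section \<open>Sequences of letters and characters\<close>

text \<open>The label \<open>None\<close> means that the path stops. A character is stored at every
  position, because along an infinite sequence of letters there is no last one from which the others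
  could be pulled back.\<close>

type_synonym ('v, 'a) char_seq = "nat \<Rightarrow> 'a option \<times> ('v set \<Rightarrow> bool)"

context wlr_labelled_space
begin

lemma rel_range_Un: "rel_range (A \<union> A') \<alpha> = rel_range A \<alpha> \<union> rel_range A' \<alpha>"
  by (auto simp: rel_range_def)

lemma rel_range_empty: "rel_range {} \<alpha> = {}"
  by (simp add: rel_range_def)

lemma letter_range_Int:
  "\<lbrakk>a \<in> letters; A \<in> \<B>; A' \<in> \<B>\<rbrakk> \<Longrightarrow> rel_range (A \<inter> A') [a] = rel_range A [a] \<inter> rel_range A' [a]"
  using weakly_left_resolving[OF _ _ letter_in_labelled_paths] by simp

lemma emitted_iff: "a \<in> emitted A \<longleftrightarrow> a \<in> letters \<and> rel_range A [a] \<noteq> {}"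
proof -
  have "u \<in> lab_source [a] \<longleftrightarrow> rel_range {u} [a] \<noteq> {}" for u
    by (simp add: lab_source_def rel_range_def) metis
  moreover have "rel_range A [a] = (\<Union>u\<in>A. rel_range {u} [a])" by (simp add: rel_range_def set_eq_iff)
  ultimately have "lab_source [a] \<inter> A \<noteq> {} \<longleftrightarrow> rel_range A [a] \<noteq> {}" by auto
  then show ?thesis by (simp add: emitted_def)
qed

lemma letter_range_sink: "v \<in> sinks \<Longrightarrow> rel_range {v} [a] = {}"
  by (auto simp: letter_range_iff sinks_def out_arcs_def)

text \<open>The lattice homomorphisms from \<open>\<B>\<close> to the truth values. The constantly
  false one is among them, and values outside \<open>\<B>\<close> are arbitrary.\<close>

definition character :: "('v set \<Rightarrow> bool) \<Rightarrow> bool" where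
  "character w \<longleftrightarrow>
     (\<forall>A\<in>\<B>. \<forall>A'\<in>\<B>. (w (A \<union> A') \<longleftrightarrow> w A \<or> w A') \<and> (w (A \<inter> A') \<longleftrightarrow> w A \<and> w A')) \<and>
     ({} \<in> \<B> \<longrightarrow> \<not> w {})"

definition regular :: "'v set \<Rightarrow> bool" where
  "regular A \<longleftrightarrow> finite (emitted A) \<and> emitted A \<noteq> {} \<and> finite (A \<inter> sinks)"

text \<open>For a letter, the equation concerns all sets and not just members of
  \<open>\<B>\<close>; thereby a sequence is determined by its first letter and its shift. The case
  \<open>None\<close> is what \<open>rep_sum\<close> forces: with no letter to contribute, a regular
  set on which w is true must be accounted for by one of its sinks.\<close>

definition path_step :: "'a option \<Rightarrow> ('v set \<Rightarrow> bool) \<Rightarrow> ('v set \<Rightarrow> bool) \<Rightarrow> bool" where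
  "path_step l w w' \<longleftrightarrow> character w \<and>
     (case l of
        Some a \<Rightarrow> a \<in> letters \<and> w' (lab_range [a]) \<and> w = (\<lambda>A. w' (rel_range A [a]))
      | None \<Rightarrow> \<forall>A\<in>\<B>. regular A \<and> w A \<longrightarrow> (\<exists>v\<in>A \<inter> sinks. w {v}))"

text \<open>A finite path is followed by junk: no condition links what comes after the first
  \<open>None\<close> to what comes before.\<close>

definition char_path :: "('v, 'a) char_seq \<Rightarrow> bool" where
  "char_path x \<longleftrightarrow> (\<forall>n. path_step (fst (x n)) (snd (x n)) (snd (x (Suc n))))"

definition prepend :: "'a \<Rightarrow> ('v, 'a) char_seq \<Rightarrow> ('v, 'a) char_seq" where
  "prepend a x = case_nat (Some a, \<lambda>A. snd (x 0) (rel_range A [a])) x"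

definition shift :: "('v, 'a) char_seq \<Rightarrow> ('v, 'a) char_seq" where
  "shift x n = x (Suc n)"

lemma prepend_simps [simp]:
  "prepend a x 0 = (Some a, \<lambda>A. snd (x 0) (rel_range A [a]))" "prepend a x (Suc n) = x n"
  "shift (prepend a x) = x"
  by (simp_all add: prepend_def shift_def fun_eq_iff)

lemma char_path_character: "char_path x \<Longrightarrow> character (snd (x n))"
  by (simp add: char_path_def path_step_def)

lemma char_path_Some:
  assumes "char_path x" "fst (x 0) = Some a"
  shows "a \<in> letters" "snd (x (Suc 0)) (lab_range [a])"
    "snd (x 0) A \<longleftrightarrow> snd (x (Suc 0)) (rel_range A [a])"
proof -
  have "path_step (Some a) (snd (x 0)) (snd (x (Suc 0)))"
    using assms unfolding char_path_def by metis
  then show "a \<in> letters" "snd (x (Suc 0)) (lab_range [a])"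
    "snd (x 0) A \<longleftrightarrow> snd (x (Suc 0)) (rel_range A [a])"
    by (simp_all add: path_step_def)
qed

lemma char_path_None:
  assumes "char_path x" "fst (x 0) = None" "A \<in> \<B>" "regular A" "snd (x 0) A"
  shows "\<exists>v\<in>A \<inter> sinks. snd (x 0) {v}"
proof -
  have "path_step None (snd (x 0)) (snd (x (Suc 0)))"
    using assms unfolding char_path_def by metis
  then show ?thesis using assms by (simp add: path_step_def)
qed

lemma char_path_shift: "char_path x \<Longrightarrow> char_path (shift x)"
  by (simp add: char_path_def shift_def)

lemma prepend_shift:
  assumes "char_path x" "fst (x 0) = Some a" shows "prepend a (shift x) = x"
proof
  show "prepend a (shift x) n = x n" for n
    using assms(2) char_path_Some(3)[OF assms]
    by (cases n) (auto simp: shift_def prod_eq_iff)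
qed

text \<open>Ranges commute with unions in every labelled graph and with intersections of members of
  \<open>\<B>\<close> by weak left-resolvingness, so the pullback of a character is a
  character.\<close>

lemma char_path_prepend:
  assumes x: "char_path x" and a: "a \<in> letters" and w: "snd (x 0) (lab_range [a])"
  shows "char_path (prepend a x)"
  unfolding char_path_def
proof
  fix n
  have "character (\<lambda>A. snd (x 0) (rel_range A [a]))"
    using char_path_character[OF x, of 0] letter_range_in_space[OF a]
    unfolding character_def by (simp add: rel_range_Un rel_range_empty letter_range_Int a)
  then have "path_step (Some a) (\<lambda>A. snd (x 0) (rel_range A [a])) (snd (x 0))"
    using a w by (simp add: path_step_def)
  then show "path_step (fst (prepend a x n)) (snd (prepend a x n)) (snd (prepend a x (Suc n)))"
    using x by (cases n) (simp_all add: char_path_def)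
qed

section \<open>Partial maps on sequences and their operators\<close>

text \<open>The three partial maps are undefined off the valid sequences. Their operators vanish on
  the remaining coordinates, so the whole type of sequences can serve as index set.\<close>

definition range_map :: "'v set \<Rightarrow> ('v, 'a) char_seq \<Rightarrow> ('v, 'a) char_seq option" where
  "range_map A x = (if char_path x \<and> snd (x 0) A then Some x else None)"

definition shift_map :: "'a \<Rightarrow> ('v, 'a) char_seq \<Rightarrow> ('v, 'a) char_seq option" where
  "shift_map a x = (if char_path x \<and> fst (x 0) = Some a then Some (shift x) else None)"

definition prepend_map :: "'a \<Rightarrow> ('v, 'a) char_seq \<Rightarrow> ('v, 'a) char_seq option" where
  "prepend_map a x = (if char_path x \<and> snd (x 0) (lab_range [a]) then Some (prepend a x) else None)"

lemma range_map_sym: "range_map A x = Some y \<longleftrightarrow> range_map A y = Some x"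
  by (auto simp: range_map_def)

lemma shift_map_prepend_map:
  assumes "a \<in> letters"
  shows "shift_map a x = Some y \<longleftrightarrow> prepend_map a y = Some x"
proof
  assume "shift_map a x = Some y"
  then have x: "char_path x" "fst (x 0) = Some a" and y: "y = shift x"
    by (auto simp: shift_map_def split: if_splits)
  show "prepend_map a y = Some x"
    using prepend_shift[OF x] char_path_shift[OF x(1)] char_path_Some(2)[OF x]
    by (simp add: prepend_map_def y) (simp add: shift_def)
next
  assume "prepend_map a y = Some x"
  then have y: "char_path y" "snd (y 0) (lab_range [a])" and x: "x = prepend a y"
    by (auto simp: prepend_map_def split: if_splits)
  show "shift_map a x = Some y"
    using char_path_prepend[OF y(1) assms y(2)] by (simp add: shift_map_def x)
qed

definition path_p :: "'v set \<Rightarrow> ('v, 'a) char_seq ell2 \<Rightarrow>\<^sub>L ('v, 'a) char_seq ell2" where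
  "path_p A = map_op (range_map A)"

text \<open>Since \<open>map_op\<close> composes with its argument, the operator of the shift moves
  point masses forward by prepending a.\<close>

definition path_s :: "'a \<Rightarrow> ('v, 'a) char_seq ell2 \<Rightarrow>\<^sub>L ('v, 'a) char_seq ell2" where
  "path_s a = map_op (shift_map a)"

lemma path_p_closed: "path_p A \<in> carrier ell2_operators" "adj (path_p A) = path_p A"
  unfolding path_p_def
  by (rule map_op_closed[of "range_map A" "range_map A", OF range_map_sym])+

lemma path_s_closed:
  assumes "a \<in> letters"
  shows "path_s a \<in> carrier ell2_operators" "adj (path_s a) = map_op (prepend_map a)"
  unfolding path_s_def
  by (rule map_op_closed[of "shift_map a" "prepend_map a", OF shift_map_prepend_map[OF assms]])+

lemma nth_path_p:
  "ell2_nth (path_p A f) x = (if char_path x \<and> snd (x 0) A then ell2_nth f x else 0)"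
proof -
  have "partial_inj (range_map A)" by (rule is_adjoint_map_op(1)[OF range_map_sym])
  from nth_map_op[OF this] show ?thesis by (simp add: path_p_def range_map_def)
qed

lemma nth_path_s:
  assumes "a \<in> letters"
  shows "ell2_nth (path_s a f) x = (if char_path x \<and> fst (x 0) = Some a then ell2_nth f (shift x) else 0)"
proof -
  have "partial_inj (shift_map a)" by (rule is_adjoint_map_op(1)[OF shift_map_prepend_map[OF assms]])
  from nth_map_op[OF this] show ?thesis by (simp add: path_s_def shift_map_def)
qed

lemma nth_adj_path_s:
  assumes "a \<in> letters"
  shows "ell2_nth (adj (path_s a) f) x =
    (if char_path x \<and> snd (x 0) (lab_range [a]) then ell2_nth f (prepend a x) else 0)"
proof -
  have "partial_inj (prepend_map a)"
    by (rule is_adjoint_map_op(1)[OF shift_map_prepend_map[OF assms, symmetric]])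
  from nth_map_op[OF this] show ?thesis by (simp add: path_s_closed[OF assms] prepend_map_def)
qed

text \<open>At a single valid sequence both sides are the value of f or 0. When the first character
  is true on A, a first letter b leaves only the summand for b, because sinks have empty range under
  b; without a first letter exactly one sink contributes.\<close>

lemma path_sum:
  assumes A: "A \<in> \<B>" "regular A"
  shows "ell2_nth (path_p A f) x =
    (\<Sum>a\<in>emitted A. ell2_nth (path_s a (path_p (rel_range A [a]) (adj (path_s a) f))) x) +
    (\<Sum>v\<in>A \<inter> sinks. ell2_nth (path_p {v} f) x)"
proof (cases "char_path x")
  case False
  then have "ell2_nth (path_s a (path_p (rel_range A [a]) (adj (path_s a) f))) x = 0" if "a \<in> emitted A" for a
    using that by (simp add: emitted_iff nth_path_s)
  then show ?thesis using False by (simp add: nth_path_p)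
next
  case x: True
  note char = char_path_character[OF x]
  have fin: "finite (emitted A)" "finite (A \<inter> sinks)" using A(2) by (auto simp: regular_def)
  have s_term: "ell2_nth (path_s a (path_p (rel_range A [a]) (adj (path_s a) f))) x =
      (if fst (x 0) = Some a then (if snd (x 0) A then ell2_nth f x else 0) else 0)"
    if "a \<in> emitted A" for a
  proof -
    have a: "a \<in> letters" using that by (simp add: emitted_iff)
    show ?thesis
    proof (cases "fst (x 0) = Some a")
      case True
      then show ?thesis
        using char_path_Some[OF x True] char_path_shift[OF x] prepend_shift[OF x True]
        by (simp add: nth_path_s[OF a] nth_path_p nth_adj_path_s[OF a] x) (simp add: shift_def)
    qed (simp add: nth_path_s[OF a])
  qed
  \<comment> \<open>Characters are monotone: the singleton is its own intersection with A.\<close>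
  have sink_le: "snd (x 0) A" if "v \<in> A \<inter> sinks" "snd (x 0) {v}" for v
  proof -
    have v: "{v} \<in> \<B>" "{v} \<inter> A = {v}" using that sink_closed by auto
    have "snd (x 0) ({v} \<inter> A) \<longleftrightarrow> snd (x 0) {v} \<and> snd (x 0) A"
      using char[of 0] v(1) A(1) unfolding character_def by blast
    then show ?thesis using that(2) v(2) by simp
  qed
  have p_term: "ell2_nth (path_p {v} f) x = (if snd (x 0) {v} then ell2_nth f x else 0)" for v
    by (simp add: nth_path_p x)
  show ?thesis
  proof (cases "snd (x 0) A")
    case False
    then have "\<not> snd (x 0) {v}" if "v \<in> A \<inter> sinks" for v using sink_le that by blast
    then have "(\<Sum>v\<in>A \<inter> sinks. ell2_nth (path_p {v} f) x) = 0" by (intro sum.neutral) (simp add: p_term)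
    moreover have "(\<Sum>a\<in>emitted A. ell2_nth (path_s a (path_p (rel_range A [a]) (adj (path_s a) f))) x) = 0"
      using False by (intro sum.neutral) (simp add: s_term)
    ultimately show ?thesis using False by (simp add: nth_path_p)
  next
    case True
    show ?thesis
    proof (cases "fst (x 0)")
      case (Some b)
      note step = char_path_Some[OF x Some]
      \<comment> \<open>An empty range would itself be a member of \<open>\<B>\<close>, and then the
        next character is false on it.\<close>
      have nonempty: "rel_range C [b] \<noteq> {}" if "C \<in> \<B>" "snd (x 0) C" for C
        using that char[of "Suc 0"] step(3)[of C] letter_range_in_space[OF step(1) that(1)]
        by (auto simp: character_def)
      have b: "b \<in> emitted A" using nonempty[OF A(1) True] step(1) by (simp add: emitted_iff)
      have "\<not> snd (x 0) {v}" if "v \<in> A \<inter> sinks" for v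
        using nonempty[OF sink_closed] letter_range_sink[of v b] that by blast
      then have "(\<Sum>v\<in>A \<inter> sinks. ell2_nth (path_p {v} f) x) = 0" by (intro sum.neutral) (simp add: p_term)
      moreover have "(\<Sum>a\<in>emitted A. ell2_nth (path_s a (path_p (rel_range A [a]) (adj (path_s a) f))) x)
          = (\<Sum>a\<in>emitted A. if a = b then ell2_nth f x else 0)"
        by (intro sum.cong) (auto simp: s_term Some True)
      ultimately show ?thesis using b fin True x by (simp add: nth_path_p)
    next
      case None
      obtain v where v: "v \<in> A \<inter> sinks" "snd (x 0) {v}"
        using char_path_None[OF x None A True] by blast
      \<comment> \<open>Two sinks have disjoint singletons, so the character would be true on the
        empty set. Thus the sum over the sinks contributes the value of f once and not several
        times.\<close>
      have unique: "u = v" if u: "u \<in> A \<inter> sinks" "snd (x 0) {u}" for u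
      proof (rule ccontr)
        assume "u \<noteq> v"
        then have e: "{u} \<inter> {v} = {}" by simp
        have uv: "{u} \<in> \<B>" "{v} \<in> \<B>" using u v sink_closed by auto
        then have "{} \<in> \<B>" using Int_closed[OF uv] e by simp
        moreover have "snd (x 0) ({u} \<inter> {v})"
          using char[of 0] uv u(2) v(2) unfolding character_def by blast
        ultimately show False using char[of 0] e by (simp add: character_def)
      qed
      have "(\<Sum>u\<in>A \<inter> sinks. ell2_nth (path_p {u} f) x) = (\<Sum>u\<in>A \<inter> sinks. if u = v then ell2_nth f x else 0)"
      proof (rule sum.cong)
        fix u assume u: "u \<in> A \<inter> sinks"
        show "ell2_nth (path_p {u} f) x = (if u = v then ell2_nth f x else 0)"
          using unique[OF u] v(2) by (cases "u = v") (auto simp: p_term)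
      qed simp
      moreover have "(\<Sum>a\<in>emitted A. ell2_nth (path_s a (path_p (rel_range A [a]) (adj (path_s a) f))) x) = 0"
        by (intro sum.neutral) (simp add: s_term None)
      ultimately show ?thesis using v fin True x by (simp add: nth_path_p)
    qed
  qed
qed

lemma path_rep: "labelled_space_rep G L \<B> ell2_operators path_s path_p"
proof -
  interpret C: cstar_algebra "ell2_operators :: (('v, 'a) char_seq ell2 \<Rightarrow>\<^sub>L ('v, 'a) char_seq ell2) cstar_struct"
    by (rule cstar_algebra_ell2_operators)
  note [simp del] = ell2_operators_simps(1)
  note closed = path_p_closed path_s_closed(1)
  have char: "snd (x 0) (A \<union> A') \<longleftrightarrow> snd (x 0) A \<or> snd (x 0) A'"
    "snd (x 0) (A \<inter> A') \<longleftrightarrow> snd (x 0) A \<and> snd (x 0) A'"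
    if "char_path x" "A \<in> \<B>" "A' \<in> \<B>" for x A A'
    using char_path_character[OF that(1), of 0] that(2,3) by (auto simp: character_def)
  show ?thesis
  proof unfold_locales
    fix A assume "A \<in> \<B>"
    show "C.projection (path_p A)"
      by (auto simp: C.projection_def closed nth_path_p intro!: blinfun_eqI ell2_eqI)
  next
    fix a assume a: "a \<in> letters"
    have 1: "adj (path_s a) o\<^sub>L path_s a = path_p (lab_range [a])"
      by (intro blinfun_eqI ell2_eqI) (simp add: nth_path_p nth_path_s nth_adj_path_s a char_path_prepend)
    then show "(path_s a)\<^sup>\<star>\<^bsub>ell2_operators\<^esub> \<otimes>\<^bsub>ell2_operators\<^esub> path_s a = path_p (lab_range [a])" by simp
    \<comment> \<open>A sequence that begins with a continues with a character true on the range of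
      a, so restricting to that range before prepending a changes nothing.\<close>
    have "ell2_nth (path_s a (path_p (lab_range [a]) f)) x = ell2_nth (path_s a f) x" for f x
      using char_path_Some(2)[of x a] char_path_shift[of x]
      by (simp add: nth_path_p nth_path_s a) (auto simp: shift_def)
    then have "path_s a o\<^sub>L path_p (lab_range [a]) = path_s a"
      by (auto intro!: blinfun_eqI ell2_eqI)
    then show "C.partial_isometry (path_s a)"
      using 1 by (simp add: C.partial_isometry_def closed a compose_assoc)
  next
    fix A A' assume A: "A \<in> \<B>" "A' \<in> \<B>"
    show "path_p A \<otimes>\<^bsub>ell2_operators\<^esub> path_p A' = path_p (A \<inter> A')"
      using char(2)[OF _ A] by (auto intro!: blinfun_eqI ell2_eqI simp: nth_path_p)
    have "path_p (A \<union> A') = path_p A + path_p A' - path_p (A \<inter> A')"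
      using char[OF _ A]
      by (auto intro!: blinfun_eqI ell2_eqI simp: nth_path_p blinfun.add_left blinfun.diff_left)
    moreover have "path_p A + path_p A' \<in> carrier ell2_operators"
      using C.M.a_closed[OF closed(1) closed(1), of A A'] by simp
    ultimately show "path_p (A \<union> A') = path_p A \<oplus>\<^bsub>ell2_operators\<^esub> path_p A' \<ominus>\<^bsub>ell2_operators\<^esub> path_p (A \<inter> A')"
      by (simp add: minus_ell2_operators closed)
  next
    assume "{} \<in> \<B>"
    then have "\<not> snd (x 0) {}" if "char_path x" for x
      using char_path_character[OF that, of 0] by (simp add: character_def)
    then show "path_p {} = \<zero>\<^bsub>ell2_operators\<^esub>"
      by (auto intro!: blinfun_eqI ell2_eqI simp: nth_path_p)
  next
    fix a A assume a: "a \<in> letters" and "A \<in> \<B>"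
    have "ell2_nth (path_p A (path_s a f)) x = ell2_nth (path_s a (path_p (rel_range A [a]) f)) x" for f x
      using char_path_Some(3)[of x a A] char_path_shift[of x]
      by (simp add: nth_path_p nth_path_s a) (auto simp: shift_def)
    then show "path_p A \<otimes>\<^bsub>ell2_operators\<^esub> path_s a = path_s a \<otimes>\<^bsub>ell2_operators\<^esub> path_p (rel_range A [a])"
      by (auto intro!: blinfun_eqI ell2_eqI)
  next
    fix a b assume "a \<in> letters" "b \<in> letters" "a \<noteq> b"
    then show "(path_s a)\<^sup>\<star>\<^bsub>ell2_operators\<^esub> \<otimes>\<^bsub>ell2_operators\<^esub> path_s b = \<zero>\<^bsub>ell2_operators\<^esub>"
      by (auto intro!: blinfun_eqI ell2_eqI simp: nth_path_s nth_adj_path_s)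
  next
    fix A assume A: "A \<in> \<B>" "finite (emitted A)" "emitted A \<noteq> {}" "finite (A \<inter> sinks)"
    let ?f = "\<lambda>a. path_s a \<otimes>\<^bsub>ell2_operators\<^esub> path_p (rel_range A [a]) \<otimes>\<^bsub>ell2_operators\<^esub> (path_s a)\<^sup>\<star>\<^bsub>ell2_operators\<^esub>"
    have f: "?f \<in> emitted A \<rightarrow> carrier ell2_operators"
      by (intro Pi_I C.mult_closed C.star_closed closed) (simp_all add: emitted_iff)
    have "path_p A = (\<Sum>a\<in>emitted A. ?f a) + (\<Sum>v\<in>A \<inter> sinks. path_p {v})"
      using path_sum[OF A(1)] A
      by (intro blinfun_eqI ell2_eqI) (simp add: regular_def blinfun.add_left blinfun.sum_left ell2_nth_sum)
    then show "path_p A = (\<Oplus>\<^bsub>ell2_operators\<^esub>a\<in>emitted A. ?f a) \<oplus>\<^bsub>ell2_operators\<^esub>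
        (\<Oplus>\<^bsub>ell2_operators\<^esub>v\<in>A \<inter> sinks. path_p {v})"
      using f by (simp add: finsum_ell2_operators A closed Pi_iff del: ell2_operators_simps(2,6))
  qed
qed

text \<open>The characters along a graph path: \<open>A\<close> holds at position \<open>n\<close> if some later vertex of the
  path lies in the range of \<open>A\<close> under the labels in between. Point evaluation at the \<open>n\<close>-th
  vertex would not do, since several vertices may emit the same letter into the next one.\<close>

inductive traces :: "(nat \<Rightarrow> 'v) \<Rightarrow> (nat \<Rightarrow> 'a option) \<Rightarrow> nat \<Rightarrow> 'v set \<Rightarrow> bool"
  for vs lab where
  here: "vs n \<in> A \<Longrightarrow> traces vs lab n A"
| later: "\<lbrakk>lab n = Some a; traces vs lab (Suc n) (rel_range A [a])\<rbrakk> \<Longrightarrow> traces vs lab n A"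

lemma traces_not_empty: "traces vs lab n A \<Longrightarrow> A \<noteq> {}"
  by (induction rule: traces.induct) (auto simp: rel_range_empty)

lemma traces_mono: "\<lbrakk>traces vs lab n A; A \<subseteq> A'\<rbrakk> \<Longrightarrow> traces vs lab n A'"
proof (induction arbitrary: A' rule: traces.induct)
  case (here n A)
  then show ?case by (blast intro: traces.here)
next
  case (later n a A)
  have "rel_range A [a] \<subseteq> rel_range A' [a]"
    using later.prems unfolding subset_iff letter_range_iff by blast
  then show ?case using later.hyps(1) later.IH by (blast intro: traces.later)
qed

lemma traces_Un: "traces vs lab n (A \<union> A') \<longleftrightarrow> traces vs lab n A \<or> traces vs lab n A'"
proof
  have "traces vs lab n C \<Longrightarrow> C = A \<union> A' \<Longrightarrow> traces vs lab n A \<or> traces vs lab n A'" for C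
  proof (induction arbitrary: A A' rule: traces.induct)
    case (here n C)
    then show ?case by (blast intro: traces.here)
  next
    case (later n a C)
    have "traces vs lab (Suc n) (rel_range A [a]) \<or> traces vs lab (Suc n) (rel_range A' [a])"
      by (rule later.IH) (simp add: later.prems rel_range_Un)
    then show ?case using later.hyps(1) by (blast intro: traces.later)
  qed
  then show "traces vs lab n (A \<union> A') \<Longrightarrow> traces vs lab n A \<or> traces vs lab n A'" by blast
next
  assume "traces vs lab n A \<or> traces vs lab n A'"
  then show "traces vs lab n (A \<union> A')"
    using traces_mono[of vs lab n A "A \<union> A'"] traces_mono[of vs lab n A' "A \<union> A'"] by blast
qed

text \<open>Only positions with a letter tie consecutive vertices together; after a position without
  one the next vertex is free.\<close>

definition labels_path :: "(nat \<Rightarrow> 'v) \<Rightarrow> (nat \<Rightarrow> 'a option) \<Rightarrow> bool" where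
  "labels_path vs lab \<longleftrightarrow>
     (\<forall>n. case lab n of
        Some a \<Rightarrow> \<exists>e\<in>arcs G. tail G e = vs n \<and> L e = a \<and> head G e = vs (Suc n)
      | None \<Rightarrow> vs n \<in> sinks)"

lemma labels_path_Some:
  assumes "labels_path vs lab" "lab n = Some a"
  shows "a \<in> letters" "vs n \<in> A \<Longrightarrow> vs (Suc n) \<in> rel_range A [a]"
proof -
  obtain e where e: "e \<in> arcs G" "tail G e = vs n" "L e = a" "head G e = vs (Suc n)"
    using assms(1)[unfolded labels_path_def, THEN spec, of n] assms(2) by auto
  show "a \<in> letters" using e by (auto simp: letters_def)
  show "vs (Suc n) \<in> rel_range A [a]" if "vs n \<in> A"
    unfolding letter_range_iff using e that by (intro bexI[of _ e]) simp_all
qed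

text \<open>If the current vertex lies in A, the next one lies in the range of A, so nothing is lost
  by moving on. This is the equation between consecutive characters that \<open>path_step\<close>
  demands.\<close>

lemma traces_step:
  assumes "labels_path vs lab" "lab n = Some a"
  shows "traces vs lab n A \<longleftrightarrow> traces vs lab (Suc n) (rel_range A [a])"
proof
  assume "traces vs lab n A"
  then show "traces vs lab (Suc n) (rel_range A [a])"
  proof cases
    case here
    then show ?thesis by (intro traces.here labels_path_Some(2)[OF assms])
  next
    case (later a')
    then show ?thesis using assms(2) by simp
  qed
qed (rule traces.later[where lab = lab, OF assms(2)])

text \<open>The two sets may be met at different positions. The one met first is carried along the
  path to the position where the other is met; there one vertex lies in both, and weak
  left-resolvingness takes the intersection back letter by letter.\<close>

lemma traces_Int:
  assumes vs: "labels_path vs lab" and A: "A \<in> \<B>" "A' \<in> \<B>"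
  shows "traces vs lab n (A \<inter> A') \<longleftrightarrow> traces vs lab n A \<and> traces vs lab n A'"
proof
  have here: "traces vs lab n A' \<Longrightarrow> vs n \<in> A \<Longrightarrow> A \<in> \<B> \<Longrightarrow> A' \<in> \<B> \<Longrightarrow> traces vs lab n (A \<inter> A')" for n A A'
  proof (induction arbitrary: A rule: traces.induct)
    case (here n A')
    then show ?case by (blast intro: traces.here)
  next
    case (later n a A')
    note a = labels_path_Some[OF vs later.hyps(1)]
    have "traces vs lab (Suc n) (rel_range A [a] \<inter> rel_range A' [a])"
      using later.prems by (intro later.IH a letter_range_in_space)
    then show ?case
      using later.prems by (intro traces.later[where lab = lab, OF later.hyps(1)]) (simp add: letter_range_Int a(1))
  qed
  have "traces vs lab n A \<Longrightarrow> traces vs lab n A' \<Longrightarrow> A \<in> \<B> \<Longrightarrow> A' \<in> \<B> \<Longrightarrow> traces vs lab n (A \<inter> A')" for n A A'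
  proof (induction arbitrary: A' rule: traces.induct)
    case (here n A)
    then show ?case using \<open>\<And>n A A'. traces vs lab n A' \<Longrightarrow> vs n \<in> A \<Longrightarrow> A \<in> \<B> \<Longrightarrow> A' \<in> \<B> \<Longrightarrow> traces vs lab n (A \<inter> A')\<close> by blast
  next
    case (later n a A)
    note a = labels_path_Some[OF vs later.hyps(1)]
    have "traces vs lab (Suc n) (rel_range A [a] \<inter> rel_range A' [a])"
      using later.prems traces_step[OF vs later.hyps(1)]
      by (intro later.IH letter_range_in_space a(1)) simp_all
    then show ?case
      using later.prems by (intro traces.later[where lab = lab, OF later.hyps(1)]) (simp add: letter_range_Int a(1))
  qed
  then show "traces vs lab n A \<and> traces vs lab n A' \<Longrightarrow> traces vs lab n (A \<inter> A')" using A by blast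
next
  assume "traces vs lab n (A \<inter> A')"
  then show "traces vs lab n A \<and> traces vs lab n A'" by (blast intro: traces_mono)
qed

lemma char_path_traces:
  assumes vs: "labels_path vs lab" and verts: "\<And>n. vs n \<in> verts G"
  shows "char_path (\<lambda>n. (lab n, traces vs lab n))"
  unfolding char_path_def
proof
  fix n
  have "character (traces vs lab n)"
    using traces_not_empty by (auto simp: character_def traces_Un traces_Int[OF vs])
  moreover have "case lab n of
        Some a \<Rightarrow> a \<in> letters \<and> traces vs lab (Suc n) (lab_range [a])
          \<and> traces vs lab n = (\<lambda>A. traces vs lab (Suc n) (rel_range A [a]))
      | None \<Rightarrow> \<forall>A\<in>\<B>. regular A \<and> traces vs lab n A \<longrightarrow> (\<exists>v\<in>A \<inter> sinks. traces vs lab n {v})"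
  proof (cases "lab n")
    case (Some a)
    have "vs (Suc n) \<in> lab_range [a]"
      unfolding lab_range_def by (rule labels_path_Some(2)[OF vs Some verts])
    then show ?thesis
      using Some labels_path_Some(1)[OF vs Some] traces_step[OF vs Some] by (auto intro: traces.here)
  next
    case None
    have "vs n \<in> sinks" using vs[unfolded labels_path_def, THEN spec, of n] None by simp
    \<comment> \<open>Without a letter the rule \<open>later\<close> cannot apply, so the trace is
      evaluation at the vertex, which is the required sink.\<close>
    moreover have "vs n \<in> A" if "traces vs lab n A" for A
      using that by cases (simp_all add: None)
    moreover have "traces vs lab n {vs n}" by (rule traces.here) simp
    ultimately show ?thesis using None by auto
  qed
  ultimately show "path_step (fst (lab n, traces vs lab n)) (snd (lab n, traces vs lab n))
      (snd (lab (Suc n), traces vs lab (Suc n)))"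
    by (simp add: path_step_def)
qed

section \<open>A valid sequence through every nonempty set\<close>

text \<open>One outgoing edge is fixed at every vertex that has one, and the walk rests at a sink
  once it arrives there.\<close>

lemma labels_path_exists:
  assumes "v \<in> verts G"
  obtains vs lab where "labels_path vs lab" "vs 0 = v" "\<And>n. vs n \<in> verts G"
proof -
  define e where "e u = (SOME e. e \<in> out_arcs G u)" for u
  have e: "e u \<in> arcs G" "tail G (e u) = u" if "u \<in> verts G" "u \<notin> sinks" for u
  proof -
    have "\<exists>e. e \<in> out_arcs G u" using that by (auto simp: sinks_def)
    then have "e u \<in> out_arcs G u" unfolding e_def by (rule someI_ex)
    then show "e u \<in> arcs G" "tail G (e u) = u" by (auto simp: out_arcs_def)
  qed
  define next_vertex where "next_vertex u = (if u \<in> sinks then u else head G (e u))" for u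
  define vs where "vs n = (next_vertex ^^ n) v" for n
  define lab where "lab n = (if vs n \<in> sinks then None else Some (L (e (vs n))))" for n
  have verts: "vs n \<in> verts G" for n
  proof (induction n)
    case (Suc n)
    then show ?case using head_in_verts[OF e(1)] by (simp add: vs_def next_vertex_def)
  qed (simp add: vs_def assms)
  have "vs (Suc n) = next_vertex (vs n)" for n by (simp add: vs_def)
  then have "labels_path vs lab"
    using e[OF verts] by (auto simp: labels_path_def lab_def next_vertex_def)
  then show thesis using verts by (intro that[of vs lab]) (simp_all add: vs_def)
qed

lemma path_p_nonzero:
  assumes A: "A \<in> \<B>" "A \<noteq> {}"
  shows "path_p A \<noteq> 0"
proof
  assume 0: "path_p A = 0"
  obtain v where v: "v \<in> A" using A by blast
  then obtain vs lab where vs: "labels_path vs lab" "vs 0 = v" "\<And>n. vs n \<in> verts G"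
    using labels_path_exists sub_verts[OF A(1)] by blast
  define x where "x n = (lab n, traces vs lab n)" for n
  have "char_path x" unfolding x_def by (rule char_path_traces[OF vs(1,3)])
  moreover have "snd (x 0) A" using v vs(2) by (auto simp: x_def intro: traces.here)
  ultimately have "ell2_nth (path_p A (ell2_point x)) x = 1"
    by (simp add: nth_path_p nth_ell2_point)
  then show False by (simp add: 0)
qed

lemma lab_range_nonempty: assumes "a \<in> letters" shows "lab_range [a] \<noteq> {}"
proof -
  obtain e where e: "e \<in> arcs G" "L e = a" using assms by (auto simp: letters_def)
  have "head G e \<in> lab_range [a]"
    unfolding lab_range_def letter_range_iff using e tail_in_verts by blast
  then show ?thesis by blast
qed

end

theorem proposition5p7:
  fixes G :: "('v, 'e) pre_digraph" and L :: "'e \<Rightarrow> 'a" and \<B> :: "'v set set"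
  assumes "wlr_labelled_space G L \<B>"
  shows "\<exists>(B :: ('v, 'a) univ_carrier cstar_struct) s p.
    cstar_algebra B \<and>
    labelled_space_rep G L \<B> B s p \<and>
    rep_generates G L \<B> B s p \<and>
    rep_universal_for TYPE(('v, 'a) univ_carrier) G L \<B> B s p \<and>
    rep_universal_for TYPE('d) G L \<B> B s p \<and>
    (\<forall>a\<in>labelled_graph.letters G L. s a \<noteq> \<zero>\<^bsub>B\<^esub>) \<and>
    (\<forall>A\<in>\<B>. A \<noteq> {} \<longrightarrow> p A \<noteq> \<zero>\<^bsub>B\<^esub>)"
proof -
  interpret wlr_labelled_space G L \<B> by (rule assms)
  obtain B :: "('v, 'a) univ_carrier cstar_struct" and s p \<phi>
    where rep: "labelled_space_rep G L \<B> B s p" and gen: "rep_generates G L \<B> B s p"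
      and univ: "rep_universal_for TYPE(('v, 'a) univ_carrier) G L \<B> B s p"
        "rep_universal_for TYPE('d) G L \<B> B s p"
      and \<phi>: "star_hom B ell2_operators \<phi>" "\<And>A. A \<in> \<B> \<Longrightarrow> \<phi> (p A) = path_p A"
    by (rule universal_rep_exists[where 'd = 'd, OF path_rep]) (rule that, assumption, assumption, assumption, assumption, assumption, simp)
  interpret B: labelled_space_rep G L \<B> B s p by (rule rep)
  interpret \<phi>: star_homomorphism B ell2_operators \<phi>
    by (intro star_homomorphism.intro star_homomorphism_axioms.intro \<phi> B.cstar_algebra_axioms
        cstar_algebra_ell2_operators)
  \<comment> \<open>The homomorphism maps zero to zero, so a vanishing \<open>p A\<close> would make
    the concrete operator vanish.\<close>
  have p: "p A \<noteq> \<zero>\<^bsub>B\<^esub>" if "A \<in> \<B>" "A \<noteq> {}" for A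
    using path_p_nonzero[OF that] \<phi>(2)[OF that(1)] \<phi>.hom_zero by auto
  have s: "s a \<noteq> \<zero>\<^bsub>B\<^esub>" if a: "a \<in> letters" for a
  proof
    assume "s a = \<zero>\<^bsub>B\<^esub>"
    \<comment> \<open>The initial projection would vanish along with \<open>s a\<close>, although it
      belongs to a nonempty set because a labels an edge.\<close>
    then have "p (lab_range [a]) = \<zero>\<^bsub>B\<^esub>"
      using B.rep_initial[OF a] by (simp add: B.zero_star B.zero_mult)
    then show False using p[OF lab_range_in_space[OF a] lab_range_nonempty[OF a]] by simp
  qed
  show ?thesis
    by (intro exI[of _ B] exI[of _ s] exI[of _ p] conjI ballI impI B.cstar_algebra_axioms rep gen univ s p)
qed

end
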